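(* For a long virtual knot $K$ with closure $\widehat{K}$, we have the following. (i) $W(\widehat{K};t)=W_0(K;t)+W_1(K;t^{-1})$. (ii) $I(\widehat{K};t)=F_{01}(K;t)+G_{00}(K;t)+G_{11}(K;t^{-1})+H_{01}(K;t^{-1})$. (iii) $I\!I(\widehat{K};t)=F_{00}(K;t)+F_{11}(K;t)+G_{01}(K;t)+G_{01}(K;t^{-1})+G_{10}(K;t)+G_{10}(K;t^{-1})+H_{00}(K;t)+H_{11}(K;t)$.
   Context: A long virtual knot diagram is an immersed line in $\mathbb{R}^2$ that agrees with the $x$-axis outside some $2$-disk and has finitely many transversal double points, each being either a real crossing (with over/under information) or a virtual crossing (without it); it is oriented from $-\infty$ to $\infty$. A long virtual knot is an equivalence class of such diagrams under generalized Reidemeister moves (the classical moves I, II, III on real crossings, the three analogous moves on virtual crossings, and the mixed move passing a strand having only virtual crossings across a real crossing). Virtual knots are defined in the same way from closed oriented virtual knot diagrams (immersed circles). Let $D$ be a diagram of a long virtual knot $K$ with real crossings $c_1,\dots,c_n$, and let $\varepsilon_i\in\{1,-1\}$ be the sign of $c_i$. The crossing $c_i$ is of type $0$ if, travelling along $D$ from $-\infty$ to $\infty$, one passes $c_i$ first over and then under; otherwise it is of type $1$. For $a\in\{0,1\}$ put $I_a=\{i\mid c_i\text{ is of type }a\}$ and $\omega_a=\sum_{i\in I_a}\varepsilon_i$. A surface realization of $D$ is a closed, connected, oriented surface $\Sigma_g$ together with an oriented knot diagram on $\Sigma_g$ with a basepoint and with no virtual crossings, whose real crossings coincide with those of $D$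 (same order of passage, over/under information and signs), and whose basepoint corresponds to $\pm\infty$ of $D$. Smoothing this diagram at $c_i$ (respecting orientation) gives two oriented loops on $\Sigma_g$: $\alpha_i$ is the one not containing the basepoint and $\beta_i$ is the one containing it; they are regarded as homology cycles on $\Sigma_g$. The intersection numbers $\gamma\cdot\gamma'\in\mathbb{Z}$ of such cycles are independent of the choice of surface realization. Put $W_a(K;t)=\sum_{i\in I_a}\varepsilon_i(t^{\alpha_i\cdot\beta_i}-1)$ and, for $a,b\in\{0,1\}$, \[F_{ab}(K;t)=\sum_{i\in I_a,\,j\in I_b}\varepsilon_i\varepsilon_j(t^{\alpha_i\cdot\alpha_j}-1),\] \[G_{ab}(K;t)=\sum_{i\in I_a,\,j\in I_b}\varepsilon_i\varepsilon_j(t^{\alpha_i\cdot\beta_j}-1)-\omega_bW_a(K;t),\] \[H_{ab}(K;t)=\sum_{i\in I_a,\,j\in I_b}\varepsilon_i\varepsilon_j(t^{\beta_i\cdot\beta_j}-1)-\omega_aW_b(K;t)-\omega_bW_a(K;t^{-1}).\] These Laurent polynomials in $\mathbb{Z}[t,t^{-1}]$ depend only on $K$, not on $D$. The closure $\widehat{K}$ of $K$ is the virtual knot presented by the diagram $\widehat{D}$ obtained from $D$ by identifying $-\infty$ with $\infty$. For a virtual knot $\kappa$ with diagram $\Delta$ having real crossings $c_1,\dots,c_n$ of signs $\varepsilon_1,\dots,\varepsilon_n$, take a surface realization $(\Sigma_g,\Delta)$, that is, a closed, connected, oriented surface $\Sigma_g$ together with an oriented knot diagram on $\Sigma_g$ (without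 basepoint, and again denoted by $\Delta$) with no virtual crossings, whose real crossings coincide with those of the virtual knot diagram $\Delta$ (same cyclic order of passage, over/under information and signs). Let $\gamma_i$ (resp. $\overline{\gamma}_i$) be the cycle on $\Sigma_g$ presented by the part of $\Delta$ running from the overcrossing to the undercrossing (resp. from the undercrossing to the overcrossing) at $c_i$, and let $\omega(\Delta)=\sum_i\varepsilon_i$. The following are (known) invariants of $\kappa$, called the writhe polynomial, first intersection polynomial and second intersection polynomial: \[W(\kappa;t)=\sum_{i=1}^n\varepsilon_i(t^{\gamma_i\cdot\overline{\gamma}_i}-1),\] \[I(\kappa;t)=\sum_{i,j=1}^n\varepsilon_i\varepsilon_j(t^{\gamma_i\cdot\overline{\gamma}_j}-1)-\omega(\Delta)W(\kappa;t),\] \[I\!I(\kappa;t)=\sum_{i,j=1}^n\varepsilon_i\varepsilon_j(t^{\gamma_i\cdot\gamma_j}-1)+\sum_{i,j=1}^n\varepsilon_i\varepsilon_j(t^{\overline{\gamma}_i\cdot\overline{\gamma}_j}-1)-\omega(\Delta)\bigl(W(\kappa;t)+W(\kappa;t^{-1})\bigr).\] *)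

theory Defs
  imports
    "HOL-Analysis.Analysis"
    "HOL-Combinatorics.Permutations"
    "HOL-Combinatorics.Orbits"
    "HOL-Library.Poly_Mapping"
begin

section \<open>Virtual knot diagrams and long virtual knot diagrams\<close>

text \<open>
  The plane is the type of complex numbers. A diagram is a parametrized curve together with the
  set of its real crossings: a pair (s, t) in \<open>real_crossings\<close> is a real crossing whose overstrand
  is at parameter s and whose understrand is at parameter t. All other double points are virtual
  crossings.

  The parameters range over a set T, which is the whole line for long diagrams. The curve of a
  closed diagram is 1-periodic, and T is the fundamental domain \<open>{0..<1}\<close>.
\<close>

record diagram =
  curve :: "real \<Rightarrow> complex"
  real_crossings :: "(real \<times> real) set"

definition velocity :: "(real \<Rightarrow> complex) \<Rightarrow> real \<Rightarrow> complex" where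
  "velocity c t = vector_derivative c (at t)"

definition det2 :: "complex \<Rightarrow> complex \<Rightarrow> real" where
  "det2 v w = Re v * Im w - Im v * Re w"

definition double_points :: "real set \<Rightarrow> (real \<Rightarrow> complex) \<Rightarrow> (real \<times> real) set" where
  "double_points T c = {(s, t). s \<in> T \<and> t \<in> T \<and> s \<noteq> t \<and> c s = c t}"

definition virtual_diagram_on :: "real set \<Rightarrow> diagram \<Rightarrow> bool" where
  "virtual_diagram_on T D \<longleftrightarrow>
     curve D C1_differentiable_on UNIV \<and>
     (\<forall>t. velocity (curve D) t \<noteq> 0) \<and>
     finite (double_points T (curve D)) \<and>
     (\<forall>(s, t) \<in> double_points T (curve D). det2 (velocity (curve D) s) (velocity (curve D) t) \<noteq> 0) \<and>
     (\<forall>s\<in>T. \<forall>t\<in>T. \<forall>u\<in>T. curve D s = curve D t \<and> curve D t = curve D u \<longrightarrow> s = t \<or> t = u \<or> s = u) \<and>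
     real_crossings D \<subseteq> double_points T (curve D) \<and>
     (\<forall>s t. (s, t) \<in> real_crossings D \<longrightarrow> (t, s) \<notin> real_crossings D)"

definition long_diagram :: "diagram \<Rightarrow> bool" where
  "long_diagram D \<longleftrightarrow> virtual_diagram_on UNIV D \<and>
     (\<exists>R. \<forall>t. R \<le> \<bar>t\<bar> \<longrightarrow> curve D t = of_real t)"

definition closed_diagram :: "diagram \<Rightarrow> bool" where
  "closed_diagram D \<longleftrightarrow> virtual_diagram_on {0..<1} D \<and> (\<forall>t. curve D (t + 1) = curve D t)"

definition diagram_sign :: "diagram \<Rightarrow> real \<times> real \<Rightarrow> int" where
  "diagram_sign D = (\<lambda>(s, t). if 0 < det2 (velocity (curve D) s) (velocity (curve D) t) then 1 else -1)"


section \<open>Generalized Reidemeister moves\<close>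

definition orientation_preserving_diffeo :: "(complex \<Rightarrow> complex) \<Rightarrow> bool" where
  "orientation_preserving_diffeo \<phi> \<longleftrightarrow> bij \<phi> \<and>
     (\<exists>\<phi>'. (\<forall>z. (\<phi> has_derivative \<phi>' z) (at z)) \<and>
          (\<forall>v. continuous_on UNIV (\<lambda>z. \<phi>' z v)) \<and>
          (\<forall>z. 0 < det2 (\<phi>' z 1) (\<phi>' z \<i>)))"

definition increasing_diffeo :: "(real \<Rightarrow> real) \<Rightarrow> bool" where
  "increasing_diffeo h \<longleftrightarrow> h C1_differentiable_on UNIV \<and> surj h \<and> (\<forall>t. 0 < vector_derivative h (at t))"

text \<open>
  Plane isotopy combined with an orientation-preserving change of parameter. A diffeomorphism of
  the plane is isotopic to the identity if it preserves orientation, and through compactly supported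
  diffeomorphisms if it is moreover the identity outside some disk.
\<close>

definition long_isotopy :: "diagram \<Rightarrow> diagram \<Rightarrow> bool" where
  "long_isotopy D D' \<longleftrightarrow>
     (\<exists>\<phi> h R. orientation_preserving_diffeo \<phi> \<and> (\<forall>z. R \<le> norm z \<longrightarrow> \<phi> z = z) \<and>
        increasing_diffeo h \<and>
        curve D' = \<phi> \<circ> curve D \<circ> h \<and>
        real_crossings D' = {(s, t). (h s, h t) \<in> real_crossings D})"

definition closed_isotopy :: "diagram \<Rightarrow> diagram \<Rightarrow> bool" where
  "closed_isotopy D D' \<longleftrightarrow>
     (\<exists>\<phi> h. orientation_preserving_diffeo \<phi> \<and>
        increasing_diffeo h \<and> (\<forall>t. h (t + 1) = h t + 1) \<and>
        curve D' = \<phi> \<circ> curve D \<circ> h \<and>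
        real_crossings D' =
          {(s, t). s \<in> {0..<1} \<and> t \<in> {0..<1} \<and> (frac (h s), frac (h t)) \<in> real_crossings D})"

text \<open>
  Up to plane isotopy, every Reidemeister move can be assumed to take place in the following
  standard square, where it has a standard form and changes a single strand. The strands in the
  square are arcs of the curve over disjoint parameter intervals. In each definition the
  second diagram is obtained from the first by one move; inverse moves are supplied by taking the
  generated equivalence relation.
\<close>

definition square :: "complex set" where
  "square = {z. \<bar>Re z\<bar> \<le> 1 \<and> \<bar>Im z\<bar> \<le> 1}"

text \<open>f runs affinely through \<open>{-1..1}\<close> on \<open>{a..b}\<close>, in either direction.\<close>

definition sweeps :: "(real \<Rightarrow> real) \<Rightarrow> real \<Rightarrow> real \<Rightarrow> bool" where
  "sweeps f a b \<longleftrightarrow> a < b \<and> (\<exists>\<sigma>\<in>{1, -1}. \<forall>t\<in>{a..b}. f t = \<sigma> * ((2 * t - a - b) / (b - a)))"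

definition move_I :: "real set \<Rightarrow> diagram \<Rightarrow> diagram \<Rightarrow> bool" where
  "move_I T D D' \<longleftrightarrow>
     (\<exists>a b p q. {a..b} \<subseteq> T \<and>
        (\<forall>t\<in>T - {a..b}. curve D' t = curve D t \<and> curve D t \<notin> square) \<and>
        sweeps (\<lambda>t. Re (curve D t)) a b \<and>
        (\<forall>t\<in>{a..b}. Im (curve D t) = 0 \<and> curve D' t \<in> square) \<and>
        double_points {a..b} (curve D') = {(p, q), (q, p)} \<and>
        real_crossings D' \<in> {real_crossings D \<union> {(p, q)}, real_crossings D \<union> {(q, p)},
                             real_crossings D})"

text \<open>
  The real crossings of strands \<open>J 0, J 1, \<dots>\<close> when strand i runs over strand j for all (i, j) in
  \<open>\<rho>\<close>, while the crossings of other pairs of strands are virtual.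
\<close>

definition strand_crossings ::
    "(real \<Rightarrow> complex) \<Rightarrow> (nat \<Rightarrow> real set) \<Rightarrow> (nat \<times> nat) set \<Rightarrow> (real \<times> real) set" where
  "strand_crossings c J \<rho> = {(s, t). c s = c t \<and> (\<exists>(i, j)\<in>\<rho>. s \<in> J i \<and> t \<in> J j)}"

definition move_II :: "real set \<Rightarrow> diagram \<Rightarrow> diagram \<Rightarrow> bool" where
  "move_II T D D' \<longleftrightarrow>
     (\<exists>a b :: nat \<Rightarrow> real. \<exists>\<rho> \<in> {{(0, 1)}, {(1, 0)}, {}}.
        let c = curve D; c' = curve D'; J = (\<lambda>i. {a i..b i}) in
        J 0 \<subseteq> T \<and> J 1 \<subseteq> T \<and> J 0 \<inter> J 1 = {} \<and>
        (\<forall>t\<in>T - J 1. c' t = c t) \<and>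
        (\<forall>t\<in>T - J 0 - J 1. c t \<notin> square) \<and>
        sweeps (\<lambda>t. Re (c t)) (a 0) (b 0) \<and> (\<forall>t\<in>J 0. Im (c t) = 0) \<and>
        sweeps (\<lambda>t. Re (c t)) (a 1) (b 1) \<and>
        (\<forall>t\<in>J 1. Re (c' t) = Re (c t) \<and> 0 < Im (c t) \<and> Im (c t) < 1 \<and> \<bar>Im (c' t)\<bar> < 1) \<and>
        card {t \<in> J 1. Im (c' t) = 0} = 2 \<and>
        real_crossings D' = real_crossings D \<union> strand_crossings c' J \<rho>)"

text \<open>
  In move III the strands 0 and 1 run along the coordinate axes, and strand 2 is the graph of a
  decreasing function, which is moved across the origin. The three possibilities for \<open>\<rho>\<close> are
  the classical move (h gives the heights of the three strands), the virtual move and the mixed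
  move.
\<close>

definition move_III :: "real set \<Rightarrow> diagram \<Rightarrow> diagram \<Rightarrow> bool" where
  "move_III T D D' \<longleftrightarrow>
     (\<exists>(a :: nat \<Rightarrow> real) (b :: nat \<Rightarrow> real) \<rho> Y.
        let c = curve D; c' = curve D'; J = (\<lambda>i. {a i..b i}); U = J 0 \<union> J 1 \<union> J 2 in
        U \<subseteq> T \<and> J 0 \<inter> J 1 = {} \<and> J 0 \<inter> J 2 = {} \<and> J 1 \<inter> J 2 = {} \<and>
        (\<forall>t\<in>T - J 2. c' t = c t) \<and>
        (\<forall>t\<in>T - U. c t \<notin> square) \<and>
        sweeps (\<lambda>t. Re (c t)) (a 0) (b 0) \<and> (\<forall>t\<in>J 0. Im (c t) = 0) \<and>
        sweeps (\<lambda>t. Im (c t)) (a 1) (b 1) \<and> (\<forall>t\<in>J 1. Re (c t) = 0) \<and>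
        sweeps (\<lambda>t. Re (c t)) (a 2) (b 2) \<and>
        (\<forall>t\<in>J 2. Re (c' t) = Re (c t) \<and> \<bar>Im (c t)\<bar> < 1 \<and> \<bar>Im (c' t)\<bar> < 1) \<and>
        (\<forall>s\<in>J 2. \<forall>t\<in>J 2. Re (c s) < Re (c t) \<longrightarrow> Im (c t) < Im (c s) \<and> Im (c' t) < Im (c' s)) \<and>
        (\<forall>t\<in>J 2. Re (c t) = 0 \<longrightarrow> Im (c' t) < 0 \<and> 0 < Im (c t)) \<and>
        ((\<exists>h :: nat \<Rightarrow> nat. inj_on h {0, 1, 2} \<and> \<rho> = {(i, j). i \<in> {0, 1, 2} \<and> j \<in> {0, 1, 2} \<and> h j < h i}) \<or>
         \<rho> = {} \<or> \<rho> = {(0, 1)} \<or> \<rho> = {(1, 0)}) \<and>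
        (\<forall>(s, t)\<in>Y. s \<notin> U \<and> t \<notin> U) \<and>
        real_crossings D = Y \<union> strand_crossings c J \<rho> \<and>
        real_crossings D' = Y \<union> strand_crossings c' J \<rho>)"

definition long_equivalent :: "diagram \<Rightarrow> diagram \<Rightarrow> bool" where
  "long_equivalent = equivclp (\<lambda>D D'. long_diagram D \<and> long_diagram D' \<and>
     (long_isotopy D D' \<or> move_I UNIV D D' \<or> move_II UNIV D D' \<or> move_III UNIV D D'))"

text \<open>
  For closed diagrams, one can choose the parametrization such that the parameter 0 lies outside
  the strands involved in a move.
\<close>

definition closed_equivalent :: "diagram \<Rightarrow> diagram \<Rightarrow> bool" where
  "closed_equivalent = equivclp (\<lambda>D D'. closed_diagram D \<and> closed_diagram D' \<and>
     (closed_isotopy D D' \<or> move_I {0..<1} D D' \<or> move_II {0..<1} D D' \<or> move_III {0..<1} D D'))"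

definition long_virtual_knots :: "diagram set set" where
  "long_virtual_knots = {D. long_diagram D} // {(D, D'). long_equivalent D D'}"

definition virtual_knots :: "diagram set set" where
  "virtual_knots = {D. closed_diagram D} // {(D, D'). closed_equivalent D D'}"

text \<open>
  The closed diagram E first runs through the part of the long diagram D in a disk of radius R and
  then returns along a simple arc outside this disk.
\<close>

definition closure_diagram :: "diagram \<Rightarrow> diagram \<Rightarrow> bool" where
  "closure_diagram D E \<longleftrightarrow> long_diagram D \<and> closed_diagram E \<and>
     (\<exists>R>0.
        (\<forall>t. R \<le> \<bar>t\<bar> \<longrightarrow> curve D t = of_real t) \<and>
        (\<forall>t. \<bar>t\<bar> < R \<longrightarrow> norm (curve D t) < R) \<and>
        (\<forall>u\<in>{0..1/2}. curve E u = curve D (R * (4 * u - 1))) \<and>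
        (\<forall>u\<in>{1/2..1}. R \<le> norm (curve E u)) \<and> inj_on (curve E) {1/2..1} \<and>
        real_crossings E =
          {(u, v). u \<in> {0..1/2} \<and> v \<in> {0..1/2} \<and>
             (R * (4 * u - 1), R * (4 * v - 1)) \<in> real_crossings D})"

text \<open>All closures of diagrams of a long virtual knot present the same virtual knot.\<close>

definition closure_knot :: "diagram set \<Rightarrow> diagram set" where
  "closure_knot K = {E'. \<exists>D\<in>K. \<exists>E. closure_diagram D E \<and> closed_equivalent E E'}"


section \<open>Knot diagrams on closed surfaces\<close>

text \<open>
  A closed connected oriented surface with a cell decomposition is given by the finite set of
  its darts (oriented edges), the permutation \<open>rot\<close> sending a dart to the next one counterclockwise
  around its origin, and the involution \<open>opp\<close> reversing the darts. Vertices are the orbits of \<open>rot\<close>,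
  and faces are glued in along the boundary components of the resulting ribbon graph.

  A knot diagram on the surface is a closed walk in the 1-skeleton, given by the list of its darts,
  that passes every edge at most once and every vertex at most twice, such that any two passages
  through a vertex cross transversally. Position k of the walk is its passage through the origin of
  \<open>walk ! k\<close>. A pair (k, l) in \<open>over_under\<close> is a crossing with overpass at k and underpass at l.

  Every generic knot diagram on a closed oriented surface is of this form, since the surface can be
  subdivided such that the diagram becomes part of the 1-skeleton. The diagram is not required to
  be a cellular embedding.
\<close>

record surface_diagram =
  darts :: "nat set"
  rot :: "nat \<Rightarrow> nat"
  opp :: "nat \<Rightarrow> nat"
  walk :: "nat list"
  over_under :: "(nat \<times> nat) set"

definition closed_surface :: "surface_diagram \<Rightarrow> bool" where
  "closed_surface S \<longleftrightarrow> finite (darts S) \<and> darts S \<noteq> {} \<and>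
     rot S permutes darts S \<and> opp S permutes darts S \<and>
     (\<forall>d\<in>darts S. opp S d \<noteq> d \<and> opp S (opp S d) = d) \<and>
     (\<forall>d\<in>darts S. \<forall>e\<in>darts S. (d, e) \<in> {(x, y). y = rot S x \<or> y = opp S x}\<^sup>*)"

definition vertex :: "surface_diagram \<Rightarrow> nat \<Rightarrow> nat set" where
  "vertex S d = orbit (rot S) d"

definition out_dart :: "surface_diagram \<Rightarrow> nat \<Rightarrow> nat" where
  "out_dart S k = walk S ! k"

text \<open>The dart along which the walk arrives at position k, reversed so as to point away from the vertex.\<close>

definition in_dart :: "surface_diagram \<Rightarrow> nat \<Rightarrow> nat" where
  "in_dart S k = opp S (walk S ! ((k + length (walk S) - 1) mod length (walk S)))"

definition surface_double_points :: "surface_diagram \<Rightarrow> (nat \<times> nat) set" where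
  "surface_double_points S = {(k, l). k < length (walk S) \<and> l < length (walk S) \<and> k \<noteq> l \<and>
     vertex S (out_dart S k) = vertex S (out_dart S l)}"

text \<open>Rotating counterclockwise from the direction of the strand k, dart d comes before the reverse direction.\<close>

definition on_left :: "surface_diagram \<Rightarrow> nat \<Rightarrow> nat \<Rightarrow> bool" where
  "on_left S k d \<longleftrightarrow>
     funpow_dist (rot S) (out_dart S k) d < funpow_dist (rot S) (out_dart S k) (in_dart S k)"

definition surface_knot_diagram :: "surface_diagram \<Rightarrow> bool" where
  "surface_knot_diagram S \<longleftrightarrow> closed_surface S \<and>
     walk S \<noteq> [] \<and> set (walk S) \<subseteq> darts S \<and>
     distinct (walk S @ map (opp S) (walk S)) \<and>
     (\<forall>k<length (walk S). in_dart S k \<in> vertex S (out_dart S k)) \<and>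
     (\<forall>k l m. (k, l) \<in> surface_double_points S \<and> (l, m) \<in> surface_double_points S \<longrightarrow> k = m) \<and>
     (\<forall>(k, l) \<in> surface_double_points S. on_left S k (out_dart S l) \<noteq> on_left S k (in_dart S l)) \<and>
     over_under S \<subseteq> surface_double_points S \<and>
     (\<forall>(k, l) \<in> surface_double_points S. ((k, l) \<in> over_under S) \<noteq> ((l, k) \<in> over_under S))"

definition surface_sign :: "surface_diagram \<Rightarrow> nat \<times> nat \<Rightarrow> int" where
  "surface_sign S = (\<lambda>(k, l). if on_left S k (out_dart S l) then 1 else -1)"

text \<open>
  Realizations of long diagrams have their basepoint at position 0 of the walk, which is not
  a crossing. The map \<open>\<theta>\<close> sends passages through real crossings to passages through crossings.
\<close>

definition long_realization :: "diagram \<Rightarrow> surface_diagram \<Rightarrow> bool" where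
  "long_realization D S \<longleftrightarrow> surface_knot_diagram S \<and> 0 \<notin> Field (over_under S) \<and>
     (\<exists>\<theta>. strict_mono_on (Field (real_crossings D)) \<theta> \<and>
        over_under S = map_prod \<theta> \<theta> ` real_crossings D \<and>
        (\<forall>x\<in>real_crossings D. surface_sign S (map_prod \<theta> \<theta> x) = diagram_sign D x))"

definition cyclic_order :: "nat \<Rightarrow> nat \<Rightarrow> nat \<Rightarrow> bool" where
  "cyclic_order k l m \<longleftrightarrow> k < l \<and> l < m \<or> l < m \<and> m < k \<or> m < k \<and> k < l"

definition closed_realization :: "diagram \<Rightarrow> surface_diagram \<Rightarrow> bool" where
  "closed_realization D S \<longleftrightarrow> surface_knot_diagram S \<and>
     (\<exists>\<theta>. inj_on \<theta> (Field (real_crossings D)) \<and>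
        (\<forall>r\<in>Field (real_crossings D). \<forall>s\<in>Field (real_crossings D). \<forall>t\<in>Field (real_crossings D).
           r < s \<and> s < t \<longrightarrow> cyclic_order (\<theta> r) (\<theta> s) (\<theta> t)) \<and>
        over_under S = map_prod \<theta> \<theta> ` real_crossings D \<and>
        (\<forall>x\<in>real_crossings D. surface_sign S (map_prod \<theta> \<theta> x) = diagram_sign D x))"


section \<open>Cycles and intersection numbers\<close>

text \<open>
  Cellular 1-chains are functions f on darts with \<open>f (opp d) = - f d\<close>, and f is a cycle
  if its sum over every vertex vanishes. \<open>arc_cycle S k l\<close> is the part of the diagram running from
  position k to position l, a cycle if (k, l) is a crossing.
\<close>

definition arc_positions :: "surface_diagram \<Rightarrow> nat \<Rightarrow> nat \<Rightarrow> nat set" where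
  "arc_positions S k l = (if k < l then {k..<l} else {k..<length (walk S)} \<union> {0..<l})"

definition arc_cycle :: "surface_diagram \<Rightarrow> nat \<Rightarrow> nat \<Rightarrow> nat \<Rightarrow> int" where
  "arc_cycle S k l d =
     (\<Sum>j\<in>arc_positions S k l. of_bool (walk S ! j = d) - of_bool (opp S (walk S ! j) = d))"

text \<open>
  The intersection form of the surface on cellular cycles: around each vertex, the
  darts are listed counterclockwise, starting from an arbitrary one (here, the least one), and
  \<open>(f d * g e - f e * g d) / 2\<close> is summed over the pairs where d comes before e. For cycles the result is
  an integer, it does not depend on the starting darts, and it vanishes if f or g is the
  boundary of a face. A transverse intersection contributes 1 if the direction of f followed by that of g
  is a positive frame, and -1 otherwise.
\<close>

definition dart_before :: "surface_diagram \<Rightarrow> nat \<Rightarrow> nat \<Rightarrow> bool" where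
  "dart_before S d e \<longleftrightarrow>
     (let d\<^sub>0 = Min (vertex S d) in funpow_dist (rot S) d\<^sub>0 d < funpow_dist (rot S) d\<^sub>0 e)"

definition intersection_number :: "surface_diagram \<Rightarrow> (nat \<Rightarrow> int) \<Rightarrow> (nat \<Rightarrow> int) \<Rightarrow> int" where
  "intersection_number S f g =
     (\<Sum>d\<in>darts S. \<Sum>e\<in>{e \<in> vertex S d. dart_before S d e}. f d * g e - f e * g d) div 2"


section \<open>Laurent polynomials\<close>

text \<open>The ring of integer Laurent polynomials in t as the group ring of the integers.\<close>

type_synonym laurent = "int \<Rightarrow>\<^sub>0 int"

definition t_pow :: "int \<Rightarrow> laurent" where
  "t_pow k = Poly_Mapping.single k 1"

text \<open>The substitution of the inverse of t for t.\<close>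

definition invert :: "laurent \<Rightarrow> laurent" where
  "invert p = Poly_Mapping.map_key uminus p"


section \<open>Invariants of long virtual knots\<close>

definition typed_crossings :: "surface_diagram \<Rightarrow> nat \<Rightarrow> (nat \<times> nat) set" where
  "typed_crossings S a = {(k, l) \<in> over_under S. (if a = 0 then k < l else l < k)}"

definition typed_writhe :: "surface_diagram \<Rightarrow> nat \<Rightarrow> int" where
  "typed_writhe S a = (\<Sum>x\<in>typed_crossings S a. surface_sign S x)"

definition alpha :: "surface_diagram \<Rightarrow> nat \<times> nat \<Rightarrow> nat \<Rightarrow> int" where
  "alpha S = (\<lambda>(k, l). arc_cycle S (min k l) (max k l))"

definition beta :: "surface_diagram \<Rightarrow> nat \<times> nat \<Rightarrow> nat \<Rightarrow> int" where
  "beta S = (\<lambda>(k, l). arc_cycle S (max k l) (min k l))"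

definition W_long_diag :: "nat \<Rightarrow> surface_diagram \<Rightarrow> laurent" where
  "W_long_diag a S = (\<Sum>x\<in>typed_crossings S a.
     of_int (surface_sign S x) * (t_pow (intersection_number S (alpha S x) (beta S x)) - 1))"

definition F_diag :: "nat \<Rightarrow> nat \<Rightarrow> surface_diagram \<Rightarrow> laurent" where
  "F_diag a b S = (\<Sum>x\<in>typed_crossings S a. \<Sum>y\<in>typed_crossings S b.
     of_int (surface_sign S x * surface_sign S y) *
       (t_pow (intersection_number S (alpha S x) (alpha S y)) - 1))"

definition G_diag :: "nat \<Rightarrow> nat \<Rightarrow> surface_diagram \<Rightarrow> laurent" where
  "G_diag a b S = (\<Sum>x\<in>typed_crossings S a. \<Sum>y\<in>typed_crossings S b.
     of_int (surface_sign S x * surface_sign S y) *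
       (t_pow (intersection_number S (alpha S x) (beta S y)) - 1))
     - of_int (typed_writhe S b) * W_long_diag a S"

definition H_diag :: "nat \<Rightarrow> nat \<Rightarrow> surface_diagram \<Rightarrow> laurent" where
  "H_diag a b S = (\<Sum>x\<in>typed_crossings S a. \<Sum>y\<in>typed_crossings S b.
     of_int (surface_sign S x * surface_sign S y) *
       (t_pow (intersection_number S (beta S x) (beta S y)) - 1))
     - of_int (typed_writhe S a) * W_long_diag b S
     - of_int (typed_writhe S b) * invert (W_long_diag a S)"

text \<open>
  The common value of P on all surface realizations of all diagrams of K.
\<close>

definition long_invariant :: "(surface_diagram \<Rightarrow> laurent) \<Rightarrow> diagram set \<Rightarrow> laurent" where
  "long_invariant P K = (THE p. \<exists>D\<in>K. \<exists>S. long_realization D S \<and> p = P S)"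

definition W_long :: "nat \<Rightarrow> diagram set \<Rightarrow> laurent" where
  "W_long a = long_invariant (W_long_diag a)"

definition F_long :: "nat \<Rightarrow> nat \<Rightarrow> diagram set \<Rightarrow> laurent" where
  "F_long a b = long_invariant (F_diag a b)"

definition G_long :: "nat \<Rightarrow> nat \<Rightarrow> diagram set \<Rightarrow> laurent" where
  "G_long a b = long_invariant (G_diag a b)"

definition H_long :: "nat \<Rightarrow> nat \<Rightarrow> diagram set \<Rightarrow> laurent" where
  "H_long a b = long_invariant (H_diag a b)"


section \<open>Writhe polynomial and intersection polynomials of virtual knots\<close>

definition writhe :: "surface_diagram \<Rightarrow> int" where
  "writhe S = (\<Sum>x\<in>over_under S. surface_sign S x)"

definition gamma :: "surface_diagram \<Rightarrow> nat \<times> nat \<Rightarrow> nat \<Rightarrow> int" where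
  "gamma S = (\<lambda>(k, l). arc_cycle S k l)"

definition gamma_bar :: "surface_diagram \<Rightarrow> nat \<times> nat \<Rightarrow> nat \<Rightarrow> int" where
  "gamma_bar S = (\<lambda>(k, l). arc_cycle S l k)"

definition W_diag :: "surface_diagram \<Rightarrow> laurent" where
  "W_diag S = (\<Sum>x\<in>over_under S.
     of_int (surface_sign S x) * (t_pow (intersection_number S (gamma S x) (gamma_bar S x)) - 1))"

definition I_diag :: "surface_diagram \<Rightarrow> laurent" where
  "I_diag S = (\<Sum>x\<in>over_under S. \<Sum>y\<in>over_under S.
     of_int (surface_sign S x * surface_sign S y) *
       (t_pow (intersection_number S (gamma S x) (gamma_bar S y)) - 1))
     - of_int (writhe S) * W_diag S"

definition II_diag :: "surface_diagram \<Rightarrow> laurent" where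
  "II_diag S =
     (\<Sum>x\<in>over_under S. \<Sum>y\<in>over_under S. of_int (surface_sign S x * surface_sign S y) *
       (t_pow (intersection_number S (gamma S x) (gamma S y)) - 1))
     + (\<Sum>x\<in>over_under S. \<Sum>y\<in>over_under S. of_int (surface_sign S x * surface_sign S y) *
       (t_pow (intersection_number S (gamma_bar S x) (gamma_bar S y)) - 1))
     - of_int (writhe S) * (W_diag S + invert (W_diag S))"

definition closed_invariant :: "(surface_diagram \<Rightarrow> laurent) \<Rightarrow> diagram set \<Rightarrow> laurent" where
  "closed_invariant P \<kappa> = (THE p. \<exists>D\<in>\<kappa>. \<exists>S. closed_realization D S \<and> p = P S)"

definition writhe_polynomial :: "diagram set \<Rightarrow> laurent" where
  "writhe_polynomial = closed_invariant W_diag"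

definition first_intersection_polynomial :: "diagram set \<Rightarrow> laurent" where
  "first_intersection_polynomial = closed_invariant I_diag"

definition second_intersection_polynomial :: "diagram set \<Rightarrow> laurent" where
  "second_intersection_polynomial = closed_invariant II_diag"

end

theory Submission
  imports Defs
begin

text \<open>
  All polynomials involved are functions of the Gauss diagram, which records the order of the passages through
  the real crossings, the over/under information and the signs. The reason is that on any surface
  realization the intersection number of two arcs of the knot is the signed number of crossings at which
  one of them passes over or under the other, where a crossing at the end of an arc counts one half
  (\<open>intersection_number_arcs\<close>; the function \<open>pairing\<close> is four times this number, so that it is an integer).

  At a crossing of type 0 the closed loops \<open>\<gamma>\<close> and \<open>\<gamma>\<close>-bar are \<open>\<alpha>\<close> and \<open>\<beta>\<close>, at a crossing of type 1 they are
  \<open>\<beta>\<close> and \<open>\<alpha>\<close>. If the pairs of crossings in a closed polynomial are sorted by their types, then every part is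
  one of the sums in F, G, H, after exchanging the two loops, that is, inverting t, where necessary; the
  correction terms with the writhes match as well. This is the identity for a single Gauss diagram,
  \<open>closed_gauss_polys_eq\<close>, and the closure has the same Gauss diagram as the long knot.

  The invariants of knots are the common values on all realizations of all diagrams. They are therefore
  determined by a single diagram as soon as realizations and closures exist and the polynomials of a
  diagram are invariant. A realization is the ribbon graph of the Gauss diagram, with one
  four-valent vertex for each crossing. A closure is obtained by
  returning to the start along an arc outside a large disk. For the invariance, a
  Reidemeister move inserts an isolated chord (I) or two parallel chords of opposite signs (II), or it exchanges
  the adjacent ends of three chords (III), or it does not change the Gauss diagram at all. The first two
  cases are settled by the correction terms and by cancellation; in the third, no intersection number of
  loops changes. Applied to a closed diagram cut open at the parameter 0, the same arguments show that
  the long polynomials of the cut diagram do not change; by the identity above, these determine the closed ones.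
  Only isotopies move the cut, and the closed polynomials depend on nothing but the cyclic order.
\<close>

section \<open>Laurent polynomials with signed weights\<close>

lemma lookup_of_int_times:
  "Poly_Mapping.lookup (of_int c * p :: laurent) k = c * Poly_Mapping.lookup p k"
proof -
  have *: "Poly_Mapping.lookup (of_nat n * p) k = int n * Poly_Mapping.lookup p k" for n
    by (induct n) (simp_all add: algebra_simps lookup_add)
  show ?thesis
    by (cases c rule: int_cases2) (simp_all add: *)
qed

lemma lookup_invert: "Poly_Mapping.lookup (invert p) k = Poly_Mapping.lookup p (- k)"
  by (simp add: invert_def map_key.rep_eq)

lemma invert_add: "invert (p + q) = invert p + invert q"
  by (rule poly_mapping_eqI) (simp add: lookup_invert lookup_add)

lemma invert_diff: "invert (p - q) = invert p - invert q"
  by (rule poly_mapping_eqI) (simp add: lookup_invert lookup_minus)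

lemma invert_zero [simp]: "invert 0 = 0"
  by (rule poly_mapping_eqI) (simp add: lookup_invert)

lemma invert_of_int_times: "invert (of_int c * p) = of_int c * invert p"
  by (rule poly_mapping_eqI) (simp add: lookup_invert lookup_of_int_times)

lemma invert_sum: "invert (\<Sum>x\<in>A. f x) = (\<Sum>x\<in>A. invert (f x))"
  by (induct A rule: infinite_finite_induct) (simp_all add: invert_add)

lemma invert_t_pow: "invert (t_pow k) = t_pow (- k)"
  by (rule poly_mapping_eqI) (auto simp: lookup_invert t_pow_def lookup_single when_def)

lemma t_pow_zero: "t_pow 0 = 1"
  by (simp add: t_pow_def)

lemma invert_t_pow_minus_one: "invert (t_pow k - 1) = t_pow (- k) - 1"
  by (metis invert_diff invert_t_pow minus_zero t_pow_zero)

lemma invert_invert [simp]: "invert (invert p) = p"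
  by (rule poly_mapping_eqI) (simp add: lookup_invert)

definition weighted_sum :: "'c set \<Rightarrow> ('c \<Rightarrow> int) \<Rightarrow> ('c \<Rightarrow> int) \<Rightarrow> laurent" where
  "weighted_sum X w m = (\<Sum>x\<in>X. of_int (w x) * (t_pow (m x) - 1))"

definition weighted_double_sum ::
    "'c set \<Rightarrow> ('c \<Rightarrow> int) \<Rightarrow> ('c \<Rightarrow> int) \<Rightarrow> ('c \<Rightarrow> 'c \<Rightarrow> int) \<Rightarrow> laurent" where
  "weighted_double_sum X w v m = (\<Sum>x\<in>X. \<Sum>y\<in>X. of_int (w x * v y) * (t_pow (m x y) - 1))"

lemma weighted_sum_cong:
  "(\<And>x. x \<in> X \<Longrightarrow> w x \<noteq> 0 \<Longrightarrow> m x = m' x) \<Longrightarrow> weighted_sum X w m = weighted_sum X w m'"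
  unfolding weighted_sum_def by (rule sum.cong) (auto, metis)

lemma weighted_double_sum_cong:
  assumes "\<And>x y. x \<in> X \<Longrightarrow> y \<in> X \<Longrightarrow> w x \<noteq> 0 \<Longrightarrow> v y \<noteq> 0 \<Longrightarrow> m x y = m' x y"
  shows "weighted_double_sum X w v m = weighted_double_sum X w v m'"
  unfolding weighted_double_sum_def
proof (intro sum.cong refl)
  fix x y assume "x \<in> X" "y \<in> X"
  then show "of_int (w x * v y) * (t_pow (m x y) - 1) = of_int (w x * v y) * (t_pow (m' x y) - 1)"
    using assms[of x y] by (cases "w x = 0 \<or> v y = 0") auto
qed

lemma weighted_sum_add:
  "weighted_sum X (\<lambda>x. w x + w' x) m = weighted_sum X w m + weighted_sum X w' m"
  by (simp add: weighted_sum_def sum.distrib[symmetric] algebra_simps)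

lemma weighted_double_sum_add_left:
  "weighted_double_sum X (\<lambda>x. w x + w' x) v m =
     weighted_double_sum X w v m + weighted_double_sum X w' v m"
  by (simp add: weighted_double_sum_def sum.distrib[symmetric] algebra_simps)

lemma weighted_double_sum_add_right:
  "weighted_double_sum X w (\<lambda>x. v x + v' x) m =
     weighted_double_sum X w v m + weighted_double_sum X w v' m"
  by (simp add: weighted_double_sum_def sum.distrib[symmetric] algebra_simps)

lemma weighted_double_sum_swap:
  "weighted_double_sum X w v m = weighted_double_sum X v w (\<lambda>x y. m y x)"
  unfolding weighted_double_sum_def by (subst sum.swap) (simp add: mult.commute)

lemma invert_weighted_sum: "invert (weighted_sum X w m) = weighted_sum X w (\<lambda>x. - m x)"
  by (simp only: weighted_sum_def invert_sum invert_of_int_times invert_t_pow_minus_one)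

lemma invert_weighted_double_sum:
  "invert (weighted_double_sum X w v m) = weighted_double_sum X w v (\<lambda>x y. - m x y)"
  by (simp only: weighted_double_sum_def invert_sum invert_of_int_times invert_t_pow_minus_one)

lemma weighted_sum_reindex:
  assumes "bij_betw \<phi> X X'" "\<And>x. x \<in> X \<Longrightarrow> w' (\<phi> x) = w x" "\<And>x. x \<in> X \<Longrightarrow> m' (\<phi> x) = m x"
  shows "weighted_sum X' w' m' = weighted_sum X w m"
  unfolding weighted_sum_def
  by (subst sum.reindex_bij_betw[OF assms(1), symmetric]) (simp add: assms)

lemma weighted_double_sum_reindex:
  assumes "bij_betw \<phi> X X'" "\<And>x. x \<in> X \<Longrightarrow> w' (\<phi> x) = w x" "\<And>x. x \<in> X \<Longrightarrow> v' (\<phi> x) = v x"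
    and "\<And>x y. x \<in> X \<Longrightarrow> y \<in> X \<Longrightarrow> m' (\<phi> x) (\<phi> y) = m x y"
  shows "weighted_double_sum X' w' v' m' = weighted_double_sum X w v m"
  unfolding weighted_double_sum_def
  by (subst sum.reindex_bij_betw[OF assms(1), symmetric], rule sum.cong[OF refl],
      subst sum.reindex_bij_betw[OF assms(1), symmetric]) (simp add: assms)

text \<open>
  The four kinds of polynomials of a long knot depend on a set of crossings only through weights and
  two integer functions: \<open>n x y\<close> stands for four times the intersection number of the loops
  \<open>\<alpha>\<close> at x and y, and \<open>u x\<close> for twice the intersection number of \<open>\<alpha>\<close> at x with the whole knot.
  Since \<open>\<beta>\<close> is the whole knot minus \<open>\<alpha>\<close>, these determine all the other intersection numbers. The factors
  2 and 4 come from letting a strand count one half at the end of a loop.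
\<close>

definition poly_W :: "'c set \<Rightarrow> ('c \<Rightarrow> int) \<Rightarrow> ('c \<Rightarrow> int) \<Rightarrow> laurent" where
  "poly_W X w u = weighted_sum X w (\<lambda>x. u x div 2)"

definition poly_F :: "'c set \<Rightarrow> ('c \<Rightarrow> int) \<Rightarrow> ('c \<Rightarrow> int) \<Rightarrow> ('c \<Rightarrow> 'c \<Rightarrow> int) \<Rightarrow> laurent" where
  "poly_F X w v n = weighted_double_sum X w v (\<lambda>x y. n x y div 4)"

definition poly_G ::
    "'c set \<Rightarrow> ('c \<Rightarrow> int) \<Rightarrow> ('c \<Rightarrow> int) \<Rightarrow> ('c \<Rightarrow> int) \<Rightarrow> ('c \<Rightarrow> 'c \<Rightarrow> int) \<Rightarrow> laurent" where
  "poly_G X w v u n = weighted_double_sum X w v (\<lambda>x y. (2 * u x - n x y) div 4)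
     - of_int (\<Sum>x\<in>X. v x) * poly_W X w u"

definition poly_H ::
    "'c set \<Rightarrow> ('c \<Rightarrow> int) \<Rightarrow> ('c \<Rightarrow> int) \<Rightarrow> ('c \<Rightarrow> int) \<Rightarrow> ('c \<Rightarrow> 'c \<Rightarrow> int) \<Rightarrow> laurent" where
  "poly_H X w v u n = weighted_double_sum X w v (\<lambda>x y. (2 * u y - 2 * u x + n x y) div 4)
     - of_int (\<Sum>x\<in>X. w x) * poly_W X v u - of_int (\<Sum>x\<in>X. v x) * invert (poly_W X w u)"

definition long_polys ::
    "'c set \<Rightarrow> ('c \<Rightarrow> int) \<Rightarrow> ('c \<Rightarrow> int) \<Rightarrow> ('c \<Rightarrow> int) \<Rightarrow> ('c \<Rightarrow> 'c \<Rightarrow> int)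
      \<Rightarrow> laurent \<times> laurent \<times> laurent \<times> laurent" where
  "long_polys X w v u n = (poly_W X w u, poly_F X w v n, poly_G X w v u n, poly_H X w v u n)"

lemma long_polys_reindex:
  assumes "bij_betw \<phi> X X'" "\<And>x. x \<in> X \<Longrightarrow> w' (\<phi> x) = w x" "\<And>x. x \<in> X \<Longrightarrow> v' (\<phi> x) = v x"
    and "\<And>x. x \<in> X \<Longrightarrow> u' (\<phi> x) = u x"
    and "\<And>x y. x \<in> X \<Longrightarrow> y \<in> X \<Longrightarrow> n' (\<phi> x) (\<phi> y) = n x y"
  shows "long_polys X' w' v' u' n' = long_polys X w v u n"
proof -
  have W: "poly_W X' w' u' = poly_W X w u" "poly_W X' v' u' = poly_W X v u"
    unfolding poly_W_def by (rule weighted_sum_reindex[OF assms(1)]; simp add: assms)+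
  have s: "(\<Sum>x\<in>X'. w' x) = (\<Sum>x\<in>X. w x)" "(\<Sum>x\<in>X'. v' x) = (\<Sum>x\<in>X. v x)"
    by (subst sum.reindex_bij_betw[OF assms(1), symmetric], simp add: assms)+
  show ?thesis
    unfolding long_polys_def poly_F_def poly_G_def poly_H_def W s
    using assms by (auto intro!: arg_cong2[of _ _ _ _ "(-)"] weighted_double_sum_reindex)
qed

lemma long_polys_cong:
  assumes "\<And>x. x \<in> X \<Longrightarrow> w' x = w x" "\<And>x. x \<in> X \<Longrightarrow> v' x = v x"
    and "\<And>x. x \<in> X \<Longrightarrow> u' x = u x" "\<And>x y. x \<in> X \<Longrightarrow> y \<in> X \<Longrightarrow> n' x y = n x y"
  shows "long_polys X w' v' u' n' = long_polys X w v u n"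
  by (rule long_polys_reindex[where \<phi> = id]) (use assms in auto)

lemma weighted_sum_insert:
  assumes "finite X" "x\<^sub>0 \<notin> X"
  shows "weighted_sum (insert x\<^sub>0 X) w m = of_int (w x\<^sub>0) * (t_pow (m x\<^sub>0) - 1) + weighted_sum X w m"
  using assms by (simp add: weighted_sum_def)

lemma weighted_double_sum_insert:
  assumes "finite X" "x\<^sub>0 \<notin> X"
  shows "weighted_double_sum (insert x\<^sub>0 X) w v m =
     of_int (w x\<^sub>0 * v x\<^sub>0) * (t_pow (m x\<^sub>0 x\<^sub>0) - 1)
     + of_int (w x\<^sub>0) * weighted_sum X v (m x\<^sub>0)
     + of_int (v x\<^sub>0) * weighted_sum X w (\<lambda>x. m x x\<^sub>0)
     + weighted_double_sum X w v m"
  using assms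
  by (simp add: weighted_double_sum_def weighted_sum_def sum.distrib sum_distrib_left mult.assoc
      mult.left_commute add.assoc)

text \<open>
  The correction terms of G and H are made for this: when one of the two loops is trivial, the
  other one only meets the whole knot.
\<close>

lemma long_polys_insert_kink:
  assumes "finite X" "x\<^sub>0 \<notin> X" "u x\<^sub>0 = 0"
    and "\<And>y. y \<in> insert x\<^sub>0 X \<Longrightarrow> n x\<^sub>0 y = 0 \<and> n y x\<^sub>0 = 0"
    and even: "\<And>x. x \<in> X \<Longrightarrow> even (u x)"
  shows "long_polys (insert x\<^sub>0 X) w v u n = long_polys X w v u n"
proof -
  have W: "poly_W (insert x\<^sub>0 X) w u = poly_W X w u" for w
    using assms(1-3) by (simp add: poly_W_def weighted_sum_insert t_pow_zero)
  have c0: "weighted_sum X w (\<lambda>x. n x\<^sub>0 x div 4) = 0" "weighted_sum X w (\<lambda>x. n x x\<^sub>0 div 4) = 0" for w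
    using assms(4) by (simp_all add: weighted_sum_def t_pow_zero)
  have c1: "weighted_sum X w (\<lambda>y. (2 * u x\<^sub>0 - n x\<^sub>0 y) div 4) = 0" for w
    using assms(3,4) by (simp_all add: weighted_sum_def t_pow_zero)
  have c2: "weighted_sum X w (\<lambda>x. (2 * u x - n x x\<^sub>0) div 4) = poly_W X w u" for w
    unfolding poly_W_def by (rule weighted_sum_cong) (simp add: assms(4))
  have c3: "weighted_sum X w (\<lambda>y. (2 * u y - 2 * u x\<^sub>0 + n x\<^sub>0 y) div 4) = poly_W X w u" for w
    unfolding poly_W_def by (rule weighted_sum_cong) (simp add: assms(3,4))
  have c4: "weighted_sum X w (\<lambda>x. (2 * u x\<^sub>0 - 2 * u x + n x x\<^sub>0) div 4) = invert (poly_W X w u)" for w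
    unfolding poly_W_def invert_weighted_sum
  proof (rule weighted_sum_cong)
    fix x assume "x \<in> X"
    then show "(2 * u x\<^sub>0 - 2 * u x + n x x\<^sub>0) div 4 = - (u x div 2)"
      using even[of x] by (auto simp: assms(3,4) elim!: evenE)
  qed
  have n00: "n x\<^sub>0 x\<^sub>0 = 0" using assms(4) by simp
  note ins = weighted_double_sum_insert[OF assms(1,2)]
  have F: "poly_F (insert x\<^sub>0 X) w v n = poly_F X w v n"
    unfolding poly_F_def ins c0 by (simp add: n00 t_pow_zero)
  have G: "poly_G (insert x\<^sub>0 X) w v u n = poly_G X w v u n"
    unfolding poly_G_def W ins c1 c2 using assms(1,2)
    by (simp add: n00 assms(3) t_pow_zero distrib_right)
  have H: "poly_H (insert x\<^sub>0 X) w v u n = poly_H X w v u n"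
    unfolding poly_H_def W ins c3 c4 using assms(1,2)
    by (simp add: n00 assms(3) t_pow_zero distrib_right)
  show ?thesis
    unfolding long_polys_def F G H W ..
qed

text \<open>
  The two new crossings have equal rows and equal columns of intersection numbers, and the sums are
  bilinear in the weights, which add up to zero on the new crossings.
\<close>

lemma long_polys_insert_cancelling_pair:
  assumes fin: "finite X" and new: "x\<^sub>1 \<notin> X" "x\<^sub>2 \<notin> X" "x\<^sub>1 \<noteq> x\<^sub>2"
    and w: "w x\<^sub>1 + w x\<^sub>2 = 0" and v: "v x\<^sub>1 + v x\<^sub>2 = 0" and u: "u x\<^sub>1 = u x\<^sub>2"
    and n: "\<And>y. y \<in> insert x\<^sub>1 (insert x\<^sub>2 X) \<Longrightarrow> n x\<^sub>1 y = n x\<^sub>2 y \<and> n y x\<^sub>1 = n y x\<^sub>2"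
  shows "long_polys (insert x\<^sub>1 (insert x\<^sub>2 X)) w v u n = long_polys X w v u n"
proof -
  let ?Y = "insert x\<^sub>1 (insert x\<^sub>2 X)"
  have S: "weighted_sum ?Y w m = weighted_sum X w m"
    if "w x\<^sub>1 + w x\<^sub>2 = 0" "m x\<^sub>1 = m x\<^sub>2" for w m :: "'a \<Rightarrow> int"
  proof -
    have "w x\<^sub>1 = - w x\<^sub>2" using that(1) by simp
    then show ?thesis using fin new that(2) by (simp add: weighted_sum_insert)
  qed
  have SS: "weighted_double_sum ?Y w v m = weighted_double_sum X w v m"
    if m: "\<And>y. y \<in> ?Y \<Longrightarrow> m x\<^sub>1 y = m x\<^sub>2 y" "\<And>y. y \<in> ?Y \<Longrightarrow> m y x\<^sub>1 = m y x\<^sub>2" for m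
  proof -
    have e: "weighted_double_sum Z w v m = (\<Sum>x\<in>Z. of_int (w x) * weighted_sum Z v (m x))" for Z
      by (simp add: weighted_double_sum_def weighted_sum_def sum_distrib_left mult.assoc)
    have "weighted_double_sum ?Y w v m = (\<Sum>x\<in>?Y. of_int (w x) * weighted_sum X v (m x))"
      unfolding e by (rule sum.cong) (auto intro!: arg_cong2[of _ _ _ _ "(*)"] S v m(2))
    also have "\<dots> = (\<Sum>x\<in>X. of_int (w x) * weighted_sum X v (m x))"
    proof -
      have 1: "w x\<^sub>1 = - w x\<^sub>2" using w by simp
      have 2: "weighted_sum X v (m x\<^sub>1) = weighted_sum X v (m x\<^sub>2)"
        by (rule weighted_sum_cong) (simp add: m)
      show ?thesis using fin new by (simp add: 1 2)
    qed
    finally show ?thesis by (simp add: e)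
  qed
  have W: "poly_W ?Y w u = poly_W X w u" "poly_W ?Y v u = poly_W X v u"
    unfolding poly_W_def using w v u by (auto intro!: S)
  have s: "(\<Sum>x\<in>?Y. w x) = (\<Sum>x\<in>X. w x)" "(\<Sum>x\<in>?Y. v x) = (\<Sum>x\<in>X. v x)"
    using fin new w v by auto
  have F: "poly_F ?Y w v n = poly_F X w v n"
    unfolding poly_F_def by (rule SS) (simp_all add: n)
  have G: "poly_G ?Y w v u n = poly_G X w v u n"
    unfolding poly_G_def W s
    by (rule arg_cong2[of _ _ _ _ "(-)"], rule SS) (simp_all add: n u)
  have H: "poly_H ?Y w v u n = poly_H X w v u n"
    unfolding poly_H_def W s
    by (intro arg_cong2[of _ _ _ _ "(-)"], rule SS) (simp_all add: n u)
  show ?thesis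
    unfolding long_polys_def F G H W ..
qed

section \<open>The identities\<close>

text \<open>
  The closed polynomials in the same abstract form. At a crossing of type 0 (\<open>\<tau>\<close> holds) the arcs
  \<open>\<gamma>\<close> and \<open>\<gamma>\<close>-bar are \<open>\<alpha>\<close> and \<open>\<beta>\<close>; at a crossing of type 1 they are exchanged.
  Sorting the terms of a closed polynomial by the types of its crossings gives the long polynomials.
\<close>

lemma closed_polys_from_long_polys:
  fixes X :: "'c set" and \<tau> :: "'c \<Rightarrow> bool"
  assumes aa: "\<And>x y. x \<in> X \<Longrightarrow> y \<in> X \<Longrightarrow> 4 * aa x y = n x y"
    and ab: "\<And>x y. x \<in> X \<Longrightarrow> y \<in> X \<Longrightarrow> 4 * ab x y = 2 * u x - n x y"
    and bb: "\<And>x y. x \<in> X \<Longrightarrow> y \<in> X \<Longrightarrow> 4 * bb x y = 2 * u y - 2 * u x + n x y"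
    and antisym: "\<And>x y. x \<in> X \<Longrightarrow> y \<in> X \<Longrightarrow> n y x = - n x y"
    and w0: "\<And>x. w\<^sub>0 x \<noteq> 0 \<Longrightarrow> \<tau> x" and w1: "\<And>x. w\<^sub>1 x \<noteq> 0 \<Longrightarrow> \<not> \<tau> x"
    and e: "\<And>x. e x = w\<^sub>0 x + w\<^sub>1 x"
    and gg: "\<And>x y. x \<in> X \<Longrightarrow> y \<in> X \<Longrightarrow>
      gg x y = (if \<tau> x then if \<tau> y then aa x y else ab x y else if \<tau> y then - ab y x else bb x y)"
    and gh: "\<And>x y. x \<in> X \<Longrightarrow> y \<in> X \<Longrightarrow>
      gh x y = (if \<tau> x then if \<tau> y then ab x y else aa x y else if \<tau> y then bb x y else - ab y x)"
    and hh: "\<And>x y. x \<in> X \<Longrightarrow> y \<in> X \<Longrightarrow>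
      hh x y = (if \<tau> x then if \<tau> y then bb x y else - ab y x else if \<tau> y then ab x y else aa x y)"
  defines "W \<equiv> weighted_sum X e (\<lambda>x. gh x x)"
  shows "W = poly_W X w\<^sub>0 u + invert (poly_W X w\<^sub>1 u)" (is ?W)
    and "weighted_double_sum X e e gh - of_int (\<Sum>x\<in>X. e x) * W =
      poly_F X w\<^sub>0 w\<^sub>1 n + poly_G X w\<^sub>0 w\<^sub>0 u n + invert (poly_G X w\<^sub>1 w\<^sub>1 u n)
      + invert (poly_H X w\<^sub>0 w\<^sub>1 u n)" (is ?I)
    and "weighted_double_sum X e e gg + weighted_double_sum X e e hh
        - of_int (\<Sum>x\<in>X. e x) * (W + invert W) =
      poly_F X w\<^sub>0 w\<^sub>0 n + poly_F X w\<^sub>1 w\<^sub>1 n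
      + poly_G X w\<^sub>0 w\<^sub>1 u n + invert (poly_G X w\<^sub>0 w\<^sub>1 u n)
      + poly_G X w\<^sub>1 w\<^sub>0 u n + invert (poly_G X w\<^sub>1 w\<^sub>0 u n)
      + poly_H X w\<^sub>0 w\<^sub>0 u n + poly_H X w\<^sub>1 w\<^sub>1 u n" (is ?II)
proof -
  have e': "e = (\<lambda>x. w\<^sub>0 x + w\<^sub>1 x)" using e by blast
  have n0: "n x x = 0" if "x \<in> X" for x using antisym[OF that that] by simp
  have abu: "ab x x = u x div 2" if "x \<in> X" for x
    using ab[OF that that] n0[OF that] by simp
  have bb_antisym: "bb y x = - bb x y" if "x \<in> X" "y \<in> X" for x y
    using bb[OF that] bb[OF that(2,1)] antisym[OF that] by simp
  have [simp]: "n x y div 4 = aa x y" "(2 * u x - n x y) div 4 = ab x y"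
    "(2 * u y - 2 * u x + n x y) div 4 = bb x y" if "x \<in> X" "y \<in> X" for x y
    using aa[OF that] ab[OF that] bb[OF that] by simp_all
  define W0 W1 where "W0 = poly_W X w\<^sub>0 u" and "W1 = poly_W X w\<^sub>1 u"
  have W0: "weighted_sum X w\<^sub>0 (\<lambda>x. gh x x) = W0"
    unfolding W0_def poly_W_def by (rule weighted_sum_cong) (auto simp: gh abu w0)
  have W1: "weighted_sum X w\<^sub>1 (\<lambda>x. gh x x) = invert W1"
    unfolding W1_def poly_W_def invert_weighted_sum
    by (rule weighted_sum_cong) (auto simp: gh abu w1)
  show W: ?W
    unfolding W_def e' by (simp add: weighted_sum_add W0 W1 flip: W0_def W1_def)
  let ?S = "weighted_double_sum X"
  have by_types: "?S e e m = ?S w\<^sub>0 w\<^sub>0 m + ?S w\<^sub>0 w\<^sub>1 m + ?S w\<^sub>1 w\<^sub>0 m + ?S w\<^sub>1 w\<^sub>1 m" for m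
    unfolding e' by (simp add: weighted_double_sum_add_left weighted_double_sum_add_right)
  have F: "poly_F X w v n = ?S w v aa" for w v
    unfolding poly_F_def by (rule weighted_double_sum_cong) simp
  have G: "poly_G X w v u n = ?S w v ab - of_int (\<Sum>x\<in>X. v x) * poly_W X w u" for w v
    unfolding poly_G_def
    by (rule arg_cong2[of _ _ _ _ "(-)"], rule weighted_double_sum_cong) simp_all
  have H: "poly_H X w v u n = ?S w v bb - of_int (\<Sum>x\<in>X. w x) * poly_W X v u
      - of_int (\<Sum>x\<in>X. v x) * invert (poly_W X w u)" for w v
    unfolding poly_H_def
    by (intro arg_cong2[of _ _ _ _ "(-)"], rule weighted_double_sum_cong) simp_all
  have gh00: "?S w\<^sub>0 w\<^sub>0 gh = ?S w\<^sub>0 w\<^sub>0 ab" and gh01: "?S w\<^sub>0 w\<^sub>1 gh = ?S w\<^sub>0 w\<^sub>1 aa"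
    and gg00: "?S w\<^sub>0 w\<^sub>0 gg = ?S w\<^sub>0 w\<^sub>0 aa" and gg01: "?S w\<^sub>0 w\<^sub>1 gg = ?S w\<^sub>0 w\<^sub>1 ab"
    and gg11: "?S w\<^sub>1 w\<^sub>1 gg = ?S w\<^sub>1 w\<^sub>1 bb"
    and hh00: "?S w\<^sub>0 w\<^sub>0 hh = ?S w\<^sub>0 w\<^sub>0 bb" and hh10: "?S w\<^sub>1 w\<^sub>0 hh = ?S w\<^sub>1 w\<^sub>0 ab"
    and hh11: "?S w\<^sub>1 w\<^sub>1 hh = ?S w\<^sub>1 w\<^sub>1 aa"
    by (rule weighted_double_sum_cong, use w0 w1 in \<open>auto simp: gg gh hh\<close>)+
  have gh10: "?S w\<^sub>1 w\<^sub>0 gh = invert (?S w\<^sub>0 w\<^sub>1 bb)"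
    unfolding invert_weighted_double_sum weighted_double_sum_swap[of _ "w\<^sub>1" "w\<^sub>0"]
    by (rule weighted_double_sum_cong) (use w0 w1 in \<open>auto simp: gh intro: bb_antisym\<close>)
  have gh11: "?S w\<^sub>1 w\<^sub>1 gh = invert (?S w\<^sub>1 w\<^sub>1 ab)"
    unfolding invert_weighted_double_sum weighted_double_sum_swap[of _ "w\<^sub>1" "w\<^sub>1" gh]
    by (rule weighted_double_sum_cong) (use w0 w1 in \<open>auto simp: gh\<close>)
  have gg10: "?S w\<^sub>1 w\<^sub>0 gg = invert (?S w\<^sub>0 w\<^sub>1 ab)"
    unfolding invert_weighted_double_sum weighted_double_sum_swap[of _ "w\<^sub>1" "w\<^sub>0"]
    by (rule weighted_double_sum_cong) (use w0 w1 in \<open>auto simp: gg\<close>)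
  have hh01: "?S w\<^sub>0 w\<^sub>1 hh = invert (?S w\<^sub>1 w\<^sub>0 ab)"
    unfolding invert_weighted_double_sum weighted_double_sum_swap[of _ "w\<^sub>0" "w\<^sub>1" hh]
    by (rule weighted_double_sum_cong) (use w0 w1 in \<open>auto simp: hh\<close>)
  have s: "(\<Sum>x\<in>X. e x) = (\<Sum>x\<in>X. w\<^sub>0 x) + (\<Sum>x\<in>X. w\<^sub>1 x)"
    by (simp add: e sum.distrib)
  note inv = invert_diff invert_add invert_of_int_times invert_invert of_int_add
  have ring_I: "(a + b + c + d) - (s + t) * (p + q) =
      b + (a - s * p) + (d - t * q) + (c - s * q - t * p)" for a b c d s t p q :: laurent
    by (simp add: algebra_simps)
  have ring_II: "(a + b + c + d) + (a' + b' + c' + d') - (s + t) * ((p + q') + (p' + q)) =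
      a + d' + (b - t * p) + (c - t * p') + (c' - s * q) + (b' - s * q')
      + (a' - s * p - s * p') + (d - t * q - t * q')"
    for a b c d a' b' c' d' s t p q p' q' :: laurent
    by (simp add: algebra_simps)
  show ?I
    unfolding by_types W F G H s gh00 gh01 gh10 gh11 inv by (rule ring_I)
  show ?II
    unfolding by_types W F G H s gg00 gg01 gg10 gg11 hh00 hh01 hh10 hh11 inv by (rule ring_II)
qed

section \<open>Gauss diagrams\<close>

definition cyc :: "'a::linorder \<Rightarrow> 'a \<Rightarrow> 'a \<Rightarrow> bool" where
  "cyc r s t \<longleftrightarrow> r < s \<and> s < t \<or> s < t \<and> t < r \<or> t < r \<and> r < s"

text \<open>Twice the indicator function of the arc from k to l, whose ends count one half.\<close>

definition cyclic_arc :: "'a::linorder \<Rightarrow> 'a \<Rightarrow> 'a \<Rightarrow> int" where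
  "cyclic_arc k l r = (if r = k \<or> r = l then 1 else if cyc k r l then 2 else 0)"

definition alpha_arc :: "'a::linorder \<times> 'a \<Rightarrow> 'a \<Rightarrow> int" where
  "alpha_arc x = cyclic_arc (min (fst x) (snd x)) (max (fst x) (snd x))"

definition beta_arc :: "'a::linorder \<times> 'a \<Rightarrow> 'a \<Rightarrow> int" where
  "beta_arc x = cyclic_arc (max (fst x) (snd x)) (min (fst x) (snd x))"

text \<open>
  Four times the intersection number, if f and g are arcs: each summand compares the strand of one arc
  over a crossing with the strand of the other one under it.
\<close>

definition pairing ::
    "('a \<times> 'a) set \<Rightarrow> ('a \<times> 'a \<Rightarrow> int) \<Rightarrow> ('a \<Rightarrow> int) \<Rightarrow> ('a \<Rightarrow> int) \<Rightarrow> int" where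
  "pairing X e f g = (\<Sum>x\<in>X. e x * (f (fst x) * g (snd x) - f (snd x) * g (fst x)))"

definition gauss_diagram :: "('a \<times> 'a) set \<Rightarrow> ('a \<times> 'a \<Rightarrow> int) \<Rightarrow> bool" where
  "gauss_diagram X e \<longleftrightarrow> finite X \<and> inj_on fst X \<and> inj_on snd X \<and> fst ` X \<inter> snd ` X = {} \<and>
     (\<forall>x\<in>X. e x \<in> {1, -1})"

definition typed_weight :: "('a::linorder \<times> 'a \<Rightarrow> int) \<Rightarrow> nat \<Rightarrow> 'a \<times> 'a \<Rightarrow> int" where
  "typed_weight e a x = (if (if a = 0 then fst x < snd x else snd x < fst x) then e x else 0)"

definition gauss_polys ::
    "('a::linorder \<times> 'a) set \<Rightarrow> ('a \<times> 'a \<Rightarrow> int) \<Rightarrow> nat \<Rightarrow> nat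
      \<Rightarrow> laurent \<times> laurent \<times> laurent \<times> laurent" where
  "gauss_polys X e a b = long_polys X (typed_weight e a) (typed_weight e b)
     (\<lambda>x. pairing X e (alpha_arc x) (\<lambda>_. 1)) (\<lambda>x y. pairing X e (alpha_arc x) (alpha_arc y))"

definition closed_gauss_polys ::
    "('a::linorder \<times> 'a) set \<Rightarrow> ('a \<times> 'a \<Rightarrow> int) \<Rightarrow> laurent \<times> laurent \<times> laurent" where
  "closed_gauss_polys X e =
     (let \<gamma> = (\<lambda>x. cyclic_arc (fst x) (snd x)); \<gamma>' = (\<lambda>x. cyclic_arc (snd x) (fst x));
          i = (\<lambda>f g. pairing X e f g div 4); \<omega> = of_int (\<Sum>x\<in>X. e x);
          W = weighted_sum X e (\<lambda>x. i (\<gamma> x) (\<gamma>' x))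
      in (W, weighted_double_sum X e e (\<lambda>x y. i (\<gamma> x) (\<gamma>' y)) - \<omega> * W,
          weighted_double_sum X e e (\<lambda>x y. i (\<gamma> x) (\<gamma> y))
          + weighted_double_sum X e e (\<lambda>x y. i (\<gamma>' x) (\<gamma>' y)) - \<omega> * (W + invert W)))"

lemma arc_add_reverse: "k \<noteq> l \<Longrightarrow> cyclic_arc k l r + cyclic_arc l k r = 2"
  by (auto simp: cyclic_arc_def cyc_def)

lemma beta_arc_eq: "fst x \<noteq> snd x \<Longrightarrow> beta_arc x = (\<lambda>r. 2 - alpha_arc x r)"
proof
  fix r assume "fst x \<noteq> snd x"
  then have "min (fst x) (snd x) \<noteq> max (fst x) (snd x)" by (simp add: min_def max_def)
  from arc_add_reverse[OF this, of r] show "beta_arc x r = 2 - alpha_arc x r"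
    by (simp add: beta_arc_def alpha_arc_def)
qed

lemma pairing_antisym: "pairing X e g f = - pairing X e f g"
  unfolding pairing_def sum_negf[symmetric] by (rule sum.cong) (simp_all add: algebra_simps)

lemma pairing_self [simp]: "pairing X e f f = 0"
  by (simp add: pairing_def)

lemma pairing_diff_left:
  "pairing X e (\<lambda>r. f r - f' r) g = pairing X e f g - pairing X e f' g"
  unfolding pairing_def sum_subtractf[symmetric] by (rule sum.cong) (simp_all add: algebra_simps)

lemma pairing_diff_right:
  "pairing X e f (\<lambda>r. g r - g' r) = pairing X e f g - pairing X e f g'"
  unfolding pairing_def sum_subtractf[symmetric] by (rule sum.cong) (simp_all add: algebra_simps)

lemma pairing_two_right: "pairing X e f (\<lambda>_. 2) = 2 * pairing X e f (\<lambda>_. 1)"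
  unfolding pairing_def sum_distrib_left by (rule sum.cong) (simp_all add: algebra_simps)

lemma pairing_two_left: "pairing X e (\<lambda>_. 2) f = - (2 * pairing X e f (\<lambda>_. 1))"
  by (subst pairing_antisym) (simp add: pairing_two_right)

lemma pairing_const_const [simp]: "pairing X e (\<lambda>_. c) (\<lambda>_. d) = 0"
  by (simp add: pairing_def)

lemma pairing_cong:
  assumes "\<And>x. x \<in> X \<Longrightarrow> e x = e' x"
    and "\<And>r. r \<in> Field X \<Longrightarrow> f r = f' r" "\<And>r. r \<in> Field X \<Longrightarrow> g r = g' r"
  shows "pairing X e f g = pairing X e' f' g'"
  unfolding pairing_def
proof (rule sum.cong)
  fix x assume "x \<in> X"
  then have "fst x \<in> Field X" "snd x \<in> Field X"
    by (metis FieldI1 prod.collapse, metis FieldI2 prod.collapse)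
  then show "e x * (f (fst x) * g (snd x) - f (snd x) * g (fst x))
      = e' x * (f' (fst x) * g' (snd x) - f' (snd x) * g' (fst x))"
    using assms \<open>x \<in> X\<close> by simp
qed simp

lemma pairing_insert:
  assumes "finite X" "x \<notin> X"
  shows "pairing (insert x X) e f g =
    e x * (f (fst x) * g (snd x) - f (snd x) * g (fst x)) + pairing X e f g"
  using assms by (simp add: pairing_def)

lemma pairing_alpha_beta:
  assumes "fst y \<noteq> snd y"
  shows "pairing X e f (beta_arc y) = 2 * pairing X e f (\<lambda>_. 1) - pairing X e f (alpha_arc y)"
  by (simp add: beta_arc_eq[OF assms] pairing_diff_right pairing_two_right)

lemma pairing_beta_beta:
  assumes "fst x \<noteq> snd x" "fst y \<noteq> snd y"
  shows "pairing X e (beta_arc x) (beta_arc y) =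
    2 * pairing X e (alpha_arc y) (\<lambda>_. 1) - 2 * pairing X e (alpha_arc x) (\<lambda>_. 1)
    + pairing X e (alpha_arc x) (alpha_arc y)"
  by (simp add: beta_arc_eq[OF assms(1)] beta_arc_eq[OF assms(2)] pairing_diff_right
      pairing_diff_left pairing_two_right pairing_two_left)

lemma gauss_diagramD:
  assumes "gauss_diagram X e"
  shows "finite X" "x \<in> X \<Longrightarrow> fst x \<noteq> snd x" "x \<in> X \<Longrightarrow> e x = 1 \<or> e x = -1"
    and "x \<in> X \<Longrightarrow> y \<in> X \<Longrightarrow> x \<noteq> y \<Longrightarrow>
      fst x \<noteq> fst y \<and> snd x \<noteq> snd y \<and> fst x \<noteq> snd y \<and> snd x \<noteq> fst y"
proof -
  have inj: "inj_on fst X" "inj_on snd X" and dis: "fst ` X \<inter> snd ` X = {}"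
    using assms by (simp_all add: gauss_diagram_def)
  show "finite X" using assms by (simp add: gauss_diagram_def)
  have "fst x \<noteq> snd y" if "x \<in> X" "y \<in> X" for x y
    using dis imageI[OF that(1), of fst] imageI[OF that(2), of snd] by (metis IntI empty_iff)
  note ne = this
  show "x \<in> X \<Longrightarrow> fst x \<noteq> snd x" by (rule ne)
  show "x \<in> X \<Longrightarrow> e x = 1 \<or> e x = -1" using assms by (simp add: gauss_diagram_def)
  assume "x \<in> X" "y \<in> X" "x \<noteq> y"
  then show "fst x \<noteq> fst y \<and> snd x \<noteq> snd y \<and> fst x \<noteq> snd y \<and> snd x \<noteq> fst y"
    using ne[of x y] ne[of y x] inj_onD[OF inj(1), of x y] inj_onD[OF inj(2), of x y] by auto
qed

lemma alpha_arc_end [simp]: "alpha_arc x (fst x) = 1" "alpha_arc x (snd x) = 1"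
  by (auto simp: alpha_arc_def cyclic_arc_def min_def max_def)

lemma even_alpha_arc: "r \<noteq> fst x \<Longrightarrow> r \<noteq> snd x \<Longrightarrow> even (alpha_arc x r)"
  by (auto simp: alpha_arc_def cyclic_arc_def min_def max_def)

lemma even_pairing_alpha_whole:
  assumes "gauss_diagram X e" "x \<in> X"
  shows "even (pairing X e (alpha_arc x) (\<lambda>_. 1))"
  unfolding pairing_def
proof (rule dvd_sum)
  fix y assume y: "y \<in> X"
  show "even (e y * (alpha_arc x (fst y) * 1 - alpha_arc x (snd y) * 1))"
  proof (cases "y = x")
    case False
    then show ?thesis
      using gauss_diagramD(4)[OF assms(1) y assms(2)] by (auto intro!: even_alpha_arc)
  qed simp
qed

definition step :: "'a::linorder \<Rightarrow> 'a \<Rightarrow> int" where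
  "step a r = (if r < a then - 1 else if r = a then 0 else 1)"

definition chord_orientation :: "'a::linorder \<times> 'a \<Rightarrow> int" where
  "chord_orientation x = (if fst x < snd x then 1 else - 1)"

lemma step_swap: "step r a = - step a r"
  by (auto simp: step_def)

lemma step_self [simp]: "step a a = 0"
  by (simp add: step_def)

lemma step_less: "r < a \<Longrightarrow> step a r = - 1"
  by (simp add: step_def)

lemma step_greater: "a < r \<Longrightarrow> step a r = 1"
  using less_not_sym[of a r] by (auto simp: step_def)

lemma odd_step: "r \<noteq> a \<Longrightarrow> odd (step a r)"
  by (simp add: step_def)

text \<open>
  This form of \<open>\<alpha>\<close> splits it into contributions of its two ends, so that a chord can be followed while
  one of its ends is moved.
\<close>

lemma alpha_arc_step:
  assumes "fst x \<noteq> snd x"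
  shows "alpha_arc x r = chord_orientation x * (step (fst x) r - step (snd x) r)"
proof -
  have *: "cyclic_arc k l r = step k r - step l r" if "k < l" for k l :: 'a
  proof -
    consider "r < k" | "r = k" | "k < r" "r < l" | "r = l" | "l < r"
      by (metis linorder_cases)
    then show ?thesis
    proof cases
      case 1
      then have "r < l" "\<not> k < r" "\<not> l < r" "\<not> l < k" "r \<noteq> k" "r \<noteq> l" using that by order+
      with 1 show ?thesis by (simp add: cyclic_arc_def cyc_def step_less)
    next
      case 5
      then have "k < r" "\<not> r < l" "\<not> r < k" "\<not> l < k" "r \<noteq> k" "r \<noteq> l" using that by order+
      with 5 show ?thesis by (simp add: cyclic_arc_def cyc_def step_greater)
    next
      case 3
      then have "r \<noteq> k" "r \<noteq> l" by order+
      with 3 show ?thesis by (simp add: cyclic_arc_def cyc_def step_less step_greater)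
    qed (use that in \<open>simp_all add: cyclic_arc_def step_less step_greater\<close>)
  qed
  show ?thesis
  proof (cases rule: linorder_cases[of "fst x" "snd x"])
    case less
    then show ?thesis using *[OF less] by (simp add: alpha_arc_def chord_orientation_def)
  next
    case greater
    then have "\<not> fst x < snd x" by order
    then show ?thesis
      using *[OF greater] greater by (simp add: alpha_arc_def chord_orientation_def)
  qed (use assms in simp)
qed

text \<open>
  Two linked chords contribute a half-integer each to the intersection number of their loops, since each
  of the loops has a corner on the other one.
\<close>

lemma linked_chords_mod_4:
  fixes k l k' l' :: "'a::linorder"
  assumes d: "distinct [k, l, k', l']" and e: "e = 1 \<or> e = (-1::int)" "e' = 1 \<or> e' = (-1::int)"
  shows "4 dvd e * (alpha_arc (k', l') l - alpha_arc (k', l') k)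
             + e' * (alpha_arc (k, l) k' - alpha_arc (k, l) l')"
proof -
  define q where "q = step k' l - step l' l - step k' k + step l' k"
  have "alpha_arc (k', l') l - alpha_arc (k', l') k = chord_orientation (k', l') * q"
    using d by (simp add: alpha_arc_step q_def algebra_simps)
  moreover have "alpha_arc (k, l) k' - alpha_arc (k, l) l' = chord_orientation (k, l) * q"
    using d by (simp add: alpha_arc_step q_def step_swap[of k] step_swap[of l] algebra_simps)
  moreover have "even q"
    using d unfolding q_def by (simp add: odd_step)
  then obtain h where "q = 2 * h" by (elim evenE)
  ultimately show ?thesis
    using e by (auto simp: chord_orientation_def)
qed

text \<open>
  At the ends of the chords other than x and y the arcs have even values, which gives multiples of 4. The terms
  of x and y remain.
\<close>

lemma four_dvd_pairing_alpha:
  assumes X: "gauss_diagram X e" and x: "x \<in> X" and y: "y \<in> X"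
  shows "4 dvd pairing X e (alpha_arc x) (alpha_arc y)"
proof (cases "x = y")
  case False
  let ?t = "\<lambda>z. e z * (alpha_arc x (fst z) * alpha_arc y (snd z)
                       - alpha_arc x (snd z) * alpha_arc y (fst z))"
  have "pairing X e (alpha_arc x) (alpha_arc y) = ?t x + (?t y + sum ?t (X - {x} - {y}))"
  proof -
    have "y \<in> X - {x}" using y False by simp
    then show ?thesis
      unfolding pairing_def
      using sum.remove[OF gauss_diagramD(1)[OF X] x, of ?t] gauss_diagramD(1)[OF X]
      by (simp only: sum.remove[of "X - {x}" y ?t] finite_Diff)
  qed
  moreover have "4 dvd sum ?t (X - {x} - {y})"
  proof (rule dvd_sum)
    fix z assume z: "z \<in> X - {x} - {y}"
    note d = gauss_diagramD(4)[OF X, of z x] gauss_diagramD(4)[OF X, of z y]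
    have "even (alpha_arc x (fst z))" "even (alpha_arc y (snd z))"
      "even (alpha_arc x (snd z))" "even (alpha_arc y (fst z))"
      using z d x y by (auto intro!: even_alpha_arc)
    then have "2 * 2 dvd alpha_arc x (fst z) * alpha_arc y (snd z)"
      "2 * 2 dvd alpha_arc x (snd z) * alpha_arc y (fst z)"
      by (simp_all only: mult_dvd_mono)
    then show "4 dvd ?t z"
      by (simp add: dvd_mult dvd_diff)
  qed
  moreover have "4 dvd ?t x + ?t y"
  proof -
    have "distinct [fst x, snd x, fst y, snd y]"
      using gauss_diagramD(2)[OF X] gauss_diagramD(4)[OF X x y False] x y by auto
    from linked_chords_mod_4[OF this gauss_diagramD(3)[OF X x] gauss_diagramD(3)[OF X y]]
    show ?thesis by simp
  qed
  ultimately show ?thesis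
    using dvd_add[of 4 "?t x + ?t y" "sum ?t (X - {x} - {y})"] by (simp only: add.assoc)
qed simp

lemma gauss_polys_cong:
  assumes "\<And>x. x \<in> X \<Longrightarrow> e' x = e x"
  shows "gauss_polys X e' a b = gauss_polys X e a b"
  unfolding gauss_polys_def
  by (rule long_polys_cong; (rule pairing_cong)?) (simp_all add: typed_weight_def assms)

text \<open>The proposition for Gauss diagrams: both sides are computed from one and the same cut-open diagram.\<close>

theorem closed_gauss_polys_eq:
  fixes X :: "('a::linorder \<times> 'a) set"
  assumes X: "gauss_diagram X e"
    and P: "gauss_polys X e 0 0 = (W\<^sub>0, F\<^sub>0\<^sub>0, G\<^sub>0\<^sub>0, H\<^sub>0\<^sub>0)" "gauss_polys X e 0 1 = (W\<^sub>0', F\<^sub>0\<^sub>1, G\<^sub>0\<^sub>1, H\<^sub>0\<^sub>1)"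
      "gauss_polys X e 1 0 = (W\<^sub>1, F\<^sub>1\<^sub>0, G\<^sub>1\<^sub>0, H\<^sub>1\<^sub>0)" "gauss_polys X e 1 1 = (W\<^sub>1', F\<^sub>1\<^sub>1, G\<^sub>1\<^sub>1, H\<^sub>1\<^sub>1)"
  shows "closed_gauss_polys X e =
    (W\<^sub>0 + invert W\<^sub>1, F\<^sub>0\<^sub>1 + G\<^sub>0\<^sub>0 + invert G\<^sub>1\<^sub>1 + invert H\<^sub>0\<^sub>1,
     F\<^sub>0\<^sub>0 + F\<^sub>1\<^sub>1 + G\<^sub>0\<^sub>1 + invert G\<^sub>0\<^sub>1 + G\<^sub>1\<^sub>0 + invert G\<^sub>1\<^sub>0 + H\<^sub>0\<^sub>0 + H\<^sub>1\<^sub>1)"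
proof -
  define u where "u = (\<lambda>x. pairing X e (alpha_arc x) (\<lambda>_. 1))"
  define n where "n = (\<lambda>x y. pairing X e (alpha_arc x) (alpha_arc y))"
  define w0 w1 where "w0 = typed_weight e 0" and "w1 = typed_weight e 1"
  define \<tau> where "\<tau> = (\<lambda>x::'a\<times>'a. fst x < snd x)"
  define aa ab bb where "aa = (\<lambda>x y. n x y div 4)" and "ab = (\<lambda>x y. (2 * u x - n x y) div 4)"
    and "bb = (\<lambda>x y. (2 * u y - 2 * u x + n x y) div 4)"
  define ga gb where "ga = (\<lambda>x::'a\<times>'a. cyclic_arc (fst x) (snd x))" and "gb = (\<lambda>x::'a\<times>'a. cyclic_arc (snd x) (fst x))"
  note D = gauss_diagramD[OF X]
  have n4: "4 dvd n x y" if "x \<in> X" "y \<in> X" for x y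
    unfolding n_def by (rule four_dvd_pairing_alpha[OF X that])
  have u2: "4 dvd 2 * u x" if "x \<in> X" for x
    using even_pairing_alpha_whole[OF X that] unfolding u_def by presburger
  have aa: "4 * aa x y = n x y" and ab: "4 * ab x y = 2 * u x - n x y"
    and bb: "4 * bb x y = 2 * u y - 2 * u x + n x y" if "x \<in> X" "y \<in> X" for x y
    using n4[OF that] u2[OF that(1)] u2[OF that(2)] unfolding aa_def ab_def bb_def
    by (presburger, presburger, presburger)
  have antisym: "n y x = - n x y" for x y
    unfolding n_def by (rule pairing_antisym)
  have pab: "pairing X e (alpha_arc x) (beta_arc y) div 4 = ab x y"
    and pba: "pairing X e (beta_arc y) (alpha_arc x) div 4 = - ab x y"
    and pbb: "pairing X e (beta_arc x) (beta_arc y) div 4 = bb x y" if "x \<in> X" "y \<in> X" for x y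
    using pairing_alpha_beta[OF D(2)[OF that(2)], of X e "alpha_arc x"] ab[OF that]
      pairing_beta_beta[OF D(2)[OF that(1)] D(2)[OF that(2)], of X e] bb[OF that]
      pairing_antisym[of X e "beta_arc y" "alpha_arc x"]
    unfolding u_def n_def by simp_all
  have gtau: "ga x = (if \<tau> x then alpha_arc x else beta_arc x)"
    "gb x = (if \<tau> x then beta_arc x else alpha_arc x)" if "x \<in> X" for x
    using D(2)[OF that] by (auto simp: ga_def gb_def \<tau>_def alpha_arc_def beta_arc_def min_def max_def)
  define gg gh hh where "gg = (\<lambda>x y. pairing X e (ga x) (ga y) div 4)"
    and "gh = (\<lambda>x y. pairing X e (ga x) (gb y) div 4)"
    and "hh = (\<lambda>x y. pairing X e (gb x) (gb y) div 4)"
  have e: "e x = w0 x + w1 x" if "x \<in> X" for x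
    using D(2)[OF that] by (auto simp: w0_def w1_def typed_weight_def)
  have sums: "weighted_sum X e m = weighted_sum X (\<lambda>x. w0 x + w1 x) m"
    "weighted_double_sum X e e m2 =
      weighted_double_sum X (\<lambda>x. w0 x + w1 x) (\<lambda>x. w0 x + w1 x) m2"
    "(\<Sum>x\<in>X. e x) = (\<Sum>x\<in>X. w0 x + w1 x)" for m m2
    by (rule weighted_sum_reindex[where \<phi> = id], simp_all add: e)
       (rule weighted_double_sum_reindex[where \<phi> = id], simp_all add: e)
  have abx: "pairing X e (ga x) (gb x) div 4 = gh x x" for x
    by (simp add: gh_def)
  have closed: "closed_gauss_polys X e = (weighted_sum X e (\<lambda>x. gh x x),
      weighted_double_sum X e e gh - of_int (\<Sum>x\<in>X. e x) * weighted_sum X e (\<lambda>x. gh x x),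
      weighted_double_sum X e e gg + weighted_double_sum X e e hh
      - of_int (\<Sum>x\<in>X. e x)
        * (weighted_sum X e (\<lambda>x. gh x x) + invert (weighted_sum X e (\<lambda>x. gh x x))))"
    by (simp add: closed_gauss_polys_def Let_def gg_def gh_def hh_def ga_def gb_def)
  have P': "W\<^sub>0 = poly_W X w0 u" "W\<^sub>1 = poly_W X w1 u" "F\<^sub>0\<^sub>0 = poly_F X w0 w0 n" "F\<^sub>0\<^sub>1 = poly_F X w0 w1 n"
    "F\<^sub>1\<^sub>1 = poly_F X w1 w1 n" "G\<^sub>0\<^sub>0 = poly_G X w0 w0 u n" "G\<^sub>0\<^sub>1 = poly_G X w0 w1 u n"
    "G\<^sub>1\<^sub>0 = poly_G X w1 w0 u n" "G\<^sub>1\<^sub>1 = poly_G X w1 w1 u n" "H\<^sub>0\<^sub>0 = poly_H X w0 w0 u n"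
    "H\<^sub>0\<^sub>1 = poly_H X w0 w1 u n" "H\<^sub>1\<^sub>1 = poly_H X w1 w1 u n"
    using P by (simp_all add: gauss_polys_def long_polys_def w0_def w1_def u_def n_def)
  have \<tau>: "w0 x \<noteq> 0 \<Longrightarrow> \<tau> x" "w1 x \<noteq> 0 \<Longrightarrow> \<not> \<tau> x" for x
    by (auto simp: w0_def w1_def \<tau>_def typed_weight_def split: if_splits)
  have gg: "gg x y = (if \<tau> x then if \<tau> y then aa x y else ab x y else if \<tau> y then - ab y x else bb x y)"
    and gh: "gh x y = (if \<tau> x then if \<tau> y then ab x y else aa x y else if \<tau> y then bb x y else - ab y x)"
    and hh: "hh x y = (if \<tau> x then if \<tau> y then bb x y else - ab y x else if \<tau> y then ab x y else aa x y)"
    if "x \<in> X" "y \<in> X" for x y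
    using pab[OF that] pba[OF that(2,1)] pbb[OF that]
    by (simp_all add: gg_def gh_def hh_def gtau that aa_def n_def)
  note main = closed_polys_from_long_polys[of X aa n ab u bb w0 \<tau> w1 "\<lambda>x. w0 x + w1 x" gg gh hh,
    OF aa ab bb antisym \<tau> refl gg gh hh]
  show ?thesis
    unfolding closed P' sums prod.inject by (intro conjI main)
qed

section \<open>Changes of a Gauss diagram\<close>

lemma cyc_rotate: "cyc r s t \<Longrightarrow> cyc s t r"
  unfolding cyc_def by blast

lemma cyc_distinct: "cyc r s t \<Longrightarrow> r \<noteq> s \<and> s \<noteq> t \<and> r \<noteq> t"
  unfolding cyc_def by (metis less_irrefl less_trans)

lemma cyc_asym: "cyc r s t \<Longrightarrow> \<not> cyc r t s"
  unfolding cyc_def by (metis less_irrefl less_trans)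

lemma cyc_total: "r \<noteq> s \<Longrightarrow> s \<noteq> t \<Longrightarrow> r \<noteq> t \<Longrightarrow> cyc r s t \<or> cyc r t s"
  unfolding cyc_def by (metis linorder_cases)

lemma cyc_image_iff:
  assumes inj: "inj_on \<theta> F"
    and \<theta>: "\<And>r s t. r \<in> F \<Longrightarrow> s \<in> F \<Longrightarrow> t \<in> F \<Longrightarrow> r < s \<Longrightarrow> s < t \<Longrightarrow> cyc (\<theta> r) (\<theta> s) (\<theta> t)"
    and F: "r \<in> F" "s \<in> F" "t \<in> F"
  shows "cyc (\<theta> r) (\<theta> s) (\<theta> t) \<longleftrightarrow> cyc r s t"
proof -
  have *: "cyc (\<theta> r) (\<theta> s) (\<theta> t)" if "cyc r s t" "r \<in> F" "s \<in> F" "t \<in> F" for r s t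
    using that(1) \<theta>[of r s t] \<theta>[of s t r] \<theta>[of t r s] that(2-4) unfolding cyc_def[of r s t]
    by (metis cyc_rotate)
  show ?thesis
  proof
    assume c: "cyc (\<theta> r) (\<theta> s) (\<theta> t)"
    show "cyc r s t"
    proof (rule ccontr)
      assume "\<not> cyc r s t"
      moreover have "r \<noteq> s" "s \<noteq> t" "r \<noteq> t" using cyc_distinct[OF c] by auto
      ultimately have "cyc r t s" using cyc_total by blast
      from *[OF this F(1,3,2)] c show False using cyc_asym by blast
    qed
  qed (use * F in blast)
qed

lemma cyclic_arc_image:
  assumes "inj_on \<theta> F"
    and "\<And>r s t. r \<in> F \<Longrightarrow> s \<in> F \<Longrightarrow> t \<in> F \<Longrightarrow> r < s \<Longrightarrow> s < t \<Longrightarrow> cyc (\<theta> r) (\<theta> s) (\<theta> t)"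
    and "k \<in> F" "l \<in> F" "r \<in> F"
  shows "cyclic_arc (\<theta> k) (\<theta> l) (\<theta> r) = cyclic_arc k l r"
  using cyc_image_iff[OF assms(1,2,3,5,4)] assms(1,3-5)
  by (simp add: cyclic_arc_def inj_on_eq_iff)

lemma in_Field_fst_snd: "x \<in> X \<Longrightarrow> fst x \<in> Field X" "x \<in> X \<Longrightarrow> snd x \<in> Field X"
  by (metis FieldI1 prod.collapse, metis FieldI2 prod.collapse)

lemma Field_obtain:
  assumes "r \<in> Field X"
  obtains x where "x \<in> X" "r = fst x \<or> r = snd x"
  using assms by (auto simp: Field_def Domain_iff Range_iff)

lemma gauss_diagram_Field_new:
  assumes "gauss_diagram X' e" "X \<subseteq> X'" "x \<in> X'" "x \<notin> X" "r \<in> Field X"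
  shows "r \<noteq> fst x" "r \<noteq> snd x"
proof -
  obtain y where y: "y \<in> X" "r = fst y \<or> r = snd y" using assms(5) by (rule Field_obtain)
  have "y \<noteq> x" using y(1) assms(4) by blast
  moreover have "y \<in> X'" using y(1) assms(2) by blast
  ultimately show "r \<noteq> fst x" "r \<noteq> snd x"
    using gauss_diagramD(4)[OF assms(1) assms(3), of y] y(2) by auto
qed

lemma inj_on_map_prod_Field:
  assumes "inj_on \<theta> (Field X)" shows "inj_on (map_prod \<theta> \<theta>) X"
proof (rule inj_onI)
  fix x y assume xy: "x \<in> X" "y \<in> X" and "map_prod \<theta> \<theta> x = map_prod \<theta> \<theta> y"
  then have "\<theta> (fst x) = \<theta> (fst y)" "\<theta> (snd x) = \<theta> (snd y)"
    by (metis fst_map_prod, metis snd_map_prod)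
  then show "x = y"
    using inj_onD[OF assms] in_Field_fst_snd[OF xy(1)] in_Field_fst_snd[OF xy(2)] by (simp add: prod_eq_iff)
qed

lemma pairing_image:
  assumes "inj_on \<theta> (Field X)" "\<And>x. x \<in> X \<Longrightarrow> e' (map_prod \<theta> \<theta> x) = e x"
    and "\<And>r. r \<in> Field X \<Longrightarrow> f' (\<theta> r) = f r" "\<And>r. r \<in> Field X \<Longrightarrow> g' (\<theta> r) = g r"
  shows "pairing (map_prod \<theta> \<theta> ` X) e' f' g' = pairing X e f g"
  unfolding pairing_def sum.reindex[OF inj_on_map_prod_Field[OF assms(1)]]
  by (rule sum.cong) (simp_all add: assms in_Field_fst_snd)

text \<open>The closed polynomials only see the cyclic order of the passages.\<close>

lemma closed_gauss_polys_image:
  assumes inj: "inj_on \<theta> (Field X)"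
    and cyc: "\<And>r s t. r \<in> Field X \<Longrightarrow> s \<in> Field X \<Longrightarrow> t \<in> Field X \<Longrightarrow> r < s \<Longrightarrow> s < t \<Longrightarrow>
      cyc (\<theta> r) (\<theta> s) (\<theta> t)"
    and e: "\<And>x. x \<in> X \<Longrightarrow> e' (map_prod \<theta> \<theta> x) = e x"
  shows "closed_gauss_polys (map_prod \<theta> \<theta> ` X) e' = closed_gauss_polys X e"
proof -
  let ?\<phi> = "map_prod \<theta> \<theta>" let ?X' = "map_prod \<theta> \<theta> ` X"
  have bij: "bij_betw ?\<phi> X ?X'"
    using inj_on_map_prod_Field[OF inj] by (rule bij_betw_imageI) simp
  note A = cyclic_arc_image[OF inj cyc]
  have p: "pairing ?X' e' (cyclic_arc (\<theta> k) (\<theta> l)) (cyclic_arc (\<theta> k') (\<theta> l')) =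
      pairing X e (cyclic_arc k l) (cyclic_arc k' l')"
    if "k \<in> Field X" "l \<in> Field X" "k' \<in> Field X" "l' \<in> Field X" for k l k' l'
    by (rule pairing_image[OF inj]) (use that in \<open>simp_all add: e A\<close>)
  have s: "sum e' ?X' = sum e X"
    by (subst sum.reindex_bij_betw[OF bij, symmetric]) (simp add: e)
  have W: "weighted_sum ?X' e' (\<lambda>x. pairing ?X' e' (cyclic_arc (fst x) (snd x)) (cyclic_arc (snd x) (fst x)) div 4)
      = weighted_sum X e (\<lambda>x. pairing X e (cyclic_arc (fst x) (snd x)) (cyclic_arc (snd x) (fst x)) div 4)"
    by (rule weighted_sum_reindex[OF bij]) (simp_all add: e p in_Field_fst_snd)
  have D: "weighted_double_sum ?X' e' e' (\<lambda>x y. pairing ?X' e' (cyclic_arc (h x) (h' x)) (cyclic_arc (j y) (j' y)) div 4)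
      = weighted_double_sum X e e (\<lambda>x y. pairing X e (cyclic_arc (h\<^sub>0 x) (h\<^sub>0' x)) (cyclic_arc (j\<^sub>0 y) (j\<^sub>0' y)) div 4)"
    if "(h, h\<^sub>0) \<in> {(fst, fst), (snd, snd)}" "(h', h\<^sub>0') \<in> {(fst, fst), (snd, snd)}"
      "(j, j\<^sub>0) \<in> {(fst, fst), (snd, snd)}" "(j', j\<^sub>0') \<in> {(fst, fst), (snd, snd)}" for h h' j j' h\<^sub>0 h\<^sub>0' j\<^sub>0 j\<^sub>0'
  proof (rule weighted_double_sum_reindex[OF bij])
    fix x y assume xy: "x \<in> X" "y \<in> X"
    have "h (?\<phi> x) = \<theta> (h\<^sub>0 x)" "h' (?\<phi> x) = \<theta> (h\<^sub>0' x)" "j (?\<phi> y) = \<theta> (j\<^sub>0 y)" "j' (?\<phi> y) = \<theta> (j\<^sub>0' y)"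
      "h\<^sub>0 x \<in> Field X" "h\<^sub>0' x \<in> Field X" "j\<^sub>0 y \<in> Field X" "j\<^sub>0' y \<in> Field X"
      using that xy in_Field_fst_snd[of x X] in_Field_fst_snd[of y X] by auto
    then show "pairing ?X' e' (cyclic_arc (h (?\<phi> x)) (h' (?\<phi> x))) (cyclic_arc (j (?\<phi> y)) (j' (?\<phi> y))) div 4
        = pairing X e (cyclic_arc (h\<^sub>0 x) (h\<^sub>0' x)) (cyclic_arc (j\<^sub>0 y) (j\<^sub>0' y)) div 4"
      by (simp add: p)
  qed (simp_all add: e)
  show ?thesis
    unfolding closed_gauss_polys_def Let_def W s
    by (simp add: D[of fst fst snd snd snd snd fst fst] D[of fst fst snd snd fst fst snd snd]
        D[of snd snd fst fst snd snd fst fst])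
qed

lemma strict_mono_on_cyc:
  assumes "strict_mono_on F \<theta>" "r \<in> F" "s \<in> F" "t \<in> F" "r < s" "s < t"
  shows "cyc (\<theta> r) (\<theta> s) (\<theta> t)"
  using assms strict_mono_onD[OF assms(1)] by (simp add: cyc_def)

lemma gauss_polys_image:
  fixes X :: "('a::linorder \<times> 'a) set" and \<theta> :: "'a \<Rightarrow> 'b::linorder"
  assumes \<theta>: "strict_mono_on (Field X) \<theta>"
    and e: "\<And>x. x \<in> X \<Longrightarrow> e' (map_prod \<theta> \<theta> x) = e x"
  shows "gauss_polys (map_prod \<theta> \<theta> ` X) e' a b = gauss_polys X e a b"
proof -
  have inj: "inj_on \<theta> (Field X)" using \<theta> by (rule strict_mono_on_imp_inj_on)
  have less: "\<theta> r < \<theta> s \<longleftrightarrow> r < s" if "r \<in> Field X" "s \<in> Field X" for r s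
    using strict_mono_onD[OF \<theta> that] strict_mono_onD[OF \<theta> that(2,1)]
    by (metis linorder_cases order_less_asym)
  have alpha: "alpha_arc (map_prod \<theta> \<theta> x) (\<theta> r) = alpha_arc x r"
    if x: "x \<in> X" and r: "r \<in> Field X" for x r
  proof -
    have F: "fst x \<in> Field X" "snd x \<in> Field X" using x by (rule in_Field_fst_snd)+
    have mm: "min (\<theta> (fst x)) (\<theta> (snd x)) = \<theta> (min (fst x) (snd x))"
      "max (\<theta> (fst x)) (\<theta> (snd x)) = \<theta> (max (fst x) (snd x))"
      using less[OF F] less[OF F(2,1)] by (simp_all add: min_def max_def flip: not_less)
    have "min (fst x) (snd x) \<in> Field X" "max (fst x) (snd x) \<in> Field X"
      using F by (simp_all add: min_def max_def)
    then show ?thesis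
      using cyclic_arc_image[OF inj strict_mono_on_cyc[OF \<theta>] _ _ r] by (simp add: alpha_arc_def mm)
  qed
  have W: "typed_weight e' c (map_prod \<theta> \<theta> x) = typed_weight e c x" if "x \<in> X" for c x
    using that less in_Field_fst_snd[OF that] by (simp add: typed_weight_def e)
  have P: "pairing (map_prod \<theta> \<theta> ` X) e' f' g' = pairing X e f g"
    if "\<And>r. r \<in> Field X \<Longrightarrow> f' (\<theta> r) = f r" "\<And>r. r \<in> Field X \<Longrightarrow> g' (\<theta> r) = g r" for f g f' g'
    using inj e that by (rule pairing_image)
  show ?thesis
    unfolding gauss_polys_def
  proof (rule long_polys_reindex)
    show "bij_betw (map_prod \<theta> \<theta>) X (map_prod \<theta> \<theta> ` X)"
      using inj_on_map_prod_Field[OF inj] by (rule bij_betw_imageI) simp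
  qed (simp_all add: W P alpha)
qed

lemma step_cong:
  fixes p q r :: real
  assumes "r \<noteq> p" "r \<noteq> q" "r < p \<longleftrightarrow> r < q"
  shows "step r p = step r q" "step p r = step q r"
  using assms by (auto simp: step_def)

text \<open>First Reidemeister move: no passage separates the two ends of the new chord.\<close>

lemma gauss_polys_insert_kink:
  fixes X :: "(real \<times> real) set"
  assumes X': "gauss_diagram (insert (p, q) X) e" and new: "(p, q) \<notin> X"
    and adj: "\<And>r. r \<in> Field X \<Longrightarrow> r < p \<longleftrightarrow> r < q"
  shows "gauss_polys (insert (p, q) X) e a b = gauss_polys X e a b"
proof -
  note D = gauss_diagramD[OF X']
  let ?X = "insert (p, q) X"
  have fin: "finite X" using D(1) by simp
  have pq: "p \<noteq> q" using D(2)[of "(p, q)"] by simp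
  have out: "r \<noteq> p" "r \<noteq> q" if "r \<in> Field X" for r
    using gauss_diagram_Field_new[OF X' _ _ new that] by (simp_all add: subset_insertI)
  have XF: "fst x \<in> Field X" "snd x \<in> Field X" if "x \<in> X" for x
    using that by (rule in_Field_fst_snd)+
  have old: "alpha_arc x p = alpha_arc x q" if "x \<in> X" for x
    using D(2)[of x] that XF[OF that] by (simp add: alpha_arc_step step_cong[OF out adj])
  have triv: "alpha_arc (p, q) r = 0" if "r \<in> Field X" for r
    using pq that by (simp add: alpha_arc_step step_cong[OF out adj])
  have ins: "pairing ?X e f g = e (p, q) * (f p * g q - f q * g p) + pairing X e f g" for f g
    using pairing_insert[OF fin new, of e f g] by simp
  have zero: "pairing X e (alpha_arc (p, q)) g = 0" for g
  proof -
    have "pairing X e (alpha_arc (p, q)) g = pairing X e (\<lambda>_. 0) g"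
      by (rule pairing_cong) (simp_all add: triv)
    then show ?thesis by (simp add: pairing_def)
  qed
  have one: "alpha_arc (p, q) p = 1" "alpha_arc (p, q) q = 1"
    using alpha_arc_end[of "(p, q)"] by simp_all
  have new_old: "pairing ?X e (alpha_arc (p, q)) g = 0" if "g p = g q" for g
    using that by (simp add: ins zero one)
  have new_all: "pairing ?X e (alpha_arc (p, q)) (alpha_arc y) = 0" if "y \<in> ?X" for y
    using that old[of y] one by (intro new_old) (cases y, auto)
  have "gauss_polys ?X e a b = long_polys X (typed_weight e a) (typed_weight e b)
     (\<lambda>x. pairing ?X e (alpha_arc x) (\<lambda>_. 1)) (\<lambda>x y. pairing ?X e (alpha_arc x) (alpha_arc y))"
    unfolding gauss_polys_def
  proof (rule long_polys_insert_kink[OF fin new])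
    show "even (pairing ?X e (alpha_arc x) (\<lambda>_. 1))" if "x \<in> X" for x
      using even_pairing_alpha_whole[OF X'] that by simp
    show "pairing ?X e (alpha_arc (p, q)) (alpha_arc y) = 0 \<and> pairing ?X e (alpha_arc y) (alpha_arc (p, q)) = 0"
      if "y \<in> ?X" for y
      using new_all[OF that] pairing_antisym[of ?X e "alpha_arc y" "alpha_arc (p, q)"] by simp
  qed (simp add: new_old)
  also have "\<dots> = gauss_polys X e a b"
    unfolding gauss_polys_def by (rule long_polys_cong) (simp_all add: ins old)
  finally show ?thesis .
qed

text \<open>
  Second Reidemeister move: the loops at the two new crossings have the same intersection number with every
  loop, because their difference runs along a bigon. As the crossings have opposite signs,
  their contributions cancel.
\<close>

lemma gauss_polys_insert_bigon:
  fixes X :: "(real \<times> real) set"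
  assumes X': "gauss_diagram (insert (p\<^sub>1, q\<^sub>1) (insert (p\<^sub>2, q\<^sub>2) X)) e"
    and new: "(p\<^sub>1, q\<^sub>1) \<notin> X" "(p\<^sub>2, q\<^sub>2) \<notin> X" "(p\<^sub>1, q\<^sub>1) \<noteq> (p\<^sub>2, q\<^sub>2)"
    and sign: "e (p\<^sub>2, q\<^sub>2) = - e (p\<^sub>1, q\<^sub>1)"
    and adj: "\<And>r. r \<in> Field X \<Longrightarrow> (r < p\<^sub>1 \<longleftrightarrow> r < p\<^sub>2) \<and> (r < q\<^sub>1 \<longleftrightarrow> r < q\<^sub>2)"
    and sep: "max p\<^sub>1 p\<^sub>2 < min q\<^sub>1 q\<^sub>2 \<or> max q\<^sub>1 q\<^sub>2 < min p\<^sub>1 p\<^sub>2"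
  shows "gauss_polys (insert (p\<^sub>1, q\<^sub>1) (insert (p\<^sub>2, q\<^sub>2) X)) e a b = gauss_polys X e a b"
proof -
  note D = gauss_diagramD[OF X']
  let ?x1 = "(p\<^sub>1, q\<^sub>1)" and ?x2 = "(p\<^sub>2, q\<^sub>2)"
  let ?X = "insert ?x1 (insert ?x2 X)"
  have fin: "finite X" using D(1) by simp
  have out: "r \<noteq> p\<^sub>1" "r \<noteq> q\<^sub>1" "r \<noteq> p\<^sub>2" "r \<noteq> q\<^sub>2" if "r \<in> Field X" for r
    using gauss_diagram_Field_new[OF X' _ _ new(1) that] gauss_diagram_Field_new[OF X' _ _ new(2) that]
    by (simp_all add: subset_insertI2 subset_insertI)
  define o1 where "o1 = chord_orientation ?x1"
  have o2: "chord_orientation ?x2 = o1"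
    using sep by (auto simp: o1_def chord_orientation_def)
  have ne: "p\<^sub>1 \<noteq> q\<^sub>1" "p\<^sub>2 \<noteq> q\<^sub>2" using D(2)[of ?x1] D(2)[of ?x2] by simp_all
  have a1: "alpha_arc ?x1 r = o1 * (step p\<^sub>1 r - step q\<^sub>1 r)"
    and a2: "alpha_arc ?x2 r = o1 * (step p\<^sub>2 r - step q\<^sub>2 r)" for r
    using ne by (simp_all add: alpha_arc_step o2 o1_def)
  have XF: "fst x \<in> Field X" "snd x \<in> Field X" if "x \<in> X" for x
    using that by (rule in_Field_fst_snd)+
  have stepF: "step r p\<^sub>1 = step r p\<^sub>2" "step r q\<^sub>1 = step r q\<^sub>2" "step p\<^sub>1 r = step p\<^sub>2 r" "step q\<^sub>1 r = step q\<^sub>2 r"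
    if "r \<in> Field X" for r
    using step_cong[of r p\<^sub>1 p\<^sub>2] step_cong[of r q\<^sub>1 q\<^sub>2] out[OF that] adj[OF that] by auto
  have old: "alpha_arc x p\<^sub>1 = alpha_arc x p\<^sub>2" "alpha_arc x q\<^sub>1 = alpha_arc x q\<^sub>2" if "x \<in> X" for x
    using D(2)[of x] that XF[OF that] by (simp_all add: alpha_arc_step stepF)
  have ins: "pairing ?X e f g = e ?x1 * (f p\<^sub>1 * g q\<^sub>1 - f q\<^sub>1 * g p\<^sub>1)
      - e ?x1 * (f p\<^sub>2 * g q\<^sub>2 - f q\<^sub>2 * g p\<^sub>2) + pairing X e f g" for f g
    using pairing_insert[of "insert ?x2 X" ?x1 e f g] pairing_insert[of X ?x2 e f g] fin new sign by simp
  define c d where "c = o1 * step q\<^sub>2 q\<^sub>1" and "d = o1 * step p\<^sub>1 p\<^sub>2"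
  define \<delta> where "\<delta> = (\<lambda>r. alpha_arc ?x1 r - alpha_arc ?x2 r)"
  have sepS: "step q\<^sub>1 p\<^sub>1 = step q\<^sub>2 p\<^sub>1" "step q\<^sub>1 p\<^sub>2 = step q\<^sub>2 p\<^sub>2" "step q\<^sub>1 p\<^sub>1 = step q\<^sub>1 p\<^sub>2"
    "step p\<^sub>1 q\<^sub>1 = step p\<^sub>2 q\<^sub>1" "step p\<^sub>1 q\<^sub>2 = step p\<^sub>2 q\<^sub>2" "step p\<^sub>1 q\<^sub>1 = step p\<^sub>1 q\<^sub>2"
    using sep by (auto simp: step_def)
  have swap: "step p\<^sub>2 p\<^sub>1 = - step p\<^sub>1 p\<^sub>2" "step q\<^sub>1 q\<^sub>2 = - step q\<^sub>2 q\<^sub>1"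
    by (rule step_swap)+
  have \<delta>: "\<delta> p\<^sub>1 = d" "\<delta> p\<^sub>2 = d" "\<delta> q\<^sub>1 = c" "\<delta> q\<^sub>2 = c"
    unfolding \<delta>_def a1 a2 c_def d_def by (simp_all add: sepS swap algebra_simps)
  have key: "pairing ?X e (alpha_arc ?x1) g = pairing ?X e (alpha_arc ?x2) g"
    if "d * (g q\<^sub>1 - g q\<^sub>2) = c * (g p\<^sub>1 - g p\<^sub>2)" for g
  proof -
    have "pairing X e \<delta> g = pairing X e (\<lambda>_. 0) g"
      by (rule pairing_cong) (simp_all add: \<delta>_def a1 a2 stepF)
    then have "pairing X e \<delta> g = 0" by (simp add: pairing_def)
    then have "pairing ?X e \<delta> g = e ?x1 * (d * (g q\<^sub>1 - g q\<^sub>2) - c * (g p\<^sub>1 - g p\<^sub>2))"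
      unfolding ins by (simp add: \<delta> algebra_simps)
    then have "pairing ?X e \<delta> g = 0" using that by simp
    then show ?thesis by (simp add: \<delta>_def pairing_diff_left)
  qed
  have new1: "alpha_arc ?x1 q\<^sub>1 - alpha_arc ?x1 q\<^sub>2 = - c" "alpha_arc ?x1 p\<^sub>1 - alpha_arc ?x1 p\<^sub>2 = - d"
    unfolding a1 c_def d_def using sepS swap by (simp_all add: algebra_simps)
  have new2: "alpha_arc ?x2 q\<^sub>1 - alpha_arc ?x2 q\<^sub>2 = - c" "alpha_arc ?x2 p\<^sub>1 - alpha_arc ?x2 p\<^sub>2 = - d"
    unfolding a2 c_def d_def using sepS swap by (simp_all add: algebra_simps)
  have same: "pairing ?X e (alpha_arc ?x1) (alpha_arc y) = pairing ?X e (alpha_arc ?x2) (alpha_arc y)"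
    if "y \<in> ?X" for y
    using that old[of y] new1 new2 by (intro key) (cases y, auto)
  have "gauss_polys ?X e a b = long_polys X (typed_weight e a) (typed_weight e b)
     (\<lambda>x. pairing ?X e (alpha_arc x) (\<lambda>_. 1)) (\<lambda>x y. pairing ?X e (alpha_arc x) (alpha_arc y))"
    unfolding gauss_polys_def
  proof (rule long_polys_insert_cancelling_pair[OF fin new])
    have "p\<^sub>1 < q\<^sub>1 \<longleftrightarrow> p\<^sub>2 < q\<^sub>2" "q\<^sub>1 < p\<^sub>1 \<longleftrightarrow> q\<^sub>2 < p\<^sub>2" using sep by auto
    then show "typed_weight e a ?x1 + typed_weight e a ?x2 = 0"
      "typed_weight e b ?x1 + typed_weight e b ?x2 = 0"
      by (simp_all add: typed_weight_def sign)
    show "pairing ?X e (alpha_arc ?x1) (alpha_arc y) = pairing ?X e (alpha_arc ?x2) (alpha_arc y) \<and>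
        pairing ?X e (alpha_arc y) (alpha_arc ?x1) = pairing ?X e (alpha_arc y) (alpha_arc ?x2)"
      if "y \<in> ?X" for y
      using same[OF that] pairing_antisym[of ?X e "alpha_arc y"] by simp
  qed (simp add: key)
  also have "\<dots> = gauss_polys X e a b"
    unfolding gauss_polys_def by (rule long_polys_cong) (simp_all add: ins old)
  finally show ?thesis .
qed

lemma alpha_arc_swap: "alpha_arc (q, p) = alpha_arc (p, q)"
  by (simp add: alpha_arc_def min.commute max.commute)

definition strand_triple :: "nat \<Rightarrow> nat \<Rightarrow> nat \<Rightarrow> bool" where
  "strand_triple k l m \<longleftrightarrow> k < 3 \<and> l < 3 \<and> m < 3 \<and> k \<noteq> l \<and> l \<noteq> m \<and> k \<noteq> m"

lemma strand_triples [simp]: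
  "strand_triple 0 (Suc 0) 2" "strand_triple 0 2 (Suc 0)" "strand_triple (Suc 0) 0 2"
  "strand_triple (Suc 0) 2 0" "strand_triple 2 0 (Suc 0)" "strand_triple 2 (Suc 0) 0"
  by (simp_all add: strand_triple_def)

text \<open>
  \<open>t i j\<close> and \<open>t' i j\<close> are the parameters on strand i of its crossing with strand j before and after a third
  Reidemeister move, and \<open>w i j\<close> is the sign of the crossing when strand i runs over strand j.
  A pair of functions f, f' is a triangle pair if it arises from one arc before and after the move: on each
  strand the values change by opposite amounts at the two crossings, and the change is orthogonal to
  every strand. Such a change does not affect intersection numbers.
\<close>

definition triangle_pair ::
    "(real \<times> real) set \<Rightarrow> (nat \<Rightarrow> nat \<Rightarrow> real) \<Rightarrow> (nat \<Rightarrow> nat \<Rightarrow> real) \<Rightarrow> (nat \<Rightarrow> nat \<Rightarrow> int)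
      \<Rightarrow> (real \<Rightarrow> int) \<Rightarrow> (real \<Rightarrow> int) \<Rightarrow> bool" where
  "triangle_pair Y t t' w f f' \<longleftrightarrow> (\<forall>r\<in>Field Y. f' r = f r) \<and>
     (\<forall>k l m. strand_triple k l m \<longrightarrow> f (t k l) + f' (t' k l) = f (t k m) + f' (t' k m) \<and>
        w m k * (f (t k m) - f' (t' k m)) + w m l * (f (t l m) - f' (t' l m)) = 0)"

definition triangle_term ::
    "(nat \<Rightarrow> nat \<Rightarrow> real) \<Rightarrow> (nat \<Rightarrow> nat \<Rightarrow> int) \<Rightarrow> (real \<Rightarrow> int) \<Rightarrow> (real \<Rightarrow> int) \<Rightarrow> nat \<Rightarrow> nat \<Rightarrow> int" where
  "triangle_term t w f g i j = w i j * (f (t i j) * g (t j i) - f (t j i) * g (t i j))"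

text \<open>
  By polarization, the change of a term is bilinear in the sums S, T of old and new values on one side and in
  their differences d, h on the other. The sums agree along each strand, so that they can be factored
  out, and the weighted differences cancel.
\<close>

lemma triangle_terms_invariant:
  assumes f: "triangle_pair Y t t' w f f'" and g: "triangle_pair Y t t' w g g'"
    and w: "\<And>i j. w j i = - w i j"
  shows "triangle_term t w f g 0 1 + triangle_term t w f g 0 2 + triangle_term t w f g 1 2 =
    triangle_term t' w f' g' 0 1 + triangle_term t' w f' g' 0 2 + triangle_term t' w f' g' 1 2"
proof -
  define S T where "S = (\<lambda>i j. f (t i j) + f' (t' i j))" and "T = (\<lambda>i j. g (t i j) + g' (t' i j))"
  define d h where "d = (\<lambda>i j. f (t i j) - f' (t' i j))" and "h = (\<lambda>i j. g (t i j) - g' (t' i j))"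
  have S: "S 0 2 = S 0 1" "S 1 2 = S 1 0" "S 2 1 = S 2 0"
    and d: "w 0 1 * d 1 0 + w 0 2 * d 2 0 = 0" "w 1 0 * d 0 1 + w 1 2 * d 2 1 = 0" "w 2 0 * d 0 2 + w 2 1 * d 1 2 = 0"
    using f unfolding triangle_pair_def S_def d_def by simp_all
  have T: "T 0 2 = T 0 1" "T 1 2 = T 1 0" "T 2 1 = T 2 0"
    and h: "w 0 1 * h 1 0 + w 0 2 * h 2 0 = 0" "w 1 0 * h 0 1 + w 1 2 * h 2 1 = 0" "w 2 0 * h 0 2 + w 2 1 * h 1 2 = 0"
    using g unfolding triangle_pair_def T_def h_def by simp_all
  have two: "2 * (triangle_term t w f g i j - triangle_term t' w f' g' i j) =
      w i j * (d i j * T j i + S i j * h j i) + w j i * (d j i * T i j + S j i * h i j)" for i j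
    unfolding triangle_term_def S_def T_def d_def h_def w[of i j] by (simp add: algebra_simps)
  have "2 * (triangle_term t w f g 0 1 - triangle_term t' w f' g' 0 1)
      + 2 * (triangle_term t w f g 0 2 - triangle_term t' w f' g' 0 2)
      + 2 * (triangle_term t w f g 1 2 - triangle_term t' w f' g' 1 2) =
      - T 1 0 * (w 1 0 * d 0 1 + w 1 2 * d 2 1) - T 0 1 * (w 0 1 * d 1 0 + w 0 2 * d 2 0)
      - T 2 0 * (w 2 0 * d 0 2 + w 2 1 * d 1 2)
      + S 0 1 * (w 0 1 * h 1 0 + w 0 2 * h 2 0) + S 1 0 * (w 1 0 * h 0 1 + w 1 2 * h 2 1)
      + S 2 0 * (w 2 0 * h 0 2 + w 2 1 * h 1 2)"
    unfolding two S T w[of 0 1] w[of 0 2] w[of 1 2] by (simp add: algebra_simps)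
  then show ?thesis
    unfolding d h by simp
qed

definition strand_crossing :: "(nat \<Rightarrow> nat \<Rightarrow> bool) \<Rightarrow> (nat \<Rightarrow> nat \<Rightarrow> real) \<Rightarrow> nat \<Rightarrow> nat \<Rightarrow> real \<times> real" where
  "strand_crossing ov t i j = (if ov i j then (t i j, t j i) else (t j i, t i j))"

text \<open>
  Third Reidemeister move. The condition \<open>balanced\<close> relates the signs of the crossings
  to the order in which the strands pass them; it says that the three strands bound a triangle.
\<close>

lemma gauss_polys_triangle_move:
  fixes Y :: "(real \<times> real) set" and lo hi :: "nat \<Rightarrow> real" and ov
  defines "c \<equiv> strand_crossing ov"
  assumes X: "gauss_diagram (Y \<union> {c t 0 1, c t 0 2, c t 1 2}) e"
    and X': "gauss_diagram (Y \<union> {c t' 0 1, c t' 0 2, c t' 1 2}) e'"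
    and strand: "\<And>i j. i < 3 \<Longrightarrow> j < 3 \<Longrightarrow> i \<noteq> j \<Longrightarrow> t i j \<in> {lo i..hi i} \<and> t' i j \<in> {lo i..hi i}"
    and disj: "\<And>i j. i < 3 \<Longrightarrow> j < 3 \<Longrightarrow> i \<noteq> j \<Longrightarrow> {lo i..hi i} \<inter> {lo j..hi j} = {}"
    and out: "\<And>r i. r \<in> Field Y \<Longrightarrow> i < 3 \<Longrightarrow> r \<notin> {lo i..hi i}"
    and eY: "\<And>y. y \<in> Y \<Longrightarrow> e' y = e y"
    and w: "\<And>i j. w j i = - w i j"
    and e: "\<And>i j. (i, j) \<in> {(0, 1), (0, 2), (1, 2)} \<Longrightarrow> e (c t i j) = (if ov i j then w i j else - w i j)"
    and e': "\<And>i j. (i, j) \<in> {(0, 1), (0, 2), (1, 2)} \<Longrightarrow> e' (c t' i j) = (if ov i j then w i j else - w i j)"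
    and flip: "\<And>k l m. strand_triple k l m \<Longrightarrow> step (t' k l) (t' k m) = - step (t k l) (t k m)"
    and balanced: "\<And>k l m. strand_triple k l m \<Longrightarrow>
      w m k * step (t k l) (t k m) = w m l * step (t l k) (t l m)"
  shows "gauss_polys (Y \<union> {c t' 0 1, c t' 0 2, c t' 1 2}) e' a b =
    gauss_polys (Y \<union> {c t 0 1, c t 0 2, c t 1 2}) e a b"
proof -
  let ?X = "Y \<union> {c t 0 1, c t 0 2, c t 1 2}" and ?X' = "Y \<union> {c t' 0 1, c t' 0 2, c t' 1 2}"
  have finY: "finite Y" using gauss_diagramD(1)[OF X] by simp
  have order: "(\<forall>r\<in>{lo i..hi i}. \<forall>s\<in>{lo j..hi j}. r < s) \<or> (\<forall>r\<in>{lo i..hi i}. \<forall>s\<in>{lo j..hi j}. s < r)"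
    if "i < 3" "j < 3" "i \<noteq> j" for i j
    using disj[OF that] by (auto simp: disjoint_iff; smt (verit))
  have sep: "step r s = step r' s' \<and> step r s \<in> {1, -1} \<and> (r < s \<longleftrightarrow> r' < s')"
    if "i < 3" "j < 3" "i \<noteq> j" "r \<in> {lo i..hi i}" "r' \<in> {lo i..hi i}" "s \<in> {lo j..hi j}" "s' \<in> {lo j..hi j}"
    for i j r r' s s'
    using order[OF that(1-3)]
  proof
    assume "\<forall>r\<in>{lo i..hi i}. \<forall>s\<in>{lo j..hi j}. r < s"
    then have "r < s" "r' < s'" using that by blast+
    then show ?thesis by (simp add: step_def)
  next
    assume "\<forall>r\<in>{lo i..hi i}. \<forall>s\<in>{lo j..hi j}. s < r"
    then have "s < r" "s' < r'" using that by blast+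
    then show ?thesis by (simp add: step_def)
  qed
  have outside: "step r s = step r s' \<and> step s r = step s' r"
    if "i < 3" "r \<in> Field Y" "s \<in> {lo i..hi i}" "s' \<in> {lo i..hi i}" for i r s s'
    using out[OF that(2,1)] that(3,4) by (auto simp: step_def)
  have ne: "u i j \<noteq> u' k l"
    if "u \<in> {t, t'}" "u' \<in> {t, t'}" "i < 3" "j < 3" "k < 3" "l < 3" "i \<noteq> j" "k \<noteq> l" "i \<noteq> k" for u u' i j k l
  proof -
    have "u i j \<in> {lo i..hi i}" "u' k l \<in> {lo k..hi k}"
      using strand[of i j] strand[of k l] that by auto
    then show ?thesis using disj[of i k] that by (metis disjoint_iff)
  qed
  have notF: "u i j \<notin> Field Y" if "u \<in> {t, t'}" "i < 3" "j < 3" "i \<noteq> j" for u i j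
    using out strand that by blast
  have cY: "c u i j \<notin> Y" if "u \<in> {t, t'}" "i < 3" "j < 3" "i \<noteq> j" for u i j
    using notF[OF that] notF[of u j i] that in_Field_fst_snd[of "c u i j" Y]
    by (auto simp: c_def strand_crossing_def split: if_splits)
  have c_ne: "c u i j \<noteq> c u' k l"
    if "u \<in> {t, t'}" "u' \<in> {t, t'}" "(i, j) \<in> {(0, 1), (0, 2), (1, 2)}" "(k, l) \<in> {(0, 1), (0, 2), (1, 2)}" "(i, j) \<noteq> (k, l)"
    for u u' i j k l
  proof
    assume eq: "c u i j = c u' k l"
    have "{fst (c u i j), snd (c u i j)} = {u i j, u j i}" "{fst (c u' k l), snd (c u' k l)} = {u' k l, u' l k}"
      by (auto simp: c_def strand_crossing_def)
    then have *: "u i j \<in> {u' k l, u' l k}" "u j i \<in> {u' k l, u' l k}"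
      unfolding eq by blast+
    have b: "i < 3" "j < 3" "k < 3" "l < 3" "i \<noteq> j" "k \<noteq> l" "i \<noteq> k \<and> i \<noteq> l \<or> j \<noteq> k \<and> j \<noteq> l"
      using that(3-5) by auto
    show False
      using b(7) * ne[OF that(1,2), of i j k l] ne[OF that(1,2), of i j l k]
        ne[OF that(1,2), of j i k l] ne[OF that(1,2), of j i l k] b(1-6) by auto
  qed
  have pair: "pairing (Y \<union> {c u 0 1, c u 0 2, c u 1 2}) e'' f g = pairing Y e'' f g +
      (triangle_term u w f g 0 1 + triangle_term u w f g 0 2 + triangle_term u w f g 1 2)"
    if u: "u \<in> {t, t'}" and e'': "\<And>i j. (i, j) \<in> {(0, 1), (0, 2), (1, 2)} \<Longrightarrow> e'' (c u i j) = (if ov i j then w i j else - w i j)"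
    for u e'' f g
  proof -
    have one: "e'' (c u i j) * (f (fst (c u i j)) * g (snd (c u i j)) - f (snd (c u i j)) * g (fst (c u i j)))
        = triangle_term u w f g i j" if "(i, j) \<in> {(0, 1), (0, 2), (1, 2)}" for i j
      unfolding e''[OF that] by (simp add: c_def strand_crossing_def triangle_term_def algebra_simps)
    have "Y \<union> {c u 0 1, c u 0 2, c u 1 2} = insert (c u 0 1) (insert (c u 0 2) (insert (c u 1 2) Y))"
      by blast
    moreover have "c u 0 1 \<notin> insert (c u 0 2) (insert (c u 1 2) Y)" "c u 0 2 \<notin> insert (c u 1 2) Y" "c u 1 2 \<notin> Y"
      using u c_ne[of u u 0 1 0 2] c_ne[of u u 0 1 1 2] c_ne[of u u 0 2 1 2] cY[of u 0 1] cY[of u 0 2] cY[of u 1 2]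
      by simp_all
    ultimately show ?thesis
      using finY one[of 0 1] one[of 0 2] one[of 1 2] by (simp add: pairing_insert)
  qed
  define \<phi> where "\<phi> = (\<lambda>x. if x = c t 0 1 then c t' 0 1 else if x = c t 0 2 then c t' 0 2
      else if x = c t 1 2 then c t' 1 2 else x)"
  have \<phi>c: "\<phi> (c t i j) = c t' i j" if "(i, j) \<in> {(0, 1), (0, 2), (1, 2)}" for i j
    using that c_ne[of t t 0 2 0 1] c_ne[of t t 1 2 0 1] c_ne[of t t 1 2 0 2] by (auto simp: \<phi>_def)
  have \<phi>Y: "\<phi> y = y" if "y \<in> Y" for y
    using that cY[of t 0 1] cY[of t 0 2] cY[of t 1 2] by (auto simp: \<phi>_def)
  have bij: "bij_betw \<phi> ?X ?X'"
  proof (rule bij_betw_imageI)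
    show "\<phi> ` ?X = ?X'"
      using \<phi>Y \<phi>c[of 0 1] \<phi>c[of 0 2] \<phi>c[of 1 2] by (force simp: image_Un)
    have c: "c t' 0 1 \<noteq> c t' 0 2" "c t' 0 1 \<noteq> c t' 1 2" "c t' 0 2 \<noteq> c t' 1 2"
      "c t' 0 1 \<notin> Y" "c t' 0 2 \<notin> Y" "c t' 1 2 \<notin> Y"
      using c_ne[of t' t' 0 1 0 2] c_ne[of t' t' 0 1 1 2] c_ne[of t' t' 0 2 1 2] cY[of t' 0 1] cY[of t' 0 2] cY[of t' 1 2]
      by simp_all
    have "card (\<phi> ` ?X) = card ?X"
      unfolding \<open>\<phi> ` ?X = ?X'\<close>
      using c finY c_ne[of t t 0 1 0 2] c_ne[of t t 0 1 1 2] c_ne[of t t 0 2 1 2] cY[of t 0 1] cY[of t 0 2] cY[of t 1 2]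
      by simp
    then show "inj_on \<phi> ?X"
      using finY by (intro eq_card_imp_inj_on) simp_all
  qed
  have alpha_c: "\<exists>o'. (\<forall>r. alpha_arc (c t k l) r = o' * (step (t k l) r - step (t l k) r)) \<and>
        (\<forall>r. alpha_arc (c t' k l) r = o' * (step (t' k l) r - step (t' l k) r)) \<and> o' * step (t l k) (t k l) = - 1 "
    if kl: "k < 3" "l < 3" "k \<noteq> l" for k l
  proof -
    have c: "alpha_arc (c u k l) = alpha_arc (u k l, u l k)" for u
      by (simp add: c_def strand_crossing_def alpha_arc_swap)
    have s: "t k l < t l k \<longleftrightarrow> t' k l < t' l k" "t l k < t k l \<or> t k l < t l k"
      using sep[OF kl, of "t k l" "t' k l" "t l k" "t' l k"] strand[of k l] strand[of l k] kl ne[of t t k l l k]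
      by auto
    have o: "chord_orientation (t' k l, t' l k) = chord_orientation (t k l, t l k)"
      "chord_orientation (t k l, t l k) * step (t l k) (t k l) = - 1"
      using s by (auto simp: chord_orientation_def step_def)
    show ?thesis
      using ne[of t t k l l k] ne[of t' t' k l l k] kl o
      by (intro exI[of _ "chord_orientation (t k l, t l k)"]) (simp add: c alpha_arc_step)
  qed
  have const: "triangle_pair Y t t' w (\<lambda>_. 1) (\<lambda>_. 1)"
    by (simp add: triangle_pair_def)
  have alpha_Y: "triangle_pair Y t t' w (alpha_arc y) (alpha_arc y)" if y: "y \<in> Y" for y
  proof -
    have "fst y \<in> Field Y" "snd y \<in> Field Y" using y by (rule in_Field_fst_snd)+
    then have "alpha_arc y r = alpha_arc y s" if "i < 3" "r \<in> {lo i..hi i}" "s \<in> {lo i..hi i}" for i r s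
      using outside[of i _ r s] that gauss_diagramD(2)[OF X, of y] y by (simp add: alpha_arc_step)
    then have "alpha_arc y (u k l) = alpha_arc y (u' k m)" 
      if "u \<in> {t, t'}" "u' \<in> {t, t'}" "k < 3" "l < 3" "m < 3" "k \<noteq> l" "k \<noteq> m" for u u' k l m
      using strand[of k l] strand[of k m] that by blast
    note * = this
    show ?thesis
      unfolding triangle_pair_def
    proof (intro conjI ballI allI impI refl)
      fix k l m assume "strand_triple k l m"
      then have klm: "k < 3" "l < 3" "m < 3" "k \<noteq> l" "l \<noteq> m" "k \<noteq> m" by (simp_all add: strand_triple_def)
      show "alpha_arc y (t k l) + alpha_arc y (t' k l) = alpha_arc y (t k m) + alpha_arc y (t' k m)"
        using *[of t t k l m] *[of t' t' k l m] klm by simp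
      show "w m k * (alpha_arc y (t k m) - alpha_arc y (t' k m)) + w m l * (alpha_arc y (t l m) - alpha_arc y (t' l m)) = 0"
        using *[of t t' k m m] *[of t t' l m m] klm by simp
    qed
  qed
  have alpha_new: "triangle_pair Y t t' w (alpha_arc (c t k l)) (alpha_arc (c t' k l))"
    if klm: "strand_triple k l m" for k l m
  proof -
    have K: "k < 3" "l < 3" "m < 3" "k \<noteq> l" "l \<noteq> m" "k \<noteq> m"
      using klm by (simp_all add: strand_triple_def)
    obtain o' where o: "\<And>r. alpha_arc (c t k l) r = o' * (step (t k l) r - step (t l k) r)"
      "\<And>r. alpha_arc (c t' k l) r = o' * (step (t' k l) r - step (t' l k) r)" "o' * step (t l k) (t k l) = - 1"
      using alpha_c[OF K(1,2,4)] by blast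
    have S: "step (u i j) (v i' j') = step (t i i') (t i' i)"
      if "u \<in> {t, t'}" "v \<in> {t, t'}" "i < 3" "j < 3" "i' < 3" "j' < 3" "i \<noteq> j" "i' \<noteq> j'" "i \<noteq> i'" for u v i j i' j'
    proof -
      have "u i j \<in> {lo i..hi i}" "v i' j' \<in> {lo i'..hi i'}" "t i i' \<in> {lo i..hi i}" "t i' i \<in> {lo i'..hi i'}"
        using strand[of i j] strand[of i' j'] strand[of i i'] strand[of i' i] that by auto
      then show ?thesis using sep[of i i'] that by blast
    qed
    have SY: "step (t' i j) r = step (t i j) r" if "i < 3" "j < 3" "i \<noteq> j" "r \<in> Field Y" for i j r
      using outside[of i r] strand[of i j] that by blast
    have F: "step (t' k l) (t' k m) = - step (t k l) (t k m)" "step (t' l k) (t' l m) = - step (t l k) (t l m)"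
      using flip[of k l m] flip[of l k m] klm by (auto simp: strand_triple_def)
    have B: "w m k * step (t k l) (t k m) = w m l * step (t l k) (t l m)"
      using balanced[OF klm] .
    have o2: "o' * step (t k l) (t l k) = 1"
      using o(3) step_swap[of "t k l" "t l k"] by simp
    have vals: "alpha_arc (c t k l) (t k l) = 1" "alpha_arc (c t' k l) (t' k l) = 1"
      "alpha_arc (c t k l) (t l k) = 1" "alpha_arc (c t' k l) (t' l k) = 1"
      by (simp_all add: c_def strand_crossing_def alpha_arc_end[of "(_, _)", simplified])
    have vk: "alpha_arc (c t k l) (t k m) = o' * step (t k l) (t k m) + 1"
      "alpha_arc (c t' k l) (t' k m) = - o' * step (t k l) (t k m) + 1"
      using o(3) F K S[of t t l k k m] S[of t' t' l k k m] by (simp_all add: o(1,2) algebra_simps)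
    have vl: "alpha_arc (c t k l) (t l m) = 1 - o' * step (t l k) (t l m)"
      "alpha_arc (c t' k l) (t' l m) = 1 + o' * step (t l k) (t l m)"
      using o2 F K S[of t t k l l m] S[of t' t' k l l m] by (simp_all add: o(1,2) algebra_simps)
    have vm: "alpha_arc (c t' k l) (t' m k) = alpha_arc (c t k l) (t m k)" "alpha_arc (c t' k l) (t' m l) = alpha_arc (c t k l) (t m k)"
      "alpha_arc (c t k l) (t m l) = alpha_arc (c t k l) (t m k)"
      using K S[of t t k l m k] S[of t t l k m k] S[of t t k l m l] S[of t t l k m l]
        S[of t' t' k l m k] S[of t' t' l k m k] S[of t' t' k l m l] S[of t' t' l k m l]
      by (simp_all add: o(1,2))
    have Bo: "w m k * (o' * step (t k l) (t k m)) = w m l * (o' * step (t l k) (t l m))"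
      using B by (metis mult.left_commute)
    show ?thesis
      unfolding triangle_pair_def
    proof (intro conjI ballI allI impI)
      fix r assume "r \<in> Field Y"
      then show "alpha_arc (c t' k l) r = alpha_arc (c t k l) r"
        using K by (simp add: o(1,2) SY)
    next
      fix k' l' m' assume t3: "strand_triple k' l' m'"
      have perm: "k' = k \<and> l' = l \<and> m' = m \<or> k' = k \<and> l' = m \<and> m' = l \<or> k' = l \<and> l' = k \<and> m' = m
          \<or> k' = l \<and> l' = m \<and> m' = k \<or> k' = m \<and> l' = k \<and> m' = l \<or> k' = m \<and> l' = l \<and> m' = k"
      proof -
        have three: "x \<in> {0, 1, 2}" if "x < 3" for x :: nat using that by auto
        have "x = k \<or> x = l \<or> x = m" if "x < 3" for x
          using K(4-6) three[OF that] three[OF K(1)] three[OF K(2)] three[OF K(3)] by auto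
        then have "k' = k \<or> k' = l \<or> k' = m" "l' = k \<or> l' = l \<or> l' = m" "m' = k \<or> m' = l \<or> m' = m"
          "k' \<noteq> l'" "l' \<noteq> m'" "k' \<noteq> m'"
          using t3 unfolding strand_triple_def by simp_all
        then show ?thesis by (elim disjE) simp_all
      qed
      from perm show "alpha_arc (c t k l) (t k' l') + alpha_arc (c t' k l) (t' k' l') =
            alpha_arc (c t k l) (t k' m') + alpha_arc (c t' k l) (t' k' m')"
        by (elim disjE conjE) (simp_all add: vals vk vl vm)
      have dk: "alpha_arc (c t k l) (t k m) - alpha_arc (c t' k l) (t' k m) = 2 * (o' * step (t k l) (t k m))"
        and dl: "alpha_arc (c t k l) (t l m) - alpha_arc (c t' k l) (t' l m) = - 2 * (o' * step (t l k) (t l m))"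
        unfolding vk vl by simp_all
      have balance: "w m k * (2 * (o' * step (t k l) (t k m))) + w m l * (- 2 * (o' * step (t l k) (t l m))) = 0"
        using Bo by simp
      have balance': "w m l * (- 2 * (o' * step (t l k) (t l m))) + w m k * (2 * (o' * step (t k l) (t k m))) = 0"
        using balance by simp
      from perm show "w m' k' * (alpha_arc (c t k l) (t k' m') - alpha_arc (c t' k l) (t' k' m')) +
            w m' l' * (alpha_arc (c t k l) (t l' m') - alpha_arc (c t' k l) (t' l' m')) = 0"
        by (elim disjE conjE) (simp_all only: dk dl balance balance' vals vm diff_self mult_zero_right add_0)
    qed
  qed
  have alpha: "triangle_pair Y t t' w (alpha_arc x) (alpha_arc (\<phi> x))" if "x \<in> ?X" for x
    using that alpha_Y[of x] alpha_new[of 0 1 2] alpha_new[of 0 2 1] alpha_new[of 1 2 0]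
      \<phi>Y[of x] \<phi>c[of 0 1] \<phi>c[of 0 2] \<phi>c[of 1 2] by auto
  have inv: "pairing ?X' e' f' g' = pairing ?X e f g"
    if "triangle_pair Y t t' w f f'" "triangle_pair Y t t' w g g'" for f f' g g'
  proof -
    have "pairing Y e' f' g' = pairing Y e f g"
      using that by (intro pairing_cong) (simp_all add: triangle_pair_def eY)
    then show ?thesis
      using triangle_terms_invariant[OF that w] pair[of t e f g, OF _ e] pair[of t' e' f' g', OF _ e'] by simp
  qed
  have weight: "typed_weight e' a (\<phi> x) = typed_weight e a x" if "x \<in> ?X" for x a
  proof -
    have tri: "typed_weight e' a (c t' i j) = typed_weight e a (c t i j)" if ij: "(i, j) \<in> {(0, 1), (0, 2), (1, 2)}" for i j
    proof -
      have "i < 3" "j < 3" "i \<noteq> j" using ij by auto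
      then have "t i j < t j i \<longleftrightarrow> t' i j < t' j i" "t j i < t i j \<longleftrightarrow> t' j i < t' i j"
        using sep[of i j "t i j" "t' i j" "t j i" "t' j i"] sep[of j i "t j i" "t' j i" "t i j" "t' i j"]
          strand[of i j] strand[of j i] by auto
      then show ?thesis
        using e[OF ij] e'[OF ij] by (simp add: typed_weight_def) (simp add: c_def strand_crossing_def)
    qed
    from that consider "x \<in> Y" | "x = c t 0 1" | "x = c t 0 2" | "x = c t 1 2" by blast
    then show ?thesis
    proof cases
      case 1
      then show ?thesis using \<phi>Y[OF 1] eY[OF 1] by (simp add: typed_weight_def)
    qed (use tri[of 0 1] tri[of 0 2] tri[of 1 2] \<phi>c[of 0 1] \<phi>c[of 0 2] \<phi>c[of 1 2] in simp_all)
  qed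
  show ?thesis
    unfolding gauss_polys_def
    by (rule long_polys_reindex[OF bij]; (rule weight inv)?; (rule alpha const)?; assumption)
qed

section \<open>Planar diagrams\<close>

definition diagram_polys :: "diagram \<Rightarrow> nat \<Rightarrow> nat \<Rightarrow> laurent \<times> laurent \<times> laurent \<times> laurent" where
  "diagram_polys D = gauss_polys (real_crossings D) (diagram_sign D)"

definition closed_diagram_polys :: "diagram \<Rightarrow> laurent \<times> laurent \<times> laurent" where
  "closed_diagram_polys D = closed_gauss_polys (real_crossings D) (diagram_sign D)"

text \<open>
  The fundamental domain of a closed diagram is treated like the line of a long diagram. Only at the
  parameter 0 has the periodicity to be used.
\<close>

definition parameter_domain :: "real set \<Rightarrow> diagram \<Rightarrow> bool" where
  "parameter_domain T D \<longleftrightarrow> virtual_diagram_on T D \<and>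
     (T = UNIV \<or> T = {0..<1} \<and> (\<forall>t. curve D (t + 1) = curve D t))"

lemma velocity_works:
  assumes "c C1_differentiable_on UNIV"
  shows "(c has_vector_derivative velocity c t) (at t)"
  using assms unfolding C1_differentiable_on_eq velocity_def
  by (simp add: vector_derivative_works)

lemma velocity_eqI: "(c has_vector_derivative v) (at t) \<Longrightarrow> velocity c t = v"
  unfolding velocity_def by (rule vector_derivative_at)

text \<open>Even at an end of the interval, the derivative is determined by the values in the interval.\<close>

lemma velocity_unique_on_interval:
  assumes f: "(f has_vector_derivative v) (at r)" and g: "(g has_vector_derivative w) (at r)"
    and "a < b" "r \<in> {a..b}" and eq: "\<And>s. s \<in> {a..b} \<Longrightarrow> f s = g s"
  shows "v = w"
proof (rule vector_derivative_unique_within_closed_interval[of a b r f])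
  show "(f has_vector_derivative v) (at r within cbox a b)"
    using f by (rule has_vector_derivative_at_within)
  have "(g has_vector_derivative w) (at r within {a..b})"
    using g by (rule has_vector_derivative_at_within)
  with assms(4) eq have "(f has_vector_derivative w) (at r within {a..b})"
    by (intro has_vector_derivative_transform[of r "{a..b}" f g]) auto
  then show "(f has_vector_derivative w) (at r within cbox a b)" by simp
qed (use assms in auto)

lemma velocity_affine:
  fixes f :: "complex \<Rightarrow> real"
  assumes "c C1_differentiable_on UNIV" "bounded_linear f"
    and "a < b" "r \<in> {a..b}" and "\<And>s. s \<in> {a..b} \<Longrightarrow> f (c s) = m * s + n"
  shows "f (velocity c r) = m"
proof (rule velocity_unique_on_interval[of "\<lambda>s. f (c s)" _ r "\<lambda>s. m * s + n" m])
  show "((\<lambda>s. f (c s)) has_vector_derivative f (velocity c r)) (at r)"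
    using bounded_linear.has_vector_derivative[OF assms(2) velocity_works[OF assms(1)]] .
  show "((\<lambda>s. m * s + n) has_vector_derivative m) (at r)"
    by (auto intro!: derivative_eq_intros simp: has_real_derivative_iff_has_vector_derivative[symmetric])
qed (use assms in auto)

lemma sweepsE:
  assumes "sweeps f a b"
  obtains \<sigma> m where "\<sigma> = 1 \<or> \<sigma> = -1" "0 < m" "a < b" "m * (b - a) = 2"
    "\<And>t. t \<in> {a..b} \<Longrightarrow> f t = \<sigma> * (m * (t - a) - 1)"
proof -
  obtain \<sigma> where \<sigma>: "\<sigma> \<in> {1, -1}" "a < b" "\<And>t. t \<in> {a..b} \<Longrightarrow> f t = \<sigma> * ((2 * t - a - b) / (b - a))"
    using assms unfolding sweeps_def by blast
  have "(2 * t - a - b) / (b - a) = 2 / (b - a) * (t - a) - 1" for t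
    using \<sigma>(2) by (simp add: field_simps)
  moreover have "2 / (b - a) * (b - a) = 2" "0 < 2 / (b - a)" using \<sigma>(2) by (simp_all add: field_simps)
  ultimately show thesis
    using \<sigma> by (intro that[of \<sigma> "2 / (b - a)"]) auto
qed

lemma sweeps_inj:
  assumes "sweeps f a b" "s \<in> {a..b}" "t \<in> {a..b}" "f s = f t"
  shows "s = t"
proof -
  obtain \<sigma> m where \<sigma>: "\<sigma> = 1 \<or> \<sigma> = -1" "0 < m" "\<And>t. t \<in> {a..b} \<Longrightarrow> f t = \<sigma> * (m * (t - a) - 1)"
    using assms(1) by (rule sweepsE) blast
  have "m * (s - a) = m * (t - a)"
    using \<sigma>(1) \<sigma>(3)[OF assms(2)] \<sigma>(3)[OF assms(3)] assms(4) by auto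
  then show ?thesis using \<sigma>(2) by simp
qed

lemma sweeps_bound:
  assumes "sweeps f a b" "t \<in> {a..b}"
  shows "\<bar>f t\<bar> \<le> 1"
proof -
  obtain \<sigma> m where \<sigma>: "\<sigma> = 1 \<or> \<sigma> = -1" "0 < m" "m * (b - a) = 2"
      "\<And>t. t \<in> {a..b} \<Longrightarrow> f t = \<sigma> * (m * (t - a) - 1)"
    using assms(1) by (rule sweepsE) blast
  have "0 \<le> m * (t - a)" "m * (t - a) \<le> m * (b - a)"
    using \<sigma>(2) assms(2) by auto
  then have "\<bar>m * (t - a) - 1\<bar> \<le> 1" using \<sigma>(3) by (simp add: abs_le_iff)
  then show ?thesis using \<sigma>(1) \<sigma>(4)[OF assms(2)] by (auto simp: abs_mult)
qed

lemma sweeps_onto: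
  assumes "sweeps f a b" "\<bar>x\<bar> \<le> 1"
  obtains t where "t \<in> {a..b}" "f t = x"
proof -
  obtain \<sigma> m where \<sigma>: "\<sigma> = 1 \<or> \<sigma> = -1" "0 < m" "m * (b - a) = 2"
      "\<And>t. t \<in> {a..b} \<Longrightarrow> f t = \<sigma> * (m * (t - a) - 1)"
    using assms(1) by (rule sweepsE) blast
  have x: "0 \<le> \<sigma> * x + 1" "\<sigma> * x + 1 \<le> 2" "\<sigma> * (\<sigma> * x) = x" using \<sigma>(1) assms(2) by auto
  have "b - a = 2 / m" using \<sigma>(2,3) by (simp add: field_simps)
  moreover have "(\<sigma> * x + 1) / m \<le> 2 / m" "0 \<le> (\<sigma> * x + 1) / m"
    using \<sigma>(2) x by (auto intro: divide_right_mono)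
  ultimately have t: "a + (\<sigma> * x + 1) / m \<in> {a..b}" by simp
  moreover have "f (a + (\<sigma> * x + 1) / m) = x"
    using \<sigma>(2) \<sigma>(4)[OF t] x(3) by simp
  ultimately show thesis by (rule that)
qed

text \<open>The strands of the moves cross in directions that only depend on the way in which they run.\<close>

lemma sweeps_velocity:
  assumes "sweeps (\<lambda>t. f (c t)) a b" "c C1_differentiable_on UNIV" "bounded_linear f"
  obtains \<sigma> m where "\<sigma> = 1 \<or> \<sigma> = -1" "0 < m" "a < b"
    "\<And>s t. s \<in> {a..b} \<Longrightarrow> t \<in> {a..b} \<Longrightarrow> f (c t) - f (c s) = \<sigma> * m * (t - s)"
    "\<And>r d. r \<in> {a..b} \<Longrightarrow> d C1_differentiable_on UNIV \<Longrightarrow> (\<And>t. t \<in> {a..b} \<Longrightarrow> f (d t) = f (c t)) \<Longrightarrow>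
       f (velocity d r) = \<sigma> * m"
proof -
  obtain \<sigma> m where \<sigma>: "\<sigma> = 1 \<or> \<sigma> = -1" "0 < m" "a < b"
      "\<And>t. t \<in> {a..b} \<Longrightarrow> f (c t) = \<sigma> * (m * (t - a) - 1)"
    using assms(1) by (rule sweepsE) blast
  show thesis
  proof (rule that[OF \<sigma>(1-3)])
    show "f (c t) - f (c s) = \<sigma> * m * (t - s)" if "s \<in> {a..b}" "t \<in> {a..b}" for s t
      by (simp add: \<sigma>(4)[OF that(1)] \<sigma>(4)[OF that(2)] algebra_simps)
    show "f (velocity d r) = \<sigma> * m"
      if "r \<in> {a..b}" "d C1_differentiable_on UNIV" "\<And>t. t \<in> {a..b} \<Longrightarrow> f (d t) = f (c t)" for r d
      by (rule velocity_affine[OF that(2) assms(3) \<sigma>(3) that(1), of _ "- \<sigma> * (m * a + 1)"])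
         (simp add: that(3) \<sigma>(4) algebra_simps)
  qed
qed

lemma virtual_diagram_onD:
  assumes "virtual_diagram_on T D"
  shows "curve D C1_differentiable_on UNIV" "finite (real_crossings D)"
    and "x \<in> real_crossings D \<Longrightarrow> fst x \<in> T \<and> snd x \<in> T \<and> fst x \<noteq> snd x \<and> curve D (fst x) = curve D (snd x)"
    and "s \<in> T \<Longrightarrow> t \<in> T \<Longrightarrow> s \<noteq> t \<Longrightarrow> curve D s = curve D t \<Longrightarrow>
      det2 (velocity (curve D) s) (velocity (curve D) t) \<noteq> 0"
    and "s \<in> T \<Longrightarrow> t \<in> T \<Longrightarrow> u \<in> T \<Longrightarrow> curve D s = curve D t \<Longrightarrow> curve D t = curve D u \<Longrightarrow>
      s = t \<or> t = u \<or> s = u"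
    and "x \<in> real_crossings D \<Longrightarrow> (snd x, fst x) \<notin> real_crossings D"
proof -
  note d = assms[unfolded virtual_diagram_on_def]
  show "curve D C1_differentiable_on UNIV" using d by blast
  show "finite (real_crossings D)" using d by (blast intro: finite_subset)
  show "fst x \<in> T \<and> snd x \<in> T \<and> fst x \<noteq> snd x \<and> curve D (fst x) = curve D (snd x)" if "x \<in> real_crossings D"
  proof -
    have "x \<in> double_points T (curve D)" using d that by blast
    then show ?thesis by (auto simp: double_points_def)
  qed
  show "det2 (velocity (curve D) s) (velocity (curve D) t) \<noteq> 0"
    if "s \<in> T" "t \<in> T" "s \<noteq> t" "curve D s = curve D t"
  proof -
    have "(s, t) \<in> double_points T (curve D)" using that by (simp add: double_points_def)
    then show ?thesis using d by blast
  qed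
  show "s = t \<or> t = u \<or> s = u"
    if "s \<in> T" "t \<in> T" "u \<in> T" "curve D s = curve D t" "curve D t = curve D u"
    using d that by blast
  show "(snd x, fst x) \<notin> real_crossings D" if "x \<in> real_crossings D"
    using d that by (metis prod.collapse)
qed

lemma gauss_diagram_of_diagram:
  assumes "virtual_diagram_on T D"
  shows "gauss_diagram (real_crossings D) (diagram_sign D)"
  unfolding gauss_diagram_def
proof (intro conjI ballI)
  note d = virtual_diagram_onD[OF assms]
  show "finite (real_crossings D)" by (rule d(2))
  have dx: "fst x \<in> T" "snd x \<in> T" "fst x \<noteq> snd x" "curve D (fst x) = curve D (snd x)"
    if "x \<in> real_crossings D" for x
    using d(3)[OF that] by blast+
  show "inj_on fst (real_crossings D)"
  proof (rule inj_onI)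
    fix x y assume xy: "x \<in> real_crossings D" "y \<in> real_crossings D" "fst x = fst y"
    then show "x = y"
      using d(5)[of "snd x" "fst x" "snd y"] dx[OF xy(1)] dx[OF xy(2)] by (metis prod_eqI)
  qed
  show "inj_on snd (real_crossings D)"
  proof (rule inj_onI)
    fix x y assume xy: "x \<in> real_crossings D" "y \<in> real_crossings D" "snd x = snd y"
    then show "x = y"
      using d(5)[of "fst x" "snd x" "fst y"] dx[OF xy(1)] dx[OF xy(2)] by (metis prod_eqI)
  qed
  have False if xy: "x \<in> real_crossings D" "y \<in> real_crossings D" "fst x = snd y" for x y
  proof -
    have "snd x = fst y"
      using d(5)[of "snd x" "fst x" "fst y"] dx[OF xy(1)] dx[OF xy(2)] xy(3) by metis
    then have "y = (snd x, fst x)" using xy(3) by (simp add: prod_eq_iff)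
    then show False using d(6)[OF xy(1)] xy(2) by simp
  qed
  then show "fst ` real_crossings D \<inter> snd ` real_crossings D = {}" by blast
  show "diagram_sign D x \<in> {1, - 1}" for x
    by (simp add: diagram_sign_def case_prod_beta)
qed

lemma parameter_domainD:
  assumes "parameter_domain T D"
  shows "virtual_diagram_on T D" "curve D C1_differentiable_on UNIV"
    "gauss_diagram (real_crossings D) (diagram_sign D)"
  using assms virtual_diagram_onD(1) gauss_diagram_of_diagram unfolding parameter_domain_def by blast+

text \<open>Outside the strands that are moved, the crossings keep their signs.\<close>

lemma velocity_outside:
  assumes T: "T = UNIV \<or> T = {0..<1}" and C1: "c C1_differentiable_on UNIV" "c' C1_differentiable_on UNIV"
    and J: "closed J" and eq: "\<And>t. t \<in> T - J \<Longrightarrow> c' t = c t" and r: "r \<in> T - J"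
  shows "velocity c' r = velocity c r"
proof -
  have "open (- J)" using J by blast
  then obtain \<delta> where \<delta>: "\<delta> > 0" "ball r \<delta> \<subseteq> - J"
    using r by (metis ComplI Diff_iff open_contains_ball)
  obtain \<delta>' where \<delta>': "\<delta>' > 0" "{r..r + \<delta>'} \<subseteq> T"
  proof (cases "T = UNIV")
    case True
    then show ?thesis using that[of 1] by simp
  next
    case False
    then have "T = {0..<1}" using T by blast
    then have "r < 1" "{r..r + (1 - r) / 2} \<subseteq> T" using r by (auto simp: field_simps)
    then show ?thesis by (intro that[of "(1 - r) / 2"]) auto
  qed
  define \<eta> where "\<eta> = min (\<delta> / 2) \<delta>'"
  have "\<eta> > 0" using \<delta> \<delta>' by (simp add: \<eta>_def)
  have "{r..r + \<eta>} \<subseteq> T - J"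
    using \<delta> \<delta>' by (auto simp: \<eta>_def subset_iff dist_real_def)
  then show ?thesis
    using \<open>\<eta> > 0\<close> eq
    by (intro velocity_unique_on_interval[OF velocity_works[OF C1(2)] velocity_works[OF C1(1)], of r "r + \<eta>"]) auto
qed

lemma diagram_sign_outside:
  assumes "parameter_domain T D" "parameter_domain T D'"
    and "closed J" "\<And>t. t \<in> T - J \<Longrightarrow> curve D' t = curve D t"
    and "fst x \<in> T - J" "snd x \<in> T - J"
  shows "diagram_sign D' x = diagram_sign D x"
proof -
  have "T = UNIV \<or> T = {0..<1}" using assms(1) unfolding parameter_domain_def by blast
  then have v: "velocity (curve D') r = velocity (curve D) r" if "r \<in> T - J" for r
    using parameter_domainD(2)[OF assms(1)] parameter_domainD(2)[OF assms(2)] assms(3,4) that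
    by (rule velocity_outside)
  show ?thesis
    by (simp add: diagram_sign_def case_prod_beta v[OF assms(5)] v[OF assms(6)])
qed

text \<open>A moved strand also keeps its ends, by continuity from outside.\<close>

lemma continuous_eq_at_limit:
  fixes c c' :: "real \<Rightarrow> complex"
  assumes "continuous_on UNIV c" "continuous_on UNIV c'" "a < b" "\<And>t. t \<in> {a<..<b} \<Longrightarrow> c' t = c t" "t \<in> {a..b}"
  shows "c' t = c t"
proof -
  have "closed {t. c' t = c t}"
    using assms(1,2) by (intro closed_Collect_eq)
  moreover have "{a<..<b} \<subseteq> {t. c' t = c t}" using assms(4) by blast
  ultimately have "closure {a<..<b} \<subseteq> {t. c' t = c t}" by (rule closure_minimal[rotated])
  then show ?thesis using assms(3,5) by (auto simp: closure_greaterThanLessThan)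
qed

lemma strand_ends_fixed:
  assumes D: "parameter_domain T D" "parameter_domain T D'" and ab: "a < b" "{a..b} \<subseteq> T"
    and eq: "\<And>t. t \<in> T - {a..b} \<Longrightarrow> curve D' t = curve D t"
  shows "curve D' a = curve D a" "curve D' b = curve D b"
proof -
  have cont: "continuous_on UNIV (curve D)" "continuous_on UNIV (curve D')"
    using parameter_domainD(2) D C1_differentiable_imp_continuous_on by blast+
  have "\<exists>\<delta>>0. (\<forall>t\<in>{a - \<delta><..<a}. curve D' t = curve D t) \<and> (\<forall>t\<in>{b<..<b + \<delta>}. curve D' t = curve D t)"
  proof (cases "T = UNIV")
    case True
    then show ?thesis using eq by (intro exI[of _ 1]) auto
  next
    case False
    then have T: "T = {0..<1}" "curve D (t + 1) = curve D t" "curve D' (t + 1) = curve D' t" for t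
      using D unfolding parameter_domain_def by blast+
    have "a \<in> {a..b}" "b \<in> {a..b}" using ab(1) by simp_all
    then have "0 \<le> a" "0 \<le> b" "b < 1" using ab(2) T(1) by auto
    have "curve D' t = curve D t" if "t \<in> {a - (1 - b)<..<a}" for t
    proof (cases "t < 0")
      case True
      then have "t + 1 \<in> T - {a..b}" using that \<open>0 \<le> a\<close> \<open>0 \<le> b\<close> T(1) by auto
      then show ?thesis using eq T(2,3) by metis
    next
      case False
      then show ?thesis using that \<open>b < 1\<close> ab(1) T(1) by (intro eq) auto
    qed
    moreover have "curve D' t = curve D t" if "t \<in> {b<..<b + (1 - b)}" for t
      using that \<open>0 \<le> a\<close> ab(1) T(1) by (intro eq) auto
    ultimately show ?thesis using \<open>b < 1\<close> by (intro exI[of _ "1 - b"]) auto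
  qed
  then obtain \<delta> where \<delta>: "\<delta> > 0" "\<And>t. t \<in> {a - \<delta><..<a} \<Longrightarrow> curve D' t = curve D t"
    "\<And>t. t \<in> {b<..<b + \<delta>} \<Longrightarrow> curve D' t = curve D t"
    by blast
  have "a - \<delta> < a" "a \<in> {a - \<delta>..a}" "b < b + \<delta>" "b \<in> {b..b + \<delta>}"
    unfolding atLeastAtMost_iff using \<delta>(1) by linarith+
  then show "curve D' a = curve D a" "curve D' b = curve D b"
    using continuous_eq_at_limit[OF cont _ \<delta>(2)] continuous_eq_at_limit[OF cont _ \<delta>(3)] by blast+
qed

text \<open>
  A crossing on J would pair a parameter in J either with another one in J, against injectivity, or with one
  outside J, where the curve is not in the square.
\<close>

lemma strands_without_crossings:
  assumes D: "virtual_diagram_on T D" and inj: "inj_on (curve D) J"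
    and inside: "curve D ` J \<subseteq> square" and outside: "\<And>t. t \<in> T - J \<Longrightarrow> curve D t \<notin> square"
  shows "Field (real_crossings D) \<inter> J = {}"
proof (rule ccontr)
  assume "Field (real_crossings D) \<inter> J \<noteq> {}"
  then obtain r where r: "r \<in> Field (real_crossings D)" "r \<in> J" by blast
  obtain x where x: "x \<in> real_crossings D" "r = fst x \<or> r = snd x" using r(1) by (rule Field_obtain)
  obtain s where s: "s \<in> T" "s \<noteq> r" "curve D s = curve D r"
    using virtual_diagram_onD(3)[OF D x(1)] x(2) by metis
  show False
  proof (cases "s \<in> J")
    case True
    then show False using inj s r(2) by (auto dest: inj_onD)
  next
    case False
    then show False using outside[of s] s inside r(2) by auto
  qed
qed

lemma diagram_polys_cong_outside:
  assumes D: "parameter_domain T D" "parameter_domain T D'"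
    and J: "closed J" "\<And>t. t \<in> T - J \<Longrightarrow> curve D' t = curve D t"
    and X: "X \<subseteq> real_crossings D" "Field X \<inter> J = {}"
  shows "gauss_polys X (diagram_sign D') i j = gauss_polys X (diagram_sign D) i j"
proof (rule gauss_polys_cong)
  fix x assume x: "x \<in> X"
  then have "fst x \<in> T" "snd x \<in> T"
    using virtual_diagram_onD(3)[OF parameter_domainD(1)[OF D(1)]] X(1) by blast+
  moreover have "fst x \<notin> J" "snd x \<notin> J"
    using X(2) in_Field_fst_snd[OF x] by blast+
  ultimately show "diagram_sign D' x = diagram_sign D x"
    by (intro diagram_sign_outside[OF D J]) auto
qed

subsection \<open>The first move\<close>

text \<open>
  Before the move, the strand is embedded and alone in the square. It therefore carries no passage, and no
  passage separates the ends of the new chord.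
\<close>

lemma diagram_polys_move_I:
  assumes D: "parameter_domain T D" "parameter_domain T D'" and move: "move_I T D D'"
  shows "diagram_polys D' i j = diagram_polys D i j"
proof -
  obtain a b p q where ab: "{a..b} \<subseteq> T"
    and out: "\<And>t. t \<in> T - {a..b} \<Longrightarrow> curve D' t = curve D t \<and> curve D t \<notin> square"
    and sw: "sweeps (\<lambda>t. Re (curve D t)) a b"
    and str: "\<And>t. t \<in> {a..b} \<Longrightarrow> Im (curve D t) = 0 \<and> curve D' t \<in> square"
    and dp: "double_points {a..b} (curve D') = {(p, q), (q, p)}"
    and X': "real_crossings D' \<in> {real_crossings D \<union> {(p, q)}, real_crossings D \<union> {(q, p)}, real_crossings D}"
    using move unfolding move_I_def by blast
  let ?X = "real_crossings D"
  have "(p, q) \<in> double_points {a..b} (curve D')" using dp by simp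
  then have pq: "p \<in> {a..b}" "q \<in> {a..b}" by (auto simp: double_points_def)
  have F: "Field ?X \<inter> {a..b} = {}"
  proof (rule strands_without_crossings[OF parameter_domainD(1)[OF D(1)]])
    show "inj_on (curve D) {a..b}" by (rule inj_onI) (metis sweeps_inj[OF sw])
    show "curve D ` {a..b} \<subseteq> square"
      using str sweeps_bound[OF sw] by (auto simp: square_def)
  qed (use out in blast)
  have kink: "gauss_polys (insert (r, s) ?X) (diagram_sign D') i j = gauss_polys ?X (diagram_sign D') i j"
    if rs: "r \<in> {a..b}" "s \<in> {a..b}" and X': "real_crossings D' = insert (r, s) ?X" for r s
  proof (rule gauss_polys_insert_kink)
    show "gauss_diagram (insert (r, s) ?X) (diagram_sign D')"
      using parameter_domainD(3)[OF D(2)] X' by simp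
    show "(r, s) \<notin> ?X" using F rs(1) by (metis FieldI1 disjoint_iff)
    show "u < r \<longleftrightarrow> u < s" if "u \<in> Field ?X" for u
    proof -
      have "u \<notin> {a..b}" using F that by blast
      then show ?thesis using rs by auto
    qed
  qed
  have old: "gauss_polys ?X (diagram_sign D') i j = gauss_polys ?X (diagram_sign D) i j"
    using diagram_polys_cong_outside[OF D _ _ order_refl F] out by simp
  have "gauss_polys (real_crossings D') (diagram_sign D') i j = gauss_polys ?X (diagram_sign D') i j"
  proof -
    consider "real_crossings D' = insert (p, q) ?X" | "real_crossings D' = insert (q, p) ?X"
      | "real_crossings D' = ?X"
      using X' by (metis Un_insert_right empty_iff insert_iff sup_bot_right)
    then show ?thesis
    proof cases
      case 1
      show ?thesis using kink[OF pq 1] unfolding 1 .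
    next
      case 2
      show ?thesis using kink[OF pq(2,1) 2] unfolding 2 .
    qed simp
  qed
  then show ?thesis
    unfolding diagram_polys_def using old by simp
qed

subsection \<open>The second move\<close>

text \<open>With any other signs, a third zero would be forced by the intermediate value theorem.\<close>

lemma two_transverse_zeros:
  fixes y y' :: "real \<Rightarrow> real"
  assumes der: "\<And>t. (y has_real_derivative y' t) (at t)"
    and ends: "0 < y a" "0 < y b" and zeros: "{t \<in> {a..b}. y t = 0} = {q\<^sub>1, q\<^sub>2}" "q\<^sub>1 < q\<^sub>2"
    and transverse: "y' q\<^sub>1 \<noteq> 0" "y' q\<^sub>2 \<noteq> 0"
  shows "y' q\<^sub>1 < 0" "0 < y' q\<^sub>2"
proof -
  have cont: "continuous_on S y" for S
    using der by (meson DERIV_isCont continuous_at_imp_continuous_on)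
  have q: "q\<^sub>1 \<in> {a..b}" "y q\<^sub>1 = 0" "q\<^sub>2 \<in> {a..b}" "y q\<^sub>2 = 0" using zeros(1) by blast+
  then have q': "a < q\<^sub>1" "q\<^sub>2 < b" using ends by (auto simp: less_le)
  show "y' q\<^sub>1 < 0"
  proof (rule ccontr)
    assume "\<not> y' q\<^sub>1 < 0"
    then obtain d where d: "d > 0" "\<And>h. 0 < h \<Longrightarrow> h < d \<Longrightarrow> y (q\<^sub>1 - h) < y q\<^sub>1"
      using DERIV_pos_inc_left[OF der, of q\<^sub>1] transverse(1) by (metis not_less_iff_gr_or_eq)
    define h where "h = min (d / 2) (q\<^sub>1 - a)"
    have h: "0 < h" "h < d" "h \<le> q\<^sub>1 - a" using d(1) q'(1) by (auto simp: h_def)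
    then have "y (q\<^sub>1 - h) < 0" using d(2)[of h] q(2) by simp
    then obtain s where "a \<le> s" "s \<le> q\<^sub>1 - h" "y s = 0"
      using IVT2'[of y "q\<^sub>1 - h" 0 a] ends(1) h(3) cont by fastforce
    then have "s \<in> {q\<^sub>1, q\<^sub>2}" unfolding zeros(1)[symmetric] using h q by auto
    then show False using \<open>s \<le> q\<^sub>1 - h\<close> h(1) zeros(2) by auto
  qed
  show "0 < y' q\<^sub>2"
  proof (rule ccontr)
    assume "\<not> 0 < y' q\<^sub>2"
    then obtain d where d: "d > 0" "\<And>h. 0 < h \<Longrightarrow> h < d \<Longrightarrow> y (q\<^sub>2 + h) < y q\<^sub>2"
      using DERIV_neg_dec_right[OF der, of q\<^sub>2] transverse(2) by (metis not_less_iff_gr_or_eq)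
    define h where "h = min (d / 2) (b - q\<^sub>2)"
    have h: "0 < h" "h < d" "h \<le> b - q\<^sub>2" using d(1) q'(2) by (auto simp: h_def)
    then have "y (q\<^sub>2 + h) < 0" using d(2)[of h] q(4) by simp
    then obtain s where "q\<^sub>2 + h \<le> s" "s \<le> b" "y s = 0"
      using IVT'[of y "q\<^sub>2 + h" 0 b] ends(2) h(3) cont by fastforce
    then have "s \<in> {q\<^sub>1, q\<^sub>2}" unfolding zeros(1)[symmetric] using h q by auto
    then show False using \<open>q\<^sub>2 + h \<le> s\<close> h(1) zeros(2) by auto
  qed
qed

lemma disjoint_intervals_ordered:
  fixes a b c d :: real
  assumes "{a..b} \<inter> {c..d} = {}" "a \<le> b" "c \<le> d"
  shows "b < c \<or> d < a"
proof (rule ccontr)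
  assume "\<not> (b < c \<or> d < a)"
  then have "max a c \<in> {a..b} \<inter> {c..d}" using assms(2,3) by auto
  then show False using assms(1) by blast
qed

text \<open>
  Strand 0 is the horizontal axis, and the new crossings are the zeros of the height of strand 1, which comes
  from above and returns there. Hence the two signs are opposite.
\<close>

lemma diagram_polys_move_II:
  assumes D: "parameter_domain T D" "parameter_domain T D'" and move: "move_II T D D'"
  shows "diagram_polys D' i j = diagram_polys D i j"
proof -
  obtain a b :: "nat \<Rightarrow> real" and \<rho> where \<rho>: "\<rho> \<in> {{(0, 1)}, {(1, 0)}, {}}"
    and J: "{a 0..b 0} \<subseteq> T" "{a 1..b 1} \<subseteq> T" "{a 0..b 0} \<inter> {a 1..b 1} = {}"
    and same: "\<forall>t\<in>T - {a 1..b 1}. curve D' t = curve D t"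
    and out: "\<forall>t\<in>T - {a 0..b 0} - {a 1..b 1}. curve D t \<notin> square"
    and sw0: "sweeps (\<lambda>t. Re (curve D t)) (a 0) (b 0)" and im0: "\<forall>t\<in>{a 0..b 0}. Im (curve D t) = 0"
    and sw1: "sweeps (\<lambda>t. Re (curve D t)) (a 1) (b 1)"
    and str1: "\<forall>t\<in>{a 1..b 1}. Re (curve D' t) = Re (curve D t) \<and> 0 < Im (curve D t) \<and> Im (curve D t) < 1
      \<and> \<bar>Im (curve D' t)\<bar> < 1"
    and card2: "card {t \<in> {a 1..b 1}. Im (curve D' t) = 0} = 2"
    and X': "real_crossings D' = real_crossings D \<union> strand_crossings (curve D') (\<lambda>i. {a i..b i}) \<rho>"
    using move unfolding move_II_def Let_def by (elim exE bexE conjE) (rule that; assumption)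
  note same = same[rule_format] and out = out[rule_format] and im0 = im0[rule_format] and str1 = str1[rule_format]
  let ?X = "real_crossings D" and ?c = "curve D" and ?c' = "curve D'"
  let ?J0 = "{a 0..b 0}" and ?J1 = "{a 1..b 1}"
  note C1 = parameter_domainD(2)[OF D(1)] parameter_domainD(2)[OF D(2)]
  have ab: "a 0 < b 0" "a 1 < b 1" using sw0 sw1 by (auto simp: sweeps_def)
  have F: "Field ?X \<inter> (?J0 \<union> ?J1) = {}"
  proof (rule strands_without_crossings[OF parameter_domainD(1)[OF D(1)]])
    show "inj_on ?c (?J0 \<union> ?J1)"
    proof (rule inj_onI)
      fix s t assume st: "s \<in> ?J0 \<union> ?J1" "t \<in> ?J0 \<union> ?J1" "?c s = ?c t"
      then have "s \<in> ?J0 \<and> t \<in> ?J0 \<or> s \<in> ?J1 \<and> t \<in> ?J1"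
        using im0 str1 by (metis Un_iff less_irrefl)
      then show "s = t" using sweeps_inj[OF sw0, of s t] sweeps_inj[OF sw1, of s t] st(3) by auto
    qed
    show "?c ` (?J0 \<union> ?J1) \<subseteq> square"
      using im0 str1 sweeps_bound[OF sw0] sweeps_bound[OF sw1] by (fastforce simp: square_def abs_le_iff)
  qed (use out in blast)
  have old: "gauss_polys ?X (diagram_sign D') i j = gauss_polys ?X (diagram_sign D) i j"
    using F same by (intro diagram_polys_cong_outside[OF D _ _ order_refl, of ?J1]) auto
  obtain q\<^sub>1 q\<^sub>2 where zeros: "{t \<in> ?J1. Im (?c' t) = 0} = {q\<^sub>1, q\<^sub>2}" and q: "q\<^sub>1 < q\<^sub>2"
  proof -
    obtain x y where xy: "{t \<in> ?J1. Im (?c' t) = 0} = {x, y}" "x \<noteq> y"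
      using card2 by (metis card_2_iff)
    show thesis
    proof (cases "x < y")
      case False
      then show thesis using xy that[of y x] by (simp add: insert_commute)
    qed (use xy that in blast)
  qed
  have qJ: "q\<^sub>1 \<in> ?J1" "q\<^sub>2 \<in> ?J1" "Im (?c' q\<^sub>1) = 0" "Im (?c' q\<^sub>2) = 0" using zeros by blast+
  have partner: "\<exists>p\<in>?J0. ?c' p = ?c' r" if r: "r \<in> ?J1" "Im (?c' r) = 0" for r
  proof -
    have "\<bar>Re (?c' r)\<bar> \<le> 1" using sweeps_bound[OF sw1 r(1)] str1[OF r(1)] by simp
    then obtain p where p: "p \<in> ?J0" "Re (?c p) = Re (?c' r)" by (rule sweeps_onto[OF sw0])
    moreover have "?c' p = ?c p" using p(1) J by (intro same) auto
    ultimately show ?thesis using im0[OF p(1)] r(2) by (auto intro!: bexI[of _ p] complex_eqI)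
  qed
  obtain p\<^sub>1 p\<^sub>2 where p: "p\<^sub>1 \<in> ?J0" "?c' p\<^sub>1 = ?c' q\<^sub>1" "p\<^sub>2 \<in> ?J0" "?c' p\<^sub>2 = ?c' q\<^sub>2"
    using partner[OF qJ(1,3)] partner[OF qJ(2,4)] by blast
  have c0: "?c' t = ?c t" if "t \<in> ?J0" for t using that J by (intro same) auto
  have uniq: "s = p\<^sub>1 \<and> t = q\<^sub>1 \<or> s = p\<^sub>2 \<and> t = q\<^sub>2" if st: "s \<in> ?J0" "t \<in> ?J1" "?c' s = ?c' t" for s t
  proof -
    have "Im (?c' t) = 0" using st im0[OF st(1)] c0[OF st(1)] by metis
    then have "t \<in> {q\<^sub>1, q\<^sub>2}" unfolding zeros[symmetric] using st(2) by blast
    moreover have "s = p" if "p \<in> ?J0" "?c' p = ?c' t" for p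
      using sweeps_inj[OF sw0 st(1) that(1)] st(3) that c0[OF st(1)] c0[OF that(1)] by metis
    ultimately show ?thesis using p by blast
  qed
  have sc: "strand_crossings ?c' (\<lambda>i. {a i..b i}) {(0, 1)} = {(p\<^sub>1, q\<^sub>1), (p\<^sub>2, q\<^sub>2)}"
    "strand_crossings ?c' (\<lambda>i. {a i..b i}) {(1, 0)} = {(q\<^sub>1, p\<^sub>1), (q\<^sub>2, p\<^sub>2)}"
    using p qJ uniq unfolding strand_crossings_def by (auto; metis)+
  have ends: "?c' (a 1) = ?c (a 1)" "?c' (b 1) = ?c (b 1)"
    using strand_ends_fixed[OF D ab(2) J(2) same] by blast+
  obtain \<sigma> m where \<sigma>: "\<sigma> = 1 \<or> \<sigma> = -1" "0 < m"
    and vel0: "\<And>r d. r \<in> ?J0 \<Longrightarrow> d C1_differentiable_on UNIV \<Longrightarrow> (\<And>t. t \<in> ?J0 \<Longrightarrow> Re (d t) = Re (?c t)) \<Longrightarrow>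
       Re (velocity d r) = \<sigma> * m"
    using sweeps_velocity[OF sw0 C1(1) bounded_linear_Re] by metis
  have v0: "Re (velocity ?c' r) = \<sigma> * m" "Im (velocity ?c' r) = 0" if "r \<in> ?J0" for r
  proof -
    show "Re (velocity ?c' r) = \<sigma> * m" using vel0[OF that C1(2)] c0 by simp
    show "Im (velocity ?c' r) = 0"
      by (rule velocity_affine[OF C1(2) bounded_linear_Im ab(1) that, of 0 0]) (simp add: c0 im0)
  qed
  have det: "det2 (velocity ?c' p) (velocity ?c' r) = \<sigma> * m * Im (velocity ?c' r)"
    "det2 (velocity ?c' r) (velocity ?c' p) = - (\<sigma> * m * Im (velocity ?c' r))" if "p \<in> ?J0" for p r
    using v0[OF that] by (simp_all add: det2_def)
  have nz: "Im (velocity ?c' r) \<noteq> 0" if "p \<in> ?J0" "r \<in> ?J1" "?c' p = ?c' r" for p r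
  proof -
    have "p \<noteq> r" "p \<in> T" "r \<in> T" using that J by auto
    then show ?thesis
      using virtual_diagram_onD(4)[OF parameter_domainD(1)[OF D(2)], of p r] that(3) det(1)[OF that(1), of r] by auto
  qed
  have y: "Im (velocity ?c' q\<^sub>1) < 0" "0 < Im (velocity ?c' q\<^sub>2)"
  proof -
    have der: "((\<lambda>t. Im (?c' t)) has_real_derivative Im (velocity ?c' t)) (at t)" for t
      unfolding has_real_derivative_iff_has_vector_derivative
      using bounded_linear.has_vector_derivative[OF bounded_linear_Im velocity_works[OF C1(2)]] .
    have "0 < Im (?c' (a 1))" "0 < Im (?c' (b 1))"
      using ends str1[of "a 1"] str1[of "b 1"] ab(2) by auto
    from two_transverse_zeros[OF der this zeros q nz[OF p(1) qJ(1) p(2)] nz[OF p(3) qJ(2) p(4)]]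
    show "Im (velocity ?c' q\<^sub>1) < 0" "0 < Im (velocity ?c' q\<^sub>2)" by blast+
  qed
  have sign: "diagram_sign D' (p\<^sub>2, q\<^sub>2) = - diagram_sign D' (p\<^sub>1, q\<^sub>1)"
    "diagram_sign D' (q\<^sub>2, p\<^sub>2) = - diagram_sign D' (q\<^sub>1, p\<^sub>1)"
    using \<sigma> y by (auto simp: diagram_sign_def det[OF p(1)] det[OF p(3)] zero_less_mult_iff mult_less_0_iff)
  have adj: "(r < p\<^sub>1 \<longleftrightarrow> r < p\<^sub>2) \<and> (r < q\<^sub>1 \<longleftrightarrow> r < q\<^sub>2)" if "r \<in> Field ?X" for r
  proof -
    have "r \<notin> ?J0" "r \<notin> ?J1" using F that by blast+
    then show ?thesis using p(1,3) qJ(1,2) by auto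
  qed
  have sep: "max p\<^sub>1 p\<^sub>2 < min q\<^sub>1 q\<^sub>2 \<or> max q\<^sub>1 q\<^sub>2 < min p\<^sub>1 p\<^sub>2"
    using disjoint_intervals_ordered[OF J(3)] ab p(1,3) qJ(1,2) by auto
  have notX: "(p\<^sub>1, q\<^sub>1) \<notin> ?X" "(p\<^sub>2, q\<^sub>2) \<notin> ?X" "(q\<^sub>1, p\<^sub>1) \<notin> ?X" "(q\<^sub>2, p\<^sub>2) \<notin> ?X"
    using F p(1,3) by (metis FieldI1 FieldI2 Un_iff disjoint_iff)+
  have "gauss_polys (real_crossings D') (diagram_sign D') i j = gauss_polys ?X (diagram_sign D') i j"
  proof -
    consider "\<rho> = {(0, 1)}" | "\<rho> = {(1, 0)}" | "\<rho> = {}" using \<rho> by blast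
    then show ?thesis
    proof cases
      case 1
      then have X1: "real_crossings D' = insert (p\<^sub>1, q\<^sub>1) (insert (p\<^sub>2, q\<^sub>2) ?X)" using X' sc(1) by auto
      show ?thesis
        unfolding X1 using notX q adj sep sign(1) parameter_domainD(3)[OF D(2)] unfolding X1
        by (intro gauss_polys_insert_bigon) auto
    next
      case 2
      then have X1: "real_crossings D' = insert (q\<^sub>1, p\<^sub>1) (insert (q\<^sub>2, p\<^sub>2) ?X)" using X' sc(2) by auto
      show ?thesis
        unfolding X1 using notX q adj sep sign(2) parameter_domainD(3)[OF D(2)] unfolding X1
        by (intro gauss_polys_insert_bigon) auto
    next
      case 3
      then show ?thesis using X' by (simp add: strand_crossings_def)
    qed
  qed
  then show ?thesis
    unfolding diagram_polys_def using old by simp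
qed

subsection \<open>The third move\<close>

lemma antimono_derivative_nonpos:
  fixes f :: "real \<Rightarrow> real"
  assumes der: "(f has_real_derivative l) (at r)" and r: "a < b" "r \<in> {a..b}"
    and mono: "\<And>s t. s \<in> {a..b} \<Longrightarrow> t \<in> {a..b} \<Longrightarrow> s < t \<Longrightarrow> f t \<le> f s"
  shows "l \<le> 0"
proof (rule ccontr)
  assume "\<not> l \<le> 0"
  then have l: "0 < l" by simp
  show False
  proof (cases "r < b")
    case True
    obtain d where d: "d > 0" "\<And>h. 0 < h \<Longrightarrow> h < d \<Longrightarrow> f r < f (r + h)"
      using DERIV_pos_inc_right[OF der l] by blast
    define h where "h = min (d / 2) (b - r)"
    have h: "0 < h" "h < d" "r + h \<in> {a..b}" using d(1) True r(2) by (auto simp: h_def)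
    then show False using d(2)[of h] mono[OF r(2) h(3)] by simp
  next
    case False
    then have "a < r" using r by simp
    obtain d where d: "d > 0" "\<And>h. 0 < h \<Longrightarrow> h < d \<Longrightarrow> f (r - h) < f r"
      using DERIV_pos_inc_left[OF der l] by blast
    define h where "h = min (d / 2) (r - a)"
    have h: "0 < h" "h < d" "r - h \<in> {a..b}" using d(1) \<open>a < r\<close> r(2) by (auto simp: h_def)
    then show False using d(2)[of h] mono[OF h(3) r(2)] by simp
  qed
qed

lemma step_from_slope:
  fixes p q m x :: real and s \<kappa> :: int
  assumes "s = 1 \<or> s = -1" "\<kappa> = 1 \<or> \<kappa> = -1" "0 < m" "x = of_int s * m * (q - p)" "0 < of_int \<kappa> * x"
  shows "step p q = \<kappa> * s"
  using assms by (auto simp: step_def zero_less_mult_iff mult_less_0_iff)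

lemma sweeps_cong:
  assumes "sweeps f a b" "\<And>t. t \<in> {a..b} \<Longrightarrow> g t = f t"
  shows "sweeps g a b"
  using assms unfolding sweeps_def by auto

text \<open>The sign of the crossing in which strand i runs over strand j, when the strands run in the directions s.\<close>

definition triangle_signs :: "(nat \<Rightarrow> int) \<Rightarrow> nat \<Rightarrow> nat \<Rightarrow> int" where
  "triangle_signs s i j =
     (if (i, j) = (0, 1) then s 0 * s 1 else if (i, j) = (1, 0) then - (s 0 * s 1)
      else if (i, j) = (0, 2) then - (s 0 * s 2) else if (i, j) = (2, 0) then s 0 * s 2
      else if (i, j) = (1, 2) then - (s 1 * s 2) else if (i, j) = (2, 1) then s 1 * s 2 else 0)"

text \<open>
  The strands of a third move, with their directions s. The number \<open>\<kappa>\<close> says on which side of the origin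
  strand 2 passes, and \<open>t i j\<close> is the parameter on strand i of its crossing with strand j.
\<close>

definition triangle_config ::
    "(real \<Rightarrow> complex) \<Rightarrow> (nat \<Rightarrow> real) \<Rightarrow> (nat \<Rightarrow> real) \<Rightarrow> (nat \<Rightarrow> int) \<Rightarrow> int \<Rightarrow> (nat \<Rightarrow> nat \<Rightarrow> real) \<Rightarrow> bool" where
  "triangle_config c a b s \<kappa> t \<longleftrightarrow>
     (\<forall>i<3. \<forall>j<3. i \<noteq> j \<longrightarrow> t i j \<in> {a i..b i}) \<and>
     (\<forall>i<3. \<forall>j<3. i \<noteq> j \<longrightarrow>
        (\<forall>p\<in>{a i..b i}. \<forall>q\<in>{a j..b j}. c p = c q \<longleftrightarrow> p = t i j \<and> q = t j i)) \<and>
     step (t 0 1) (t 0 2) = \<kappa> * s 0 \<and> step (t 1 0) (t 1 2) = \<kappa> * s 1 \<and> step (t 2 1) (t 2 0) = \<kappa> * s 2 \<and>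
     (\<forall>(i, j)\<in>{(0, 1), (0, 2), (1, 2)}.
        0 < det2 (velocity c (t i j)) (velocity c (t j i)) \<longleftrightarrow> triangle_signs s i j = 1)"

text \<open>
  As a decreasing graph, strand 2 meets each axis once, on the sides determined by \<open>\<kappa>\<close>. On every strand, the
  order of the two crossings can be read off from these sides.
\<close>

lemma triangle_config_exists:
  fixes s :: "nat \<Rightarrow> int" and a b m :: "nat \<Rightarrow> real" and \<kappa> :: int
  assumes C1: "c C1_differentiable_on UNIV"
    and sw0: "sweeps (\<lambda>t. Re (c t)) (a 0) (b 0)" and im0: "\<And>t. t \<in> {a 0..b 0} \<Longrightarrow> Im (c t) = 0"
    and sw1: "sweeps (\<lambda>t. Im (c t)) (a 1) (b 1)" and re1: "\<And>t. t \<in> {a 1..b 1} \<Longrightarrow> Re (c t) = 0"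
    and sw2: "sweeps (\<lambda>t. Re (c t)) (a 2) (b 2)" and im2: "\<And>t. t \<in> {a 2..b 2} \<Longrightarrow> \<bar>Im (c t)\<bar> < 1"
    and s: "\<And>i. s i = 1 \<or> s i = -1" and m: "\<And>i. 0 < m i"
    and lin0: "\<And>p q. p \<in> {a 0..b 0} \<Longrightarrow> q \<in> {a 0..b 0} \<Longrightarrow> Re (c q) - Re (c p) = of_int (s 0) * m 0 * (q - p)"
    and lin1: "\<And>p q. p \<in> {a 1..b 1} \<Longrightarrow> q \<in> {a 1..b 1} \<Longrightarrow> Im (c q) - Im (c p) = of_int (s 1) * m 1 * (q - p)"
    and lin2: "\<And>p q. p \<in> {a 2..b 2} \<Longrightarrow> q \<in> {a 2..b 2} \<Longrightarrow> Re (c q) - Re (c p) = of_int (s 2) * m 2 * (q - p)"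
    and vel0: "\<And>r. r \<in> {a 0..b 0} \<Longrightarrow> Re (velocity c r) = of_int (s 0) * m 0"
    and vel1: "\<And>r. r \<in> {a 1..b 1} \<Longrightarrow> Im (velocity c r) = of_int (s 1) * m 1"
    and vel2: "\<And>r. r \<in> {a 2..b 2} \<Longrightarrow> Re (velocity c r) = of_int (s 2) * m 2"
    and dec: "\<And>p q. p \<in> {a 2..b 2} \<Longrightarrow> q \<in> {a 2..b 2} \<Longrightarrow> Re (c p) < Re (c q) \<Longrightarrow> Im (c q) < Im (c p)"
    and \<kappa>: "\<kappa> = 1 \<or> \<kappa> = -1" and mid: "\<And>t. t \<in> {a 2..b 2} \<Longrightarrow> Re (c t) = 0 \<Longrightarrow> 0 < of_int \<kappa> * Im (c t)"
    and ends: "\<And>t. t \<in> {a 2..b 2} \<Longrightarrow> Re (c t) = 1 \<Longrightarrow> Im (c t) < 0" "\<And>t. t \<in> {a 2..b 2} \<Longrightarrow> Re (c t) = -1 \<Longrightarrow> 0 < Im (c t)"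
    and transverse: "\<And>p q. p \<in> {a 0..b 0} \<Longrightarrow> q \<in> {a 2..b 2} \<Longrightarrow> c p = c q \<Longrightarrow> det2 (velocity c p) (velocity c q) \<noteq> 0"
  obtains t where "triangle_config c a b s \<kappa> t"
proof -
  have ab: "a 0 < b 0" "a 1 < b 1" "a 2 < b 2" using sw0 sw1 sw2 by (auto simp: sweeps_def)
  have cont: "continuous_on S (\<lambda>t. Im (c t))" for S
    using C1_differentiable_imp_continuous_on[OF C1] by (intro continuous_intros) (auto intro: continuous_on_subset)
  have inj0: "p = q" if "p \<in> {a 0..b 0}" "q \<in> {a 0..b 0}" "Re (c p) = Re (c q)" for p q
    using sweeps_inj[OF sw0 that(1,2)] that(3) by simp
  have inj1: "p = q" if "p \<in> {a 1..b 1}" "q \<in> {a 1..b 1}" "Im (c p) = Im (c q)" for p q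
    using sweeps_inj[OF sw1 that(1,2)] that(3) by simp
  have inj2: "p = q" if "p \<in> {a 2..b 2}" "q \<in> {a 2..b 2}" "Re (c p) = Re (c q)" for p q
    using sweeps_inj[OF sw2 that(1,2)] that(3) by simp
  have inj2': "p = q" if "p \<in> {a 2..b 2}" "q \<in> {a 2..b 2}" "Im (c p) = Im (c q)" for p q
    using dec[OF that(1,2)] dec[OF that(2,1)] inj2[OF that(1,2)] that(3) by (cases "Re (c p)" "Re (c q)" rule: linorder_cases) simp_all
  obtain t01 where t01: "t01 \<in> {a 0..b 0}" "Re (c t01) = 0" by (rule sweeps_onto[OF sw0, of 0]) auto
  obtain t10 where t10: "t10 \<in> {a 1..b 1}" "Im (c t10) = 0" by (rule sweeps_onto[OF sw1, of 0]) auto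
  obtain t21 where t21: "t21 \<in> {a 2..b 2}" "Re (c t21) = 0" by (rule sweeps_onto[OF sw2, of 0]) auto
  have "\<bar>Im (c t21)\<bar> \<le> 1" using im2[OF t21(1)] by simp
  then obtain t12 where t12: "t12 \<in> {a 1..b 1}" "Im (c t12) = Im (c t21)" by (rule sweeps_onto[OF sw1])
  obtain l r where lr: "l \<in> {a 2..b 2}" "Re (c l) = -1" "r \<in> {a 2..b 2}" "Re (c r) = 1"
    using sweeps_onto[OF sw2, of "-1"] sweeps_onto[OF sw2, of 1] by (metis abs_minus_cancel abs_one order_refl)
  have lr': "Im (c r) < 0" "0 < Im (c l)" using ends lr by blast+
  obtain t20 where t20: "t20 \<in> {a 2..b 2}" "Im (c t20) = 0"
  proof (cases "l \<le> r")
    case True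
    then obtain u where "l \<le> u" "u \<le> r" "Im (c u) = 0"
      using IVT2'[of "\<lambda>t. Im (c t)" r 0 l] lr' cont by fastforce
    then show thesis using lr by (intro that[of u]) simp_all
  next
    case False
    then obtain u where "r \<le> u" "u \<le> l" "Im (c u) = 0"
      using IVT'[of "\<lambda>t. Im (c t)" r 0 l] lr' cont by fastforce
    then show thesis using lr by (intro that[of u]) simp_all
  qed
  have "\<bar>Re (c t20)\<bar> \<le> 1" using sweeps_bound[OF sw2 t20(1)] .
  then obtain t02 where t02: "t02 \<in> {a 0..b 0}" "Re (c t02) = Re (c t20)" by (rule sweeps_onto[OF sw0])
  have y: "0 < of_int \<kappa> * Im (c t21)" using mid[OF t21] .
  have x: "0 < of_int \<kappa> * Re (c t20)"
  proof (cases "Re (c t20)" "0::real" rule: linorder_cases)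
    case less
    then show ?thesis using dec[OF t20(1) t21(1)] t21(2) t20(2) y \<kappa> by auto
  next
    case equal
    then have "t20 = t21" using inj2[OF t20(1) t21(1)] t21(2) by simp
    then show ?thesis using y t20(2) by simp
  next
    case greater
    then show ?thesis using dec[OF t21(1) t20(1)] t21(2) t20(2) y \<kappa> by auto
  qed
  define t :: "nat \<Rightarrow> nat \<Rightarrow> real" where "t = (\<lambda>i j. if i = 0 then if j = 1 then t01 else t02
      else if i = 1 then if j = 0 then t10 else t12 else if j = 0 then t20 else t21)"
  have t: "t 0 1 = t01" "t 0 2 = t02" "t 1 0 = t10" "t 1 2 = t12" "t 2 0 = t20" "t 2 1 = t21"
    by (simp_all add: t_def)
  have m01: "c p = c q \<longleftrightarrow> p = t01 \<and> q = t10" if "p \<in> {a 0..b 0}" "q \<in> {a 1..b 1}" for p q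
    using inj0[OF that(1) t01(1)] inj1[OF that(2) t10(1)] im0[OF that(1)] re1[OF that(2)] t01(2) t10(2)
      im0[OF t01(1)] re1[OF t10(1)] by (metis complex_eqI)
  have m02: "c p = c q \<longleftrightarrow> p = t02 \<and> q = t20" if "p \<in> {a 0..b 0}" "q \<in> {a 2..b 2}" for p q
    using inj0[OF that(1) t02(1)] inj2'[OF that(2) t20(1)] im0[OF that(1)] t02(2) t20(2)
      im0[OF t02(1)] by (metis complex_eqI)
  have m12: "c p = c q \<longleftrightarrow> p = t12 \<and> q = t21" if "p \<in> {a 1..b 1}" "q \<in> {a 2..b 2}" for p q
    using inj1[OF that(1) t12(1)] inj2[OF that(2) t21(1)] re1[OF that(1)] t12(2) t21(2)
      re1[OF t12(1)] by (metis complex_eqI)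
  have three: "i \<in> {0, 1, 2}" if "i < 3" for i :: nat using that by auto
  have "triangle_config c a b s \<kappa> t"
    unfolding triangle_config_def
  proof (intro conjI allI impI ballI)
    fix i j :: nat assume ij: "i < 3" "j < 3" "i \<noteq> j"
    show "t i j \<in> {a i..b i}"
      using three[OF ij(1)] t01(1) t02(1) t10(1) t12(1) t20(1) t21(1) by (elim insertE emptyE) (simp_all add: t_def)
    fix p q assume pq: "p \<in> {a i..b i}" "q \<in> {a j..b j}"
    have "(i, j) \<in> {(0, 1), (1, 0), (0, 2), (2, 0), (1, 2), (2, 1)}"
      using three[OF ij(1)] three[OF ij(2)] ij(3) by auto
    then show "c p = c q \<longleftrightarrow> p = t i j \<and> q = t j i"
      using pq m01[of p q] m01[of q p] m02[of p q] m02[of q p] m12[of p q] m12[of q p]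
      by (elim insertE emptyE; clarify; simp only: t simp_thms; metis)
  next
    show "step (t 0 1) (t 0 2) = \<kappa> * s 0"
      unfolding t by (rule step_from_slope[OF s \<kappa> m lin0[OF t01(1) t02(1), unfolded t01(2) t02(2) diff_0_right] x])
    show "step (t 1 0) (t 1 2) = \<kappa> * s 1"
      unfolding t by (rule step_from_slope[OF s \<kappa> m lin1[OF t10(1) t12(1), unfolded t10(2) t12(2) diff_0_right] y])
    show "step (t 2 1) (t 2 0) = \<kappa> * s 2"
      unfolding t by (rule step_from_slope[OF s \<kappa> m lin2[OF t21(1) t20(1), unfolded t21(2) diff_0_right] x])
  next
    have v0: "Im (velocity c r) = 0" if "r \<in> {a 0..b 0}" for r
      by (rule velocity_affine[OF C1 bounded_linear_Im ab(1) that, of 0 0]) (simp add: im0)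
    have v1: "Re (velocity c r) = 0" if "r \<in> {a 1..b 1}" for r
      by (rule velocity_affine[OF C1 bounded_linear_Re ab(2) that, of 0 0]) (simp add: re1)
    have sgn_prod: "0 < of_int (s i) * m i * (of_int (s j) * m j) \<longleftrightarrow> s i * s j = 1"
      "0 < - (of_int (s i) * m i * (of_int (s j) * m j)) \<longleftrightarrow> - (s i * s j) = 1" for i j
      using s[of i] s[of j] m[of i] m[of j] by (auto simp: zero_less_mult_iff mult_less_0_iff)
    have d01: "0 < det2 (velocity c t01) (velocity c t10) \<longleftrightarrow> s 0 * s 1 = 1"
      unfolding det2_def vel0[OF t01(1)] v0[OF t01(1)] vel1[OF t10(1)] v1[OF t10(1)]
      using sgn_prod(1)[of 0 1] by simp
    have d12: "0 < det2 (velocity c t12) (velocity c t21) \<longleftrightarrow> - (s 1 * s 2) = 1"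
      unfolding det2_def vel1[OF t12(1)] v1[OF t12(1)] vel2[OF t21(1)]
      using sgn_prod(2)[of 1 2] by simp
    have d02: "0 < det2 (velocity c t02) (velocity c t20) \<longleftrightarrow> - (s 0 * s 2) = 1"
    proof -
      define w where "w = Im (velocity c t20)"
      have det: "det2 (velocity c t02) (velocity c t20) = of_int (s 0) * m 0 * w"
        unfolding det2_def vel0[OF t02(1)] v0[OF t02(1)] w_def by simp
      have "c t02 = c t20" using m02[OF t02(1) t20(1)] by simp
      then have "w \<noteq> 0" using transverse[OF t02(1) t20(1)] det by auto
      have der: "((\<lambda>t. of_int (s 2) * Im (c t)) has_real_derivative of_int (s 2) * w) (at t20)"
      proof -
        have "((\<lambda>t. Im (c t)) has_real_derivative w) (at t20)"
          unfolding has_real_derivative_iff_has_vector_derivative w_def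
          using bounded_linear.has_vector_derivative[OF bounded_linear_Im velocity_works[OF C1]] .
        then show ?thesis by (rule DERIV_cmult)
      qed
      have "of_int (s 2) * w \<le> 0"
      proof (rule antimono_derivative_nonpos[OF der ab(3) t20(1)])
        fix p q assume pq: "p \<in> {a 2..b 2}" "q \<in> {a 2..b 2}" "p < q"
        have "0 < m 2 * (q - p)" using m[of 2] pq(3) by simp
        then show "of_int (s 2) * Im (c q) \<le> of_int (s 2) * Im (c p)"
          using s[of 2] lin2[OF pq(1,2)] dec[OF pq(1,2)] dec[OF pq(2,1)] by auto
      qed
      then show ?thesis
        unfolding det using \<open>w \<noteq> 0\<close> s[of 0] s[of 2] m[of 0] by (auto simp: zero_less_mult_iff mult_less_0_iff)
    qed
    fix x :: "nat \<times> nat" assume "x \<in> {(0, 1), (0, 2), (1, 2)}"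
    then show "case x of (i, j) \<Rightarrow> 0 < det2 (velocity c (t i j)) (velocity c (t j i)) \<longleftrightarrow> triangle_signs s i j = 1"
      using d01 d02 d12 by (elim insertE emptyE) (simp_all add: t[simplified] triangle_signs_def)
  qed
  then show thesis by (rule that)
qed

lemma triangle_config_crossings:
  assumes cfg: "triangle_config c a b s \<kappa> t"
    and \<rho>: "\<rho> \<subseteq> {0, 1, 2} \<times> {0, 1, 2}" "\<And>i j. i \<in> {0, 1, 2} \<Longrightarrow> j \<in> {0, 1, 2} \<Longrightarrow> i \<noteq> j \<Longrightarrow> (i, j) \<in> \<rho> \<longleftrightarrow> (j, i) \<notin> \<rho>"
      "\<And>i. (i, i) \<notin> \<rho>"
  defines "x \<equiv> strand_crossing (\<lambda>i j. (i, j) \<in> \<rho>) t"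
  shows "strand_crossings c (\<lambda>i. {a i..b i}) \<rho> = {x 0 1, x 0 2, x 1 2}"
proof -
  have t: "t i j \<in> {a i..b i}" if "i < 3" "j < 3" "i \<noteq> j" for i j
    using cfg that unfolding triangle_config_def by blast
  have meet: "c p = c q \<longleftrightarrow> p = t i j \<and> q = t j i"
    if "i < 3" "j < 3" "i \<noteq> j" "p \<in> {a i..b i}" "q \<in> {a j..b j}" for i j p q
    using cfg that unfolding triangle_config_def by blast
  have bound: "i < 3 \<and> j < 3 \<and> i \<noteq> j" if "(i, j) \<in> \<rho>" for i j
  proof -
    have "i \<in> {0, 1, 2}" "j \<in> {0, 1, 2}" "i \<noteq> j" using \<rho>(1,3) that by auto
    then show ?thesis by auto
  qed
  have "strand_crossings c (\<lambda>i. {a i..b i}) \<rho> = (\<lambda>(i, j). (t i j, t j i)) ` \<rho>"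
  proof (intro set_eqI iffI)
    fix z assume "z \<in> strand_crossings c (\<lambda>i. {a i..b i}) \<rho>"
    then obtain p q i j where z: "z = (p, q)" "c p = c q" "(i, j) \<in> \<rho>" "p \<in> {a i..b i}" "q \<in> {a j..b j}"
      unfolding strand_crossings_def by blast
    then have "z = (t i j, t j i)" using meet[of i j p q] bound[OF z(3)] by simp
    then show "z \<in> (\<lambda>(i, j). (t i j, t j i)) ` \<rho>" using z(3) by (auto intro!: image_eqI[of _ _ "(i, j)"])
  next
    fix z assume "z \<in> (\<lambda>(i, j). (t i j, t j i)) ` \<rho>"
    then obtain i j where z: "z = (t i j, t j i)" "(i, j) \<in> \<rho>" by auto
    have "t i j \<in> {a i..b i}" "t j i \<in> {a j..b j}" using t bound[OF z(2)] by auto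
    moreover from this have "c (t i j) = c (t j i)" using meet[of i j] bound[OF z(2)] by blast
    ultimately show "z \<in> strand_crossings c (\<lambda>i. {a i..b i}) \<rho>"
      unfolding strand_crossings_def using z by blast
  qed
  also have "\<dots> = {x 0 1, x 0 2, x 1 2}"
  proof -
    have x: "x i j = (if (i, j) \<in> \<rho> then (t i j, t j i) else (t j i, t i j))" for i j
      by (simp add: x_def strand_crossing_def)
    have x': "x i j = (\<lambda>(i, j). (t i j, t j i)) (if (i, j) \<in> \<rho> then (i, j) else (j, i))" for i j
      by (simp add: x)
    have "\<rho> = {if (0, 1) \<in> \<rho> then (0, 1) else (1, 0), if (0, 2) \<in> \<rho> then (0, 2) else (2, 0),
        if (1, 2) \<in> \<rho> then (1, 2) else (2, 1)}" (is "_ = ?R")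
    proof
      show "\<rho> \<subseteq> ?R"
      proof
        fix z assume z: "z \<in> \<rho>"
        then have "z \<in> {(0, 1), (0, 2), (1, 2), (1, 0), (2, 0), (2, 1)}" using \<rho>(1,3) by auto
        then show "z \<in> ?R" using z \<rho>(2)[of 0 1] \<rho>(2)[of 0 2] \<rho>(2)[of 1 2] by (elim insertE emptyE) simp_all
      qed
      show "?R \<subseteq> \<rho>" using \<rho>(2)[of 0 1] \<rho>(2)[of 0 2] \<rho>(2)[of 1 2] by simp
    qed
    then have "(\<lambda>(i, j). (t i j, t j i)) ` \<rho> = (\<lambda>(i, j). (t i j, t j i)) ` ?R" by (rule arg_cong)
    then show ?thesis by (simp only: image_insert image_empty x')
  qed
  finally show ?thesis .
qed

text \<open>When strand 2 passes to the other side of the origin, the two crossings on each strand exchange their places.\<close>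

lemma triangle_flip_and_balance:
  assumes cfg: "triangle_config c a b s 1 t" "triangle_config c' a b s (-1) t'"
    and s: "\<And>i. s i = 1 \<or> s i = -1" and klm: "strand_triple k l m"
  shows "step (t' k l) (t' k m) = - step (t k l) (t k m)"
    "triangle_signs s m k * step (t k l) (t k m) = triangle_signs s m l * step (t l k) (t l m)"
proof -
  have st: "step (t 0 1) (t 0 2) = s 0" "step (t 1 0) (t 1 2) = s 1" "step (t 2 1) (t 2 0) = s 2"
    using cfg(1) unfolding triangle_config_def by simp_all
  have st': "step (t' 0 1) (t' 0 2) = - s 0" "step (t' 1 0) (t' 1 2) = - s 1" "step (t' 2 1) (t' 2 0) = - s 2"
    using cfg(2) unfolding triangle_config_def by simp_all
  have ts: "step (t 0 2) (t 0 1) = - s 0" "step (t 1 2) (t 1 0) = - s 1" "step (t 2 0) (t 2 1) = - s 2"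
    "step (t' 0 2) (t' 0 1) = s 0" "step (t' 1 2) (t' 1 0) = s 1" "step (t' 2 0) (t' 2 1) = s 2"
    using st st' step_swap[of "t 0 2" "t 0 1"] step_swap[of "t 1 2" "t 1 0"] step_swap[of "t 2 0" "t 2 1"]
      step_swap[of "t' 0 2" "t' 0 1"] step_swap[of "t' 1 2" "t' 1 0"] step_swap[of "t' 2 0" "t' 2 1"] by linarith+
  have three: "i \<in> {0, 1, 2}" if "i < 3" for i :: nat using that by auto
  have "(k, l, m) \<in> {(0, 1, 2), (0, 2, 1), (1, 0, 2), (1, 2, 0), (2, 0, 1), (2, 1, 0)}"
    using klm three[of k] three[of l] three[of m] unfolding strand_triple_def by auto
  then show "step (t' k l) (t' k m) = - step (t k l) (t k m)"
    by (elim insertE emptyE) (simp_all add: st[simplified] st'[simplified] ts[simplified])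
  have sq: "s i * s i = 1" "s i * (s i * x) = x" for i x using s[of i] by auto
  from \<open>(k, l, m) \<in> _\<close>
  show "triangle_signs s m k * step (t k l) (t k m) = triangle_signs s m l * step (t l k) (t l m)"
    by (elim insertE emptyE)
       (simp_all add: st[simplified] ts[simplified] triangle_signs_def sq mult.assoc mult.commute mult.left_commute)
qed

lemma sweeps_slope:
  assumes "sweeps (\<lambda>t. f (c t)) a b" "c C1_differentiable_on UNIV" "bounded_linear f"
  obtains s :: int and m where "s = 1 \<or> s = -1" "0 < m"
    "\<forall>d. d C1_differentiable_on UNIV \<longrightarrow> (\<forall>t\<in>{a..b}. f (d t) = f (c t)) \<longrightarrow>
      (\<forall>p\<in>{a..b}. \<forall>q\<in>{a..b}. f (d q) - f (d p) = of_int s * m * (q - p)) \<and>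
      (\<forall>r\<in>{a..b}. f (velocity d r) = of_int s * m)"
proof (rule sweeps_velocity[OF assms])
  fix \<sigma> m :: real
  assume \<sigma>: "\<sigma> = 1 \<or> \<sigma> = -1" "0 < m" and lin: "\<And>p q. p \<in> {a..b} \<Longrightarrow> q \<in> {a..b} \<Longrightarrow> f (c q) - f (c p) = \<sigma> * m * (q - p)"
    and vel: "\<And>r d. r \<in> {a..b} \<Longrightarrow> d C1_differentiable_on UNIV \<Longrightarrow> (\<And>t. t \<in> {a..b} \<Longrightarrow> f (d t) = f (c t)) \<Longrightarrow>
       f (velocity d r) = \<sigma> * m"
  show thesis
  proof (rule that[of "if \<sigma> = 1 then 1 else -1" m])
    show "\<forall>d. d C1_differentiable_on UNIV \<longrightarrow> (\<forall>t\<in>{a..b}. f (d t) = f (c t)) \<longrightarrow>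
      (\<forall>p\<in>{a..b}. \<forall>q\<in>{a..b}. f (d q) - f (d p) = of_int (if \<sigma> = 1 then 1 else -1) * m * (q - p)) \<and>
      (\<forall>r\<in>{a..b}. f (velocity d r) = of_int (if \<sigma> = 1 then 1 else -1) * m)"
    proof (intro allI impI)
      fix d assume d: "d C1_differentiable_on UNIV" "\<forall>t\<in>{a..b}. f (d t) = f (c t)"
      have e: "real_of_int (if \<sigma> = 1 then 1 else -1) = \<sigma>" using \<sigma>(1) by auto
      show "(\<forall>p\<in>{a..b}. \<forall>q\<in>{a..b}. f (d q) - f (d p) = of_int (if \<sigma> = 1 then 1 else -1) * m * (q - p)) \<and>
        (\<forall>r\<in>{a..b}. f (velocity d r) = of_int (if \<sigma> = 1 then 1 else -1) * m)"
        unfolding e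
      proof (intro conjI ballI)
        show "f (d q) - f (d p) = \<sigma> * m * (q - p)" if "p \<in> {a..b}" "q \<in> {a..b}" for p q
          using lin[OF that] bspec[OF d(2) that(1)] bspec[OF d(2) that(2)] by simp
        show "f (velocity d r) = \<sigma> * m" if "r \<in> {a..b}" for r
          using vel[OF that d(1)] bspec[OF d(2)] by blast
      qed
    qed
  qed (use \<sigma>(1,2) in auto)
qed

lemma sweeps_ends:
  assumes "sweeps f a b" "t \<in> {a..b}" "\<bar>f t\<bar> = 1"
  shows "t = a \<or> t = b"
proof -
  obtain \<sigma> m where \<sigma>: "\<sigma> = 1 \<or> \<sigma> = -1" "0 < m" "m * (b - a) = 2"
      "\<And>t. t \<in> {a..b} \<Longrightarrow> f t = \<sigma> * (m * (t - a) - 1)"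
    using assms(1) by (rule sweepsE) blast
  have "m * (t - a) = 0 \<or> m * (t - a) = m * (b - a)"
    using \<sigma>(1,3) \<sigma>(4)[OF assms(2)] assms(3) by (auto simp: abs_mult abs_if split: if_splits)
  then show ?thesis using \<sigma>(2) by auto
qed

lemma diagram_sign_swap:
  assumes "det2 (velocity (curve D) p) (velocity (curve D) q) \<noteq> 0"
  shows "diagram_sign D (q, p) = - diagram_sign D (p, q)"
  using assms by (auto simp: diagram_sign_def det2_def algebra_simps)

lemma triangle_config_mem:
  assumes "triangle_config c a b s \<kappa> t" "i < 3" "j < 3" "i \<noteq> j"
  shows "t i j \<in> {a i..b i}"
  using assms unfolding triangle_config_def by simp

lemma triangle_config_sign:
  assumes D: "virtual_diagram_on T D" and cfg: "triangle_config (curve D) a b s \<kappa> t"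
    and s: "\<And>i. s i = 1 \<or> s i = -1"
    and J: "\<And>i. i < 3 \<Longrightarrow> {a i..b i} \<subseteq> T" "\<And>i j. i < 3 \<Longrightarrow> j < 3 \<Longrightarrow> i \<noteq> j \<Longrightarrow> {a i..b i} \<inter> {a j..b j} = {}"
    and ij: "(i, j) \<in> {(0, 1), (0, 2), (1, 2)}"
  shows "diagram_sign D (strand_crossing ov t i j) = (if ov i j then triangle_signs s i j else - triangle_signs s i j)"
proof -
  have b: "i < 3" "j < 3" "i \<noteq> j" using ij by auto
  have t: "t i j \<in> {a i..b i}" "t j i \<in> {a j..b j}" using cfg b unfolding triangle_config_def by auto
  moreover have "curve D (t i j) = curve D (t j i)"
    using cfg b t unfolding triangle_config_def by blast
  moreover have "t i j \<noteq> t j i" using t J(2)[OF b] by (metis disjoint_iff)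
  ultimately have nz: "det2 (velocity (curve D) (t i j)) (velocity (curve D) (t j i)) \<noteq> 0"
    using virtual_diagram_onD(4)[OF D] J(1) b by blast
  have "0 < det2 (velocity (curve D) (t i j)) (velocity (curve D) (t j i)) \<longleftrightarrow> triangle_signs s i j = 1"
    using cfg ij unfolding triangle_config_def by blast
  moreover have "triangle_signs s i j = 1 \<or> triangle_signs s i j = -1"
    using ij s[of 0] s[of 1] s[of 2] by (elim insertE emptyE) (auto simp: triangle_signs_def)
  ultimately have "diagram_sign D (t i j, t j i) = triangle_signs s i j"
    by (auto simp: diagram_sign_def)
  then show ?thesis
    using diagram_sign_swap[OF nz] by (simp add: strand_crossing_def)
qed

text \<open>All signs are determined by the directions of the strands and do not change.\<close>

lemma diagram_polys_move_III:
  assumes D: "parameter_domain T D" "parameter_domain T D'" and move: "move_III T D D'"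
  shows "diagram_polys D' i j = diagram_polys D i j"
proof -
  obtain a b :: "nat \<Rightarrow> real" and \<rho> Y where
        UT: "{a 0..b 0} \<union> {a 1..b 1} \<union> {a 2..b 2} \<subseteq> T"
    and J: "{a 0..b 0} \<inter> {a 1..b 1} = {}" "{a 0..b 0} \<inter> {a 2..b 2} = {}" "{a 1..b 1} \<inter> {a 2..b 2} = {}"
    and same: "\<forall>t\<in>T - {a 2..b 2}. curve D' t = curve D t"
    and sw0: "sweeps (\<lambda>t. Re (curve D t)) (a 0) (b 0)" and im0: "\<forall>t\<in>{a 0..b 0}. Im (curve D t) = 0"
    and sw1: "sweeps (\<lambda>t. Im (curve D t)) (a 1) (b 1)" and re1: "\<forall>t\<in>{a 1..b 1}. Re (curve D t) = 0"
    and sw2: "sweeps (\<lambda>t. Re (curve D t)) (a 2) (b 2)"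
    and str2: "\<forall>t\<in>{a 2..b 2}. Re (curve D' t) = Re (curve D t) \<and> \<bar>Im (curve D t)\<bar> < 1 \<and> \<bar>Im (curve D' t)\<bar> < 1"
    and dec: "\<forall>s\<in>{a 2..b 2}. \<forall>t\<in>{a 2..b 2}. Re (curve D s) < Re (curve D t) \<longrightarrow>
        Im (curve D t) < Im (curve D s) \<and> Im (curve D' t) < Im (curve D' s)"
    and mid: "\<forall>t\<in>{a 2..b 2}. Re (curve D t) = 0 \<longrightarrow> Im (curve D' t) < 0 \<and> 0 < Im (curve D t)"
    and \<rho>: "(\<exists>h :: nat \<Rightarrow> nat. inj_on h {0, 1, 2} \<and> \<rho> = {(i, j). i \<in> {0, 1, 2} \<and> j \<in> {0, 1, 2} \<and> h j < h i}) \<or>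
         \<rho> = {} \<or> \<rho> = {(0, 1)} \<or> \<rho> = {(1, 0)}"
    and Yout: "\<forall>(s, t)\<in>Y. s \<notin> {a 0..b 0} \<union> {a 1..b 1} \<union> {a 2..b 2} \<and> t \<notin> {a 0..b 0} \<union> {a 1..b 1} \<union> {a 2..b 2}"
    and X: "real_crossings D = Y \<union> strand_crossings (curve D) (\<lambda>i. {a i..b i}) \<rho>"
    and X': "real_crossings D' = Y \<union> strand_crossings (curve D') (\<lambda>i. {a i..b i}) \<rho>"
    using move unfolding move_III_def Let_def by (elim exE conjE) (rule that; assumption)
  note same = same[rule_format] and im0 = im0[rule_format] and re1 = re1[rule_format]
    and str2 = str2[rule_format] and dec = dec[rule_format] and mid = mid[rule_format]
  let ?c = "curve D" and ?c' = "curve D'"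
  note C1 = parameter_domainD(2)[OF D(1)] parameter_domainD(2)[OF D(2)]
  have ab: "a 2 < b 2" using sw2 by (auto simp: sweeps_def)
  have c0: "?c' t = ?c t" if "t \<in> {a 0..b 0}" for t using that J UT by (intro same) blast
  have c1: "?c' t = ?c t" if "t \<in> {a 1..b 1}" for t using that J UT by (intro same) blast
  have three: "i \<in> {0, 1, 2}" if "i < 3" for i :: nat using that by auto
  have JT: "{a i..b i} \<subseteq> T" if "i < 3" for i
    using three[OF that] UT by (elim insertE emptyE) blast+
  have disj: "{a i..b i} \<inter> {a j..b j} = {}" if "i < 3" "j < 3" "i \<noteq> j" for i j
    using three[OF that(1)] three[OF that(2)] that(3) J by (elim insertE emptyE) (simp_all add: Int_commute)
  have FY: "Field Y \<inter> {a i..b i} = {}" if "i < 3" for i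
  proof (rule ccontr)
    assume "Field Y \<inter> {a i..b i} \<noteq> {}"
    then obtain r where r: "r \<in> Field Y" "r \<in> {a i..b i}" by blast
    obtain x where x: "x \<in> Y" "r = fst x \<or> r = snd x" using r(1) by (rule Field_obtain)
    have "r \<notin> {a 0..b 0} \<union> {a 1..b 1} \<union> {a 2..b 2}" using bspec[OF Yout x(1)] x(2) by (auto simp: case_prod_beta)
    then show False using r(2) three[OF that] by blast
  qed
  have sY: "diagram_sign D' x = diagram_sign D x" if "x \<in> Y" for x
  proof -
    have "x \<in> real_crossings D" using that X by blast
    then have "fst x \<in> T" "snd x \<in> T" using virtual_diagram_onD(3)[OF parameter_domainD(1)[OF D(1)]] by blast+
    moreover have "fst x \<notin> {a 2..b 2}" "snd x \<notin> {a 2..b 2}"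
      using FY[of 2] in_Field_fst_snd[OF that] by auto
    ultimately show ?thesis using same by (intro diagram_sign_outside[OF D, of "{a 2..b 2}"]) auto
  qed
  have "gauss_polys (real_crossings D') (diagram_sign D') i j = gauss_polys (real_crossings D) (diagram_sign D) i j"
  \<comment> \<open>If only the crossing of the strands 0 and 1, which stay fixed, is real, nothing changes.\<close>
  proof (cases "\<rho> \<subseteq> {(0, 1), (1, 0)}")
    case True
    have "strand_crossings ?c' (\<lambda>i. {a i..b i}) \<rho> = strand_crossings ?c (\<lambda>i. {a i..b i}) \<rho>"
    proof -
      have "?c' p = ?c' q \<longleftrightarrow> ?c p = ?c q" if "(k, l) \<in> \<rho>" "p \<in> {a k..b k}" "q \<in> {a l..b l}" for k l p q
      proof -
        have "k = 0 \<and> l = 1 \<or> k = 1 \<and> l = 0" using True that(1) by blast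
        then show ?thesis using that(2,3) c0[of p] c0[of q] c1[of p] c1[of q] by auto
      qed
      then show ?thesis unfolding strand_crossings_def by blast
    qed
    then have eq: "real_crossings D' = real_crossings D" using X X' by simp
    have "Field (real_crossings D) \<inter> {a 2..b 2} = {}"
    proof (rule ccontr)
      assume "Field (real_crossings D) \<inter> {a 2..b 2} \<noteq> {}"
      then obtain r where r: "r \<in> Field (real_crossings D)" "r \<in> {a 2..b 2}" by blast
      obtain x where x: "x \<in> real_crossings D" "r = fst x \<or> r = snd x" using r(1) by (rule Field_obtain)
      show False
      proof (cases "x \<in> Y")
        case True
        then show False using FY[of 2] in_Field_fst_snd[OF True] x(2) r(2) by auto
      next
        case False
        then have "x \<in> strand_crossings ?c (\<lambda>i. {a i..b i}) \<rho>" using x(1) X by blast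
        then obtain k l where kl: "(k, l) \<in> \<rho>" "fst x \<in> {a k..b k}" "snd x \<in> {a l..b l}"
          unfolding strand_crossings_def by auto
        have "k = 0 \<and> l = 1 \<or> k = 1 \<and> l = 0" using True kl(1) by blast
        then have "r \<in> {a 0..b 0} \<or> r \<in> {a 1..b 1}" using kl x(2) by auto
        then show False using r(2) J by blast
      qed
    qed
    then show ?thesis
      unfolding eq using same by (intro diagram_polys_cong_outside[OF D _ _ order_refl, of "{a 2..b 2}"]) auto
  next
    case False
    then obtain h :: "nat \<Rightarrow> nat" where h: "inj_on h {0, 1, 2}"
        "\<rho> = {(i, j). i \<in> {0, 1, 2} \<and> j \<in> {0, 1, 2} \<and> h j < h i}"
      using \<rho> by blast
    have \<rho>1: "\<rho> \<subseteq> {0, 1, 2} \<times> {0, 1, 2}" using h(2) by blast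
    have \<rho>2: "(i, j) \<in> \<rho> \<longleftrightarrow> (j, i) \<notin> \<rho>" if "i \<in> {0, 1, 2}" "j \<in> {0, 1, 2}" "i \<noteq> j" for i j
    proof -
      have "h i \<noteq> h j" using inj_onD[OF h(1) _ that(1,2)] that(3) by blast
      then show ?thesis using that(1,2) unfolding h(2) by auto
    qed
    have \<rho>3: "(i, i) \<notin> \<rho>" for i unfolding h(2) by simp
    obtain s0 m0 where s0: "s0 = 1 \<or> s0 = -1" "0 < m0"
      and S0: "\<forall>d. d C1_differentiable_on UNIV \<longrightarrow> (\<forall>t\<in>{a 0..b 0}. Re (d t) = Re (?c t)) \<longrightarrow>
      (\<forall>p\<in>{a 0..b 0}. \<forall>q\<in>{a 0..b 0}. Re (d q) - Re (d p) = of_int s0 * m0 * (q - p)) \<and>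
      (\<forall>r\<in>{a 0..b 0}. Re (velocity d r) = of_int s0 * m0)"
      by (rule sweeps_slope[OF sw0 C1(1) bounded_linear_Re]) (rule that; assumption)
    obtain s1 m1 where s1: "s1 = 1 \<or> s1 = -1" "0 < m1"
      and S1: "\<forall>d. d C1_differentiable_on UNIV \<longrightarrow> (\<forall>t\<in>{a 1..b 1}. Im (d t) = Im (?c t)) \<longrightarrow>
      (\<forall>p\<in>{a 1..b 1}. \<forall>q\<in>{a 1..b 1}. Im (d q) - Im (d p) = of_int s1 * m1 * (q - p)) \<and>
      (\<forall>r\<in>{a 1..b 1}. Im (velocity d r) = of_int s1 * m1)"
      by (rule sweeps_slope[OF sw1 C1(1) bounded_linear_Im]) (rule that; assumption)
    obtain s2 m2 where s2: "s2 = 1 \<or> s2 = -1" "0 < m2"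
      and S2: "\<forall>d. d C1_differentiable_on UNIV \<longrightarrow> (\<forall>t\<in>{a 2..b 2}. Re (d t) = Re (?c t)) \<longrightarrow>
      (\<forall>p\<in>{a 2..b 2}. \<forall>q\<in>{a 2..b 2}. Re (d q) - Re (d p) = of_int s2 * m2 * (q - p)) \<and>
      (\<forall>r\<in>{a 2..b 2}. Re (velocity d r) = of_int s2 * m2)"
      by (rule sweeps_slope[OF sw2 C1(1) bounded_linear_Re]) (rule that; assumption)
    define s :: "nat \<Rightarrow> int" where "s = (\<lambda>i. if i = 0 then s0 else if i = 1 then s1 else s2)"
    define m :: "nat \<Rightarrow> real" where "m = (\<lambda>i. if i = 0 then m0 else if i = 1 then m1 else m2)"
    have s: "s i = 1 \<or> s i = -1" and m: "0 < m i" for i using s0 s1 s2 by (simp_all add: s_def m_def)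
    have sm: "s 0 = s0" "s 1 = s1" "s 2 = s2" "m 0 = m0" "m 1 = m1" "m 2 = m2" by (simp_all add: s_def m_def)
    have ends: "?c' (a 2) = ?c (a 2)" "?c' (b 2) = ?c (b 2)"
      using strand_ends_fixed[OF D ab JT[of 2] same] by simp_all
    have ends_abs: "t = a 2 \<or> t = b 2" if "t \<in> {a 2..b 2}" "\<bar>Re (?c t)\<bar> = 1" for t
      using sweeps_ends[OF sw2 that] .
    have cfg_exists: "\<exists>t. triangle_config d a b s \<kappa> t"
      if d: "parameter_domain T E" "d = curve E" "\<And>t. t \<in> {a 0..b 0} \<union> {a 1..b 1} \<Longrightarrow> d t = ?c t"
          "\<And>t. t \<in> {a 2..b 2} \<Longrightarrow> Re (d t) = Re (?c t) \<and> \<bar>Im (d t)\<bar> < 1"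
        and dec': "\<And>p q. p \<in> {a 2..b 2} \<Longrightarrow> q \<in> {a 2..b 2} \<Longrightarrow> Re (?c p) < Re (?c q) \<Longrightarrow> Im (d q) < Im (d p)"
        and \<kappa>: "\<kappa> = 1 \<or> \<kappa> = -1" "\<And>t. t \<in> {a 2..b 2} \<Longrightarrow> Re (?c t) = 0 \<Longrightarrow> 0 < of_int \<kappa> * Im (d t)"
        and ends': "\<And>t. t \<in> {a 2..b 2} \<Longrightarrow> Re (?c t) = 1 \<Longrightarrow> Im (d t) < 0" "\<And>t. t \<in> {a 2..b 2} \<Longrightarrow> Re (?c t) = -1 \<Longrightarrow> 0 < Im (d t)"
      for d E and \<kappa> :: int
    proof -
      have C1d: "d C1_differentiable_on UNIV" using parameter_domainD(2)[OF d(1)] d(2) by simp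
      have r0: "Re (d t) = Re (?c t)" if "t \<in> {a 0..b 0}" for t using d(3) that by simp
      have r1: "Im (d t) = Im (?c t)" if "t \<in> {a 1..b 1}" for t using d(3) that by simp
      have r2: "Re (d t) = Re (?c t)" if "t \<in> {a 2..b 2}" for t using d(4) that by simp
      note S0 = mp[OF mp[OF spec[OF S0] C1d] ballI[OF r0]] and S1 = mp[OF mp[OF spec[OF S1] C1d] ballI[OF r1]]
        and S2 = mp[OF mp[OF spec[OF S2] C1d] ballI[OF r2]]
      obtain t where "triangle_config d a b s \<kappa> t"
      proof (rule triangle_config_exists[OF C1d, of a b s m \<kappa>])
        show "sweeps (\<lambda>t. Re (d t)) (a 0) (b 0)" by (rule sweeps_cong[OF sw0 r0])
        show "sweeps (\<lambda>t. Im (d t)) (a 1) (b 1)" by (rule sweeps_cong[OF sw1 r1])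
        show "sweeps (\<lambda>t. Re (d t)) (a 2) (b 2)" by (rule sweeps_cong[OF sw2 r2])
        show "Im (d t) = 0" if "t \<in> {a 0..b 0}" for t using im0[OF that] d(3) that by simp
        show "Re (d t) = 0" if "t \<in> {a 1..b 1}" for t using re1[OF that] d(3) that by simp
        show "\<bar>Im (d t)\<bar> < 1" if "t \<in> {a 2..b 2}" for t using d(4)[OF that] by blast
        show "s i = 1 \<or> s i = -1" "0 < m i" for i by (fact s m)+
        show "Re (d q) - Re (d p) = of_int (s 0) * m 0 * (q - p)" if "p \<in> {a 0..b 0}" "q \<in> {a 0..b 0}" for p q
          using S0 that unfolding sm by blast
        show "Im (d q) - Im (d p) = of_int (s 1) * m 1 * (q - p)" if "p \<in> {a 1..b 1}" "q \<in> {a 1..b 1}" for p q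
          using S1 that unfolding sm by blast
        show "Re (d q) - Re (d p) = of_int (s 2) * m 2 * (q - p)" if "p \<in> {a 2..b 2}" "q \<in> {a 2..b 2}" for p q
          using S2 that unfolding sm by blast
        show "Re (velocity d r) = of_int (s 0) * m 0" if "r \<in> {a 0..b 0}" for r using S0 that unfolding sm by blast
        show "Im (velocity d r) = of_int (s 1) * m 1" if "r \<in> {a 1..b 1}" for r using S1 that unfolding sm by blast
        show "Re (velocity d r) = of_int (s 2) * m 2" if "r \<in> {a 2..b 2}" for r using S2 that unfolding sm by blast
        show "Im (d q) < Im (d p)" if "p \<in> {a 2..b 2}" "q \<in> {a 2..b 2}" "Re (d p) < Re (d q)" for p q
          using dec'[OF that(1,2)] that(3) r2[OF that(1)] r2[OF that(2)] by simp
        show "\<kappa> = 1 \<or> \<kappa> = -1" by (fact \<kappa>(1))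
        show "0 < of_int \<kappa> * Im (d t)" if "t \<in> {a 2..b 2}" "Re (d t) = 0" for t
          using \<kappa>(2)[OF that(1)] that r2 by simp
        show "Im (d t) < 0" if "t \<in> {a 2..b 2}" "Re (d t) = 1" for t
          using ends'(1)[OF that(1)] that r2 by simp
        show "0 < Im (d t)" if "t \<in> {a 2..b 2}" "Re (d t) = -1" for t
          using ends'(2)[OF that(1)] that r2 by simp
        show "det2 (velocity d p) (velocity d q) \<noteq> 0" if "p \<in> {a 0..b 0}" "q \<in> {a 2..b 2}" "d p = d q" for p q
        proof -
          have "p \<noteq> q" "p \<in> T" "q \<in> T" using that(1,2) J(2) UT by blast+
          then show ?thesis
            using virtual_diagram_onD(4)[OF parameter_domainD(1)[OF d(1)], of p q] that(3) unfolding d(2) by blast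
        qed
      qed
      then show ?thesis by blast
    qed
    obtain z where z: "z \<in> {a 2..b 2}" "Re (?c z) = 0" by (rule sweeps_onto[OF sw2, of 0]) auto
    have cc': "?c' t = ?c t" if "t \<in> {a 2..b 2}" "\<bar>Re (?c t)\<bar> = 1" for t
      using ends_abs[OF that] ends by auto
    have right: "Im (?c t) < 0" if "t \<in> {a 2..b 2}" "Re (?c t) = 1" for t
    proof -
      have "Im (?c' t) < Im (?c' z)" using dec[OF z(1) that(1)] z(2) that(2) by simp
      then show ?thesis using mid[OF z] cc'[OF that(1)] that(2) by simp
    qed
    have left: "0 < Im (?c t)" if "t \<in> {a 2..b 2}" "Re (?c t) = -1" for t
      using dec[OF that(1) z(1)] z(2) that(2) mid[OF z] by simp
    have "\<exists>t. triangle_config ?c a b s 1 t"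
      using str2 dec mid left right by (intro cfg_exists[OF D(1) refl]) simp_all
    then obtain t where cfg: "triangle_config ?c a b s 1 t" by blast
    have "\<exists>t. triangle_config ?c' a b s (-1) t"
    proof (rule cfg_exists[OF D(2) refl])
      show "?c' t = ?c t" if "t \<in> {a 0..b 0} \<union> {a 1..b 1}" for t using that c0 c1 by blast
      show "0 < of_int (- 1) * Im (?c' t)" if "t \<in> {a 2..b 2}" "Re (?c t) = 0" for t using mid[OF that] by simp
      show "Im (?c' t) < 0" if "t \<in> {a 2..b 2}" "Re (?c t) = 1" for t
        using right[OF that] cc'[OF that(1)] that(2) by simp
      show "0 < Im (?c' t)" if "t \<in> {a 2..b 2}" "Re (?c t) = -1" for t
        using left[OF that] cc'[OF that(1)] that(2) by simp
    qed (use str2 dec in simp_all)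
    then obtain t' where cfg': "triangle_config ?c' a b s (-1) t'" by blast
    define ov where "ov = (\<lambda>i j. (i, j) \<in> \<rho>)"
    have Xt: "real_crossings D = Y \<union> {strand_crossing ov t 0 1, strand_crossing ov t 0 2, strand_crossing ov t 1 2}"
      unfolding X ov_def using triangle_config_crossings[OF cfg \<rho>1 \<rho>2 \<rho>3] by simp
    have Xt': "real_crossings D' = Y \<union> {strand_crossing ov t' 0 1, strand_crossing ov t' 0 2, strand_crossing ov t' 1 2}"
      unfolding X' ov_def using triangle_config_crossings[OF cfg' \<rho>1 \<rho>2 \<rho>3] by simp
    show ?thesis
      unfolding Xt Xt'
    proof (rule gauss_polys_triangle_move[of Y ov t "diagram_sign D" t' "diagram_sign D'" a b "triangle_signs s"])
      show "gauss_diagram (Y \<union> {strand_crossing ov t 0 1, strand_crossing ov t 0 2, strand_crossing ov t 1 2}) (diagram_sign D)"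
        using parameter_domainD(3)[OF D(1)] unfolding Xt .
      show "gauss_diagram (Y \<union> {strand_crossing ov t' 0 1, strand_crossing ov t' 0 2, strand_crossing ov t' 1 2}) (diagram_sign D')"
        using parameter_domainD(3)[OF D(2)] unfolding Xt' .
      show "t i j \<in> {a i..b i} \<and> t' i j \<in> {a i..b i}" if "i < 3" "j < 3" "i \<noteq> j" for i j
        using triangle_config_mem[OF cfg that] triangle_config_mem[OF cfg' that] by (rule conjI)
      show "r \<notin> {a i..b i}" if "r \<in> Field Y" "i < 3" for r i using FY[OF that(2)] that(1) by blast
      show "triangle_signs s j i = - triangle_signs s i j" for i j by (auto simp: triangle_signs_def)
      show "diagram_sign D (strand_crossing ov t i j) = (if ov i j then triangle_signs s i j else - triangle_signs s i j)"
        if "(i, j) \<in> {(0, 1), (0, 2), (1, 2)}" for i j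
        by (rule triangle_config_sign[OF parameter_domainD(1)[OF D(1)] cfg s JT disj that])
      show "diagram_sign D' (strand_crossing ov t' i j) = (if ov i j then triangle_signs s i j else - triangle_signs s i j)"
        if "(i, j) \<in> {(0, 1), (0, 2), (1, 2)}" for i j
        by (rule triangle_config_sign[OF parameter_domainD(1)[OF D(2)] cfg' s JT disj that])
      show "step (t' k l) (t' k m) = - step (t k l) (t k m)" if "strand_triple k l m" for k l m
        by (rule triangle_flip_and_balance(1)[OF cfg cfg' s that])
      show "triangle_signs s m k * step (t k l) (t k m) = triangle_signs s m l * step (t l k) (t l m)"
        if "strand_triple k l m" for k l m
        by (rule triangle_flip_and_balance(2)[OF cfg cfg' s that])
    qed (fact disj sY)+
  qed
  then show ?thesis by (simp add: diagram_polys_def)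
qed

subsection \<open>Isotopies\<close>

text \<open>The determinant of f is its value on the standard frame.\<close>

lemma det2_linear:
  assumes "bounded_linear f"
  shows "det2 (f v) (f w) = det2 (f 1) (f \<i>) * det2 v w"
proof -
  interpret bounded_linear f by (rule assms)
  have f: "f v = Re v *\<^sub>R f 1 + Im v *\<^sub>R f \<i>" for v
  proof -
    have "v = Re v *\<^sub>R 1 + Im v *\<^sub>R \<i>" by (simp add: complex_eq_iff)
    then show ?thesis by (metis add scaleR)
  qed
  show ?thesis
    unfolding f[of v] f[of w] by (simp add: det2_def algebra_simps)
qed

lemma det2_scaleR: "det2 (a *\<^sub>R v) (b *\<^sub>R w) = a * b * det2 v w"
  by (simp add: det2_def algebra_simps)

lemma increasing_diffeoD:
  assumes "increasing_diffeo h"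
  shows "strict_mono h" "surj h" "(h has_vector_derivative vector_derivative h (at t)) (at t)"
    "0 < vector_derivative h (at t)"
proof -
  show der: "(h has_vector_derivative vector_derivative h (at t)) (at t)" for t
    using assms unfolding increasing_diffeo_def C1_differentiable_on_eq
    by (simp add: vector_derivative_works)
  show pos: "0 < vector_derivative h (at t)" for t
    using assms unfolding increasing_diffeo_def by blast
  show "surj h" using assms unfolding increasing_diffeo_def by blast
  show "strict_mono h"
  proof (rule strict_monoI)
    fix x y :: real assume "x < y"
    then show "h x < h y"
      using DERIV_pos_imp_increasing[of x y h] der pos
      by (metis has_real_derivative_iff_has_vector_derivative)
  qed
qed

text \<open>
  The frame of velocities is transformed by the derivative of \<open>\<phi>\<close>, whose determinant is positive, and rescaled
  by positive factors.
\<close>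

lemma sign_after_isotopy:
  assumes \<phi>: "orientation_preserving_diffeo \<phi>" and h: "increasing_diffeo h"
    and C1: "c C1_differentiable_on UNIV" and eq: "c (h s) = c (h t)"
  shows "0 < det2 (velocity (\<phi> \<circ> c \<circ> h) s) (velocity (\<phi> \<circ> c \<circ> h) t) \<longleftrightarrow>
    0 < det2 (velocity c (h s)) (velocity c (h t))"
proof -
  obtain \<phi>' where \<phi>': "\<And>z. (\<phi> has_derivative \<phi>' z) (at z)" "\<And>z. 0 < det2 (\<phi>' z 1) (\<phi>' z \<i>)"
    using \<phi> unfolding orientation_preserving_diffeo_def by blast
  note hD = increasing_diffeoD[OF h]
  let ?h' = "\<lambda>r. vector_derivative h (at r)"
  have v: "velocity (\<phi> \<circ> c \<circ> h) r = \<phi>' (c (h r)) (?h' r *\<^sub>R velocity c (h r))" for r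
  proof (rule velocity_eqI)
    have "((c \<circ> h) has_vector_derivative ?h' r *\<^sub>R velocity c (h r)) (at r)"
      by (rule vector_diff_chain_at[OF hD(3) velocity_works[OF C1]])
    then have "((\<lambda>x. \<phi> ((c \<circ> h) x)) has_derivative (\<lambda>x. \<phi>' ((c \<circ> h) r) (x *\<^sub>R (?h' r *\<^sub>R velocity c (h r))))) (at r)"
      unfolding has_vector_derivative_def by (rule has_derivative_compose[OF _ \<phi>'(1)])
    moreover have "\<phi>' ((c \<circ> h) r) (x *\<^sub>R w) = x *\<^sub>R \<phi>' ((c \<circ> h) r) w" for x w
      using has_derivative_bounded_linear[OF \<phi>'(1)] by (simp add: linear_simps)
    ultimately show "(\<phi> \<circ> c \<circ> h has_vector_derivative \<phi>' (c (h r)) (?h' r *\<^sub>R velocity c (h r))) (at r)"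
      unfolding has_vector_derivative_def by (simp add: comp_def)
  qed
  have "det2 (velocity (\<phi> \<circ> c \<circ> h) s) (velocity (\<phi> \<circ> c \<circ> h) t) =
      det2 (\<phi>' (c (h t)) 1) (\<phi>' (c (h t)) \<i>) * det2 (?h' s *\<^sub>R velocity c (h s)) (?h' t *\<^sub>R velocity c (h t))"
    unfolding v eq by (rule det2_linear[OF has_derivative_bounded_linear[OF \<phi>'(1)]])
  also have "\<dots> = det2 (\<phi>' (c (h t)) 1) (\<phi>' (c (h t)) \<i>) * (?h' s * ?h' t * det2 (velocity c (h s)) (velocity c (h t)))"
    by (simp only: det2_scaleR)
  finally have "det2 (velocity (\<phi> \<circ> c \<circ> h) s) (velocity (\<phi> \<circ> c \<circ> h) t) =
      det2 (\<phi>' (c (h t)) 1) (\<phi>' (c (h t)) \<i>) * (?h' s * ?h' t * det2 (velocity c (h s)) (velocity c (h t)))" .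
  moreover have "0 < u * (v * x) \<longleftrightarrow> 0 < x" if "0 < u" "0 < v" for u v x :: real
    using that by (simp add: zero_less_mult_iff)
  ultimately show ?thesis
    using \<phi>'(2)[of "c (h t)"] mult_pos_pos[OF hD(4)[of s] hD(4)[of t]] by presburger
qed

lemma diagram_polys_long_isotopy:
  assumes D: "virtual_diagram_on UNIV D" and iso: "long_isotopy D D'"
  shows "diagram_polys D' i j = diagram_polys D i j"
proof -
  obtain \<phi> h where \<phi>: "orientation_preserving_diffeo \<phi>" and h: "increasing_diffeo h"
    and c: "curve D' = \<phi> \<circ> curve D \<circ> h"
    and X': "real_crossings D' = {(s, t). (h s, h t) \<in> real_crossings D}"
    using iso unfolding long_isotopy_def by blast
  note hD = increasing_diffeoD[OF h]
  have img: "real_crossings D = map_prod h h ` real_crossings D'"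
  proof (intro set_eqI iffI)
    fix x assume x: "x \<in> real_crossings D"
    obtain s t where "fst x = h s" "snd x = h t" using hD(2) by (metis surjD)
    then have "x = map_prod h h (s, t)" by (simp add: prod_eq_iff)
    then show "x \<in> map_prod h h ` real_crossings D'" using x X' by auto
  qed (use X' in auto)
  have sign: "diagram_sign D (map_prod h h x) = diagram_sign D' x" if "x \<in> real_crossings D'" for x
  proof -
    have "map_prod h h x \<in> real_crossings D" using that img by blast
    then have "curve D (h (fst x)) = curve D (h (snd x))"
      using virtual_diagram_onD(3)[OF D, of "map_prod h h x"] by simp
    from sign_after_isotopy[OF \<phi> h virtual_diagram_onD(1)[OF D] this]
    show ?thesis by (simp add: diagram_sign_def case_prod_beta c)
  qed
  have "strict_mono_on (Field (real_crossings D')) h"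
    using hD(1) by (simp add: strict_mono_on_def strict_mono_def)
  then have "gauss_polys (map_prod h h ` real_crossings D') (diagram_sign D) i j =
      gauss_polys (real_crossings D') (diagram_sign D') i j"
    using sign by (rule gauss_polys_image)
  then show ?thesis unfolding diagram_polys_def img by simp
qed

lemma periodic_int:
  fixes c :: "real \<Rightarrow> 'a"
  assumes "\<And>t. c (t + 1) = c t"
  shows "c (t + of_int n) = c t"
proof -
  have *: "c (t + of_nat n) = c t" for t n
  proof (induct n)
    case (Suc n)
    have "c (t + of_nat (Suc n)) = c ((t + of_nat n) + 1)" by (simp add: add.commute add.left_commute)
    then show ?case using assms Suc by simp
  qed simp
  show ?thesis
  proof (cases n rule: int_cases2)
    case (nonneg k)
    then show ?thesis using * by simp
  next
    case (nonpos k)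
    then show ?thesis using *[of "t - of_nat k" k] by simp
  qed
qed

lemma velocity_periodic:
  assumes C1: "c C1_differentiable_on UNIV" and per: "\<And>t. c (t + 1) = c t"
  shows "velocity c (frac t) = velocity c t"
proof (rule velocity_eqI)
  have shift: "((\<lambda>s. s + of_int \<lfloor>t\<rfloor>) has_vector_derivative 1) (at (frac t))"
    by (auto intro!: derivative_eq_intros simp flip: has_real_derivative_iff_has_vector_derivative)
  have "(c has_vector_derivative velocity c t) (at (frac t + of_int \<lfloor>t\<rfloor>))"
    using velocity_works[OF C1, of t] by (simp add: frac_def)
  from vector_diff_chain_at[OF shift this]
  have "((\<lambda>s. c (s + of_int \<lfloor>t\<rfloor>)) has_vector_derivative velocity c t) (at (frac t))"
    by (simp add: comp_def)
  then show "(c has_vector_derivative velocity c t) (at (frac t))"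
    using periodic_int[of c, OF per] by simp
qed

lemma cyc_frac:
  fixes x y z :: real
  assumes "x < y" "y < z" "z < x + 1"
  shows "cyc (frac x) (frac y) (frac z)"
proof -
  have fl: "\<lfloor>x\<rfloor> \<le> \<lfloor>y\<rfloor>" "\<lfloor>y\<rfloor> \<le> \<lfloor>z\<rfloor>" "\<lfloor>z\<rfloor> \<le> \<lfloor>x\<rfloor> + 1"
    using assms floor_mono[of x y] floor_mono[of y z] floor_mono[of z "x + 1"] by simp_all
  then consider "\<lfloor>y\<rfloor> = \<lfloor>x\<rfloor>" "\<lfloor>z\<rfloor> = \<lfloor>x\<rfloor>" | "\<lfloor>y\<rfloor> = \<lfloor>x\<rfloor>" "\<lfloor>z\<rfloor> = \<lfloor>x\<rfloor> + 1" | "\<lfloor>y\<rfloor> = \<lfloor>x\<rfloor> + 1" "\<lfloor>z\<rfloor> = \<lfloor>x\<rfloor> + 1"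
    by linarith
  then show ?thesis
    by cases (use assms in \<open>simp_all add: cyc_def frac_def\<close>)
qed

text \<open>The lift h has degree one, so that its fractional part rotates the passages cyclically.\<close>

lemma closed_diagram_polys_isotopy:
  assumes D: "closed_diagram D" and iso: "closed_isotopy D D'"
  shows "closed_diagram_polys D' = closed_diagram_polys D"
proof -
  obtain \<phi> h where \<phi>: "orientation_preserving_diffeo \<phi>" and h: "increasing_diffeo h"
    and h1: "\<And>t. h (t + 1) = h t + 1" and c: "curve D' = \<phi> \<circ> curve D \<circ> h"
    and X': "real_crossings D' =
      {(s, t). s \<in> {0..<1} \<and> t \<in> {0..<1} \<and> (frac (h s), frac (h t)) \<in> real_crossings D}"
    using iso unfolding closed_isotopy_def by blast
  note hD = increasing_diffeoD[OF h]
  have V: "virtual_diagram_on {0..<1} D" and per: "\<And>t. curve D (t + 1) = curve D t"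
    using D unfolding closed_diagram_def by blast+
  have C1: "curve D C1_differentiable_on UNIV" by (rule virtual_diagram_onD(1)[OF V])
  have hn: "h (t + of_int n) = h t + of_int n" for t n
  proof -
    have "h (t + of_int n) - (t + of_int n) = h t - t"
      using periodic_int[of "\<lambda>t. h t - t" t n] h1 by simp
    then show ?thesis by simp
  qed
  let ?\<theta> = "\<lambda>s. frac (h s)"
  have mono: "h s < h t" if "s < t" for s t using hD(1) that by (simp add: strict_mono_def)
  have lift: "\<exists>s\<in>{0..<1}. ?\<theta> s = r" if "r \<in> {0..<1}" for r
  proof -
    obtain s where s: "h s = r" using hD(2) by (metis surjD)
    have "h (frac s) = r - of_int \<lfloor>s\<rfloor>" using hn[of "frac s" "\<lfloor>s\<rfloor>"] s by (simp add: frac_def)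
    moreover have "frac (r - of_int \<lfloor>s\<rfloor>) = r" using that by (simp add: frac_def floor_eq_iff) 
    ultimately show ?thesis by (intro bexI[of _ "frac s"]) (simp_all add: frac_lt_1)
  qed
  \<comment> \<open>A real crossing of D lifts to the fundamental domain of the new parameter.\<close>
  have img: "real_crossings D = map_prod ?\<theta> ?\<theta> ` real_crossings D'"
  proof (intro set_eqI iffI)
    fix x assume x: "x \<in> real_crossings D"
    then have "fst x \<in> {0..<1}" "snd x \<in> {0..<1}" using virtual_diagram_onD(3)[OF V] by blast+
    then obtain s t where "s \<in> {0..<1}" "t \<in> {0..<1}" "?\<theta> s = fst x" "?\<theta> t = snd x" using lift by metis
    then have "x = map_prod ?\<theta> ?\<theta> (s, t)" "(s, t) \<in> real_crossings D'" using x X' by (simp_all add: prod_eq_iff)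
    then show "x \<in> map_prod ?\<theta> ?\<theta> ` real_crossings D'" by blast
  qed (use X' in auto)
  have F: "Field (real_crossings D') \<subseteq> {0..<1}" unfolding X' by (auto simp: Field_def)
  have near: "h t < h s + 1" if "s \<in> {0..<1}" "t \<in> {0..<1}" for s t
    using mono[of t "s + 1"] h1[of s] that by simp
  have inj: "inj_on ?\<theta> {0..<1}"
  proof (rule inj_onI)
    have *: "\<not> s < t" if "s \<in> {0..<1}" "t \<in> {0..<1}" "?\<theta> s = ?\<theta> t" for s t
    proof
      assume "s < t"
      have "h t - h s = of_int (\<lfloor>h t\<rfloor> - \<lfloor>h s\<rfloor>)" using that(3) by (simp add: frac_def)
      moreover have "0 < h t - h s" "h t - h s < 1" using mono[OF \<open>s < t\<close>] near[OF that(1,2)] by simp_all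
      ultimately show False by (simp only: of_int_less_1_iff of_int_0_less_iff)
    qed
    show "s = t" if "s \<in> {0..<1}" "t \<in> {0..<1}" "?\<theta> s = ?\<theta> t" for s t
      using *[OF that] *[OF that(2,1) that(3)[symmetric]] by simp
  qed
  have vel: "velocity (curve D) (frac r) = velocity (curve D) r" and cr: "curve D (frac r) = curve D r" for r
    using velocity_periodic[OF C1 per] periodic_int[of "curve D" "frac r" "\<lfloor>r\<rfloor>", OF per] by (simp_all add: frac_def)
  have sign: "diagram_sign D (map_prod ?\<theta> ?\<theta> x) = diagram_sign D' x" if "x \<in> real_crossings D'" for x
  proof -
    have "map_prod ?\<theta> ?\<theta> x \<in> real_crossings D" using that img by blast
    then have "curve D (h (fst x)) = curve D (h (snd x))"
      using virtual_diagram_onD(3)[OF V, of "map_prod ?\<theta> ?\<theta> x"] by (simp add: cr)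
    from sign_after_isotopy[OF \<phi> h C1 this]
    show ?thesis by (simp add: diagram_sign_def case_prod_beta c vel)
  qed
  have "closed_gauss_polys (map_prod ?\<theta> ?\<theta> ` real_crossings D') (diagram_sign D)
      = closed_gauss_polys (real_crossings D') (diagram_sign D')"
  proof (rule closed_gauss_polys_image)
    show "inj_on ?\<theta> (Field (real_crossings D'))" using inj F by (rule inj_on_subset)
    fix r s t assume "r \<in> Field (real_crossings D')" "s \<in> Field (real_crossings D')" "t \<in> Field (real_crossings D')"
      "r < s" "s < t"
    then show "cyc (?\<theta> r) (?\<theta> s) (?\<theta> t)"
      using F by (intro cyc_frac mono near) auto
  qed (rule sign)
  then show ?thesis
    unfolding closed_diagram_polys_def img by simp
qed

section \<open>Intersection numbers of arcs on a surface\<close>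

text \<open>The position of a dart around its vertex, counted counterclockwise from the least dart.\<close>

definition dart_index :: "surface_diagram \<Rightarrow> nat \<Rightarrow> nat" where
  "dart_index S d = funpow_dist (rot S) (Min (vertex S d)) d"

lemma least_shift_mod:
  fixes a b N :: nat
  assumes "a < N" "b < N"
  shows "(LEAST k. (k + a) mod N = b) = (if a \<le> b then b - a else N - a + b)"
proof (rule Least_equality)
  show "((if a \<le> b then b - a else N - a + b) + a) mod N = b"
    using assms by auto
  fix k assume k: "(k + a) mod N = b"
  show "(if a \<le> b then b - a else N - a + b) \<le> k"
  proof (cases "k + a < N")
    case True
    then show ?thesis using k by simp
  next
    case False
    have "b + N * ((k + a) div N) = k + a" using k by (metis add.commute mult_div_mod_eq)
    moreover have "1 \<le> (k + a) div N" using False assms(1) by (simp add: div_greater_zero_iff Suc_le_eq)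
    then have "N \<le> N * ((k + a) div N)" using mult_le_mono2[of 1 "(k + a) div N" N] by simp
    ultimately have "N + b \<le> k + a" by linarith
    then show ?thesis using assms by auto
  qed
qed

locale knot_on_surface =
  fixes S :: surface_diagram
  assumes knot: "surface_knot_diagram S"
begin

abbreviation "n \<equiv> length (walk S)"
abbreviation "out \<equiv> out_dart S"
abbreviation "inc \<equiv> in_dart S"
abbreviation "prev k \<equiv> (k + n - 1) mod n"

lemma surface: "closed_surface S"
  using knot unfolding surface_knot_diagram_def by blast

lemma
  shows inc_in_vertex: "\<forall>k<n. inc k \<in> vertex S (out k)"
    and simple_crossings: "\<forall>k l m. (k, l) \<in> surface_double_points S \<and> (l, m) \<in> surface_double_points S \<longrightarrow> k = m"
    and transverse: "\<forall>(k, l)\<in>surface_double_points S. on_left S k (out l) \<noteq> on_left S k (inc l)"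
    and over_under_double: "over_under S \<subseteq> surface_double_points S"
    and over_xor_under: "\<forall>(k, l)\<in>surface_double_points S. ((k, l) \<in> over_under S) \<noteq> ((l, k) \<in> over_under S)"
  using knot unfolding surface_knot_diagram_def by - (elim conjE, assumption)+

lemma rot_permutes: "rot S permutes darts S" and opp_permutes: "opp S permutes darts S" and finite_darts: "finite (darts S)"
  using surface unfolding closed_surface_def by blast+

lemma n_pos: "0 < n" and walk_darts: "set (walk S) \<subseteq> darts S" and distinct_walk: "distinct (walk S @ map (opp S) (walk S))"
  using knot unfolding surface_knot_diagram_def by simp_all

lemma prev_less: "prev k < n"
  using n_pos by simp

lemma prev_eq: "k < n \<Longrightarrow> prev k = (if k = 0 then n - 1 else k - 1)"
  using n_pos by (cases k) (auto simp: mod_if)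

lemma out_inj: "k < n \<Longrightarrow> l < n \<Longrightarrow> out k = out l \<longleftrightarrow> k = l"
  using distinct_walk by (simp add: out_dart_def nth_eq_iff_index_eq)

lemma opp_walk_inj: "k < n \<Longrightarrow> l < n \<Longrightarrow> opp S (walk S ! k) = opp S (walk S ! l) \<longleftrightarrow> k = l"
  using distinct_walk by (metis (no_types, lifting) distinct_append length_map nth_eq_iff_index_eq nth_map)

lemma walk_neq_opp: "k < n \<Longrightarrow> l < n \<Longrightarrow> walk S ! k \<noteq> opp S (walk S ! l)"
proof
  assume kl: "k < n" "l < n" and eq: "walk S ! k = opp S (walk S ! l)"
  have "walk S ! k \<in> set (walk S)" "opp S (walk S ! l) \<in> opp S ` set (walk S)"
    using kl by (simp_all only: nth_mem imageI)
  moreover have "set (walk S) \<inter> opp S ` set (walk S) = {}" using distinct_walk by simp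
  ultimately show False using eq by (metis disjoint_iff)
qed

lemma inc_inj: "k < n \<Longrightarrow> l < n \<Longrightarrow> inc k = inc l \<longleftrightarrow> k = l"
  unfolding in_dart_def using opp_walk_inj[OF prev_less prev_less, of k l] prev_eq[of k] prev_eq[of l]
  by (auto split: if_splits)

lemma out_neq_inc: "k < n \<Longrightarrow> out k \<noteq> inc l"
  unfolding in_dart_def out_dart_def using walk_neq_opp prev_less by blast

lemma out_darts: "k < n \<Longrightarrow> out k \<in> darts S"
  using walk_darts unfolding out_dart_def by (meson nth_mem subsetD)

lemma inc_darts: "inc k \<in> darts S"
  using walk_darts prev_less[of k] unfolding in_dart_def
  by (metis nth_mem opp_permutes permutes_in_image subsetD)

lemma vertex_self: "d \<in> vertex S d"
  unfolding vertex_def using finite_darts rot_permutes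
  by (metis permutation_permutes permutation_self_in_orbit)

lemma vertex_eq: "e \<in> vertex S d \<Longrightarrow> vertex S e = vertex S d"
  unfolding vertex_def using finite_darts rot_permutes
  by (metis cyclic_on_orbit orbit_cyclic_eq3)

lemma vertex_darts: "d \<in> darts S \<Longrightarrow> vertex S d \<subseteq> darts S"
  unfolding vertex_def using rot_permutes by (rule permutes_orbit_subset)

lemma vertex_inc: "k < n \<Longrightarrow> vertex S (inc k) = vertex S (out k)"
  using inc_in_vertex vertex_eq by simp

lemma finite_vertex: "d \<in> darts S \<Longrightarrow> finite (vertex S d)"
  using vertex_darts finite_darts finite_subset by blast

lemma double_points_partition: "surface_double_points S = over_under S \<union> (over_under S)\<inverse>" (is ?A)
  and over_under_asym: "(k, l) \<in> over_under S \<Longrightarrow> (l, k) \<notin> over_under S"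
proof -
  have OU: "over_under S \<subseteq> surface_double_points S"
    and xor: "\<And>k l. (k, l) \<in> surface_double_points S \<Longrightarrow> ((k, l) \<in> over_under S) \<noteq> ((l, k) \<in> over_under S)"
    using over_under_double over_xor_under by fast+
  have sym: "(l, k) \<in> surface_double_points S" if "(k, l) \<in> surface_double_points S" for k l
    using that unfolding surface_double_points_def by auto
  show ?A
  proof (intro set_eqI iffI)
    fix x assume "x \<in> surface_double_points S"
    then show "x \<in> over_under S \<union> (over_under S)\<inverse>" using xor[of "fst x" "snd x"] by (cases x) auto
  next
    fix x assume "x \<in> over_under S \<union> (over_under S)\<inverse>"
    then show "x \<in> surface_double_points S" using OU sym by (cases x) auto
  qed
  show "(k, l) \<in> over_under S \<Longrightarrow> (l, k) \<notin> over_under S" using OU xor by blast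
qed

lemma crossingD:
  assumes "(k, l) \<in> over_under S"
  shows "k < n" "l < n" "k \<noteq> l" "vertex S (out l) = vertex S (out k)"
    "on_left S k (out l) \<noteq> on_left S k (inc l)"
proof -
  have dp: "(k, l) \<in> surface_double_points S" using assms double_points_partition by blast
  then show "k < n" "l < n" "k \<noteq> l" "vertex S (out l) = vertex S (out k)"
    unfolding surface_double_points_def by auto
  show "on_left S k (out l) \<noteq> on_left S k (inc l)"
    using transverse dp by fast
qed

lemma crossings_disjoint:
  assumes "(k, l) \<in> surface_double_points S" "(l, m) \<in> surface_double_points S"
  shows "k = m"
  using simple_crossings assms by metis

lemma gauss_diagram_of_surface: "gauss_diagram (over_under S) (surface_sign S)"
  unfolding gauss_diagram_def
proof (intro conjI ballI)
  have dp: "(fst x, snd x) \<in> surface_double_points S" "(snd x, fst x) \<in> surface_double_points S"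
    if "x \<in> over_under S" for x
    unfolding double_points_partition using that by simp_all
  have "over_under S \<subseteq> {..<n} \<times> {..<n}" using crossingD by auto
  then show "finite (over_under S)" by (rule finite_subset) simp
  show "inj_on fst (over_under S)"
  proof (rule inj_onI)
    fix x y assume xy: "x \<in> over_under S" "y \<in> over_under S" "fst x = fst y"
    then have "snd x = snd y"
      using crossings_disjoint[OF dp(2)[OF xy(1)], of "snd y"] dp(1)[OF xy(2)] by simp
    then show "x = y" using xy(3) by (simp add: prod_eq_iff)
  qed
  show "inj_on snd (over_under S)"
  proof (rule inj_onI)
    fix x y assume xy: "x \<in> over_under S" "y \<in> over_under S" "snd x = snd y"
    then have "fst x = fst y"
      using crossings_disjoint[OF dp(1)[OF xy(1)], of "fst y"] dp(2)[OF xy(2)] by simp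
    then show "x = y" using xy(3) by (simp add: prod_eq_iff)
  qed
  have False if xy: "x \<in> over_under S" "y \<in> over_under S" "fst x = snd y" for x y
  proof -
    have "snd x = fst y"
      using crossings_disjoint[OF dp(2)[OF xy(1)], of "fst y"] dp(2)[OF xy(2)] xy(3) by simp
    then have "(snd x, fst x) \<in> over_under S" using xy by simp
    then show False using over_under_asym[of "fst x" "snd x"] xy(1) by simp
  qed
  then show "fst ` over_under S \<inter> snd ` over_under S = {}" by blast
  show "surface_sign S x \<in> {1, - 1}" for x by (simp add: surface_sign_def case_prod_beta)
qed

subsection \<open>The cyclic order around a vertex\<close>

text \<open>Counted from the least dart, a vertex with N darts becomes the integers modulo N, on which \<open>rot\<close> adds 1.\<close>

lemma funpow_dist_in_vertex:
  assumes d: "d \<in> darts S" and yz: "y \<in> vertex S d" "z \<in> vertex S d"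
  obtains N where "dart_index S y < N" "dart_index S z < N"
    "funpow_dist (rot S) y z =
      (if dart_index S y \<le> dart_index S z then dart_index S z - dart_index S y else N - dart_index S y + dart_index S z)"
    "N = funpow_dist1 (rot S) (Min (vertex S d)) (Min (vertex S d))"
proof -
  define x where "x = Min (vertex S d)"
  define N where "N = funpow_dist1 (rot S) x x"
  have x: "x \<in> vertex S d" unfolding x_def using finite_vertex[OF d] vertex_self by (intro Min_in) blast+
  have orb: "orbit (rot S) x = vertex S d" using vertex_eq[OF x] by (simp add: vertex_def)
  have self: "x \<in> orbit (rot S) x" using orb x by simp
  have per: "(rot S ^^ N) x = x" unfolding N_def by (rule funpow_dist1_prop[OF self])
  have idx: "dart_index S w = funpow_dist (rot S) x w" if "w \<in> vertex S d" for w
    unfolding dart_index_def x_def vertex_eq[OF that] ..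
  have pow: "(rot S ^^ dart_index S w) x = w" if "w \<in> vertex S d" for w
    unfolding idx[OF that] using that orb by (intro funpow_dist_prop) simp
  have less: "dart_index S w < N" if "w \<in> vertex S d" for w
  proof -
    have "w \<in> (\<lambda>i. (rot S ^^ i) x) ` {0..<N}" using orbit_conv_funpow_dist1[OF self] orb that unfolding N_def by simp
    then obtain i where i: "i < N" "(rot S ^^ i) x = w" by auto
    have "funpow_dist (rot S) x w \<le> i" unfolding funpow_dist_def using i(2) by (rule Least_le)
    then show ?thesis using i(1) idx[OF that] by simp
  qed
  have inj: "i = j" if "i < N" "j < N" "(rot S ^^ i) x = (rot S ^^ j) x" for i j
    using inj_onD[OF inj_on_funpow_dist1[OF self] that(3)] that(1,2) unfolding N_def by simp
  have iff: "(rot S ^^ k) y = z \<longleftrightarrow> (k + dart_index S y) mod N = dart_index S z" for k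
  proof -
    have "(rot S ^^ k) y = (rot S ^^ (k + dart_index S y)) x" using pow[OF yz(1)] by (simp add: funpow_add)
    also have "\<dots> = (rot S ^^ ((k + dart_index S y) mod N)) x" using funpow_mod_eq[OF per] by simp
    finally have e: "(rot S ^^ k) y = (rot S ^^ ((k + dart_index S y) mod N)) x" .
    have "(k + dart_index S y) mod N < N" using less[OF yz(1)] by simp
    then show ?thesis unfolding e using inj[OF _ less[OF yz(2)]] pow[OF yz(2)] by metis
  qed
  have "funpow_dist (rot S) y z =
      (if dart_index S y \<le> dart_index S z then dart_index S z - dart_index S y else N - dart_index S y + dart_index S z)"
    unfolding funpow_dist_def iff by (rule least_shift_mod[OF less[OF yz(1)] less[OF yz(2)]])
  then show thesis
    by (rule that[OF less[OF yz(1)] less[OF yz(2)]]) (simp add: N_def x_def)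
qed

lemma dart_index_inj:
  assumes "d \<in> darts S" "y \<in> vertex S d" "z \<in> vertex S d" "dart_index S y = dart_index S z"
  shows "y = z"
proof -
  have m: "Min (vertex S d) \<in> vertex S d" using finite_vertex[OF assms(1)] vertex_self by (intro Min_in) blast+
  have "(rot S ^^ dart_index S w) (Min (vertex S d)) = w" if "w \<in> vertex S d" for w
    unfolding dart_index_def vertex_eq[OF that] using that vertex_eq[OF m]
    by (intro funpow_dist_prop) (simp add: vertex_def)
  then show ?thesis using assms(2-4) by metis
qed

lemma funpow_dist_less_iff_cyc:
  assumes d: "d \<in> darts S" and y: "y \<in> vertex S d" and z: "z \<in> vertex S d" and w: "w \<in> vertex S d"
    and ne: "y \<noteq> z" "z \<noteq> w" "y \<noteq> w"
  shows "funpow_dist (rot S) y z < funpow_dist (rot S) y w \<longleftrightarrow>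
    cyc (dart_index S y) (dart_index S z) (dart_index S w)"
proof -
  obtain N where N: "dart_index S y < N" "dart_index S z < N"
    "funpow_dist (rot S) y z =
      (if dart_index S y \<le> dart_index S z then dart_index S z - dart_index S y else N - dart_index S y + dart_index S z)"
    "N = funpow_dist1 (rot S) (Min (vertex S d)) (Min (vertex S d))"
    using d y z by (rule funpow_dist_in_vertex)
  obtain N' where N': "dart_index S w < N'"
    "funpow_dist (rot S) y w =
      (if dart_index S y \<le> dart_index S w then dart_index S w - dart_index S y else N' - dart_index S y + dart_index S w)"
    "N' = funpow_dist1 (rot S) (Min (vertex S d)) (Min (vertex S d))"
    using funpow_dist_in_vertex[OF d y w] by metis
  have "N' = N" using N(4) N'(3) by simp
  have ne': "dart_index S y \<noteq> dart_index S z" "dart_index S z \<noteq> dart_index S w" "dart_index S y \<noteq> dart_index S w"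
    using dart_index_inj[OF d] y z w ne by blast+
  show ?thesis
    unfolding N(3) N'(2) \<open>N' = N\<close> cyc_def using ne' N(1,2) N'(1) unfolding \<open>N' = N\<close> by auto
qed

subsection \<open>Reduction to the crossings\<close>

text \<open>
  The local contribution of a crossing: a, b, c, d are the places of the four darts around the vertex, the
  over strand leaving at a and arriving at b, the under strand leaving at c and arriving at d. On
  functions whose values at the four darts sum to zero, the form is determined by the cyclic order.
\<close>

lemma local_intersection_form:
  fixes a b c d :: nat and f1 f2 f3 f4 g1 g2 g3 g4 :: int
  assumes sum: "f1 + f2 + f3 + f4 = 0" "g1 + g2 + g3 + g4 = 0"
    and ne: "distinct [a, b, c, d]" and alt: "cyc a c b \<noteq> cyc a d b"
  shows "2 * (step a b * (f1 * g2 - f2 * g1) + step a c * (f1 * g3 - f3 * g1) + step a d * (f1 * g4 - f4 * g1)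
      + step b c * (f2 * g3 - f3 * g2) + step b d * (f2 * g4 - f4 * g2) + step c d * (f3 * g4 - f4 * g3)) =
    (if cyc a c b then 1 else - 1) * ((f1 - f2) * (g3 - g4) - (f3 - f4) * (g1 - g2))"
proof -
  have f4: "f4 = - f1 - f2 - f3" and g4: "g4 = - g1 - g2 - g3" using sum by simp_all
  have ne': "a \<noteq> b" "a \<noteq> c" "a \<noteq> d" "b \<noteq> c" "b \<noteq> d" "c \<noteq> d" using ne by simp_all
  have step: "step a b = (if a < b then 1 else - 1)" "step a c = (if a < c then 1 else - 1)"
    "step a d = (if a < d then 1 else - 1)" "step b c = (if b < c then 1 else - 1)"
    "step b d = (if b < d then 1 else - 1)" "step c d = (if c < d then 1 else - 1)"
    using ne' by (simp_all add: step_def)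
  have arrange: "a < x \<and> x < b \<and> b < y \<or> x < b \<and> b < y \<and> y < a \<or> b < y \<and> y < a \<and> a < x \<or> y < a \<and> a < x \<and> x < b"
    if xy: "cyc a x b" "\<not> cyc a y b" and n: "a \<noteq> y" "b \<noteq> y" "x \<noteq> y" for x y
  proof -
    consider "a < x" "x < b" | "x < b" "b < a" | "b < a" "a < x" using xy(1) unfolding cyc_def by blast
    then show ?thesis
    proof cases
      case 1
      have "\<not> (a < y \<and> y < b)" using xy(2) unfolding cyc_def by blast
      then have "y < a \<or> b < y" using n by linarith
      then show ?thesis using 1 by blast
    next
      case 2
      have "\<not> y < b" "\<not> a < y" using xy(2) 2 unfolding cyc_def by blast+
      then have "b < y" "y < a" using n by linarith+
      then show ?thesis using 2 by blast
    next
      case 3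
      have "\<not> y < b" "\<not> a < y" using xy(2) 3 unfolding cyc_def by blast+
      then have "b < y" "y < a" using n by linarith+
      then show ?thesis using 3 by blast
    qed
  qed
  show ?thesis
  proof (cases "cyc a c b")
    case True
    then have nd: "\<not> cyc a d b" using alt by blast
    have t: "cyc a c b = True" using True by simp
    consider "a < c \<and> c < b \<and> b < d" | "c < b \<and> b < d \<and> d < a" | "b < d \<and> d < a \<and> a < c" | "d < a \<and> a < c \<and> c < b"
      using arrange[OF True nd ne'(3,5,6)] by blast
    then show ?thesis
    proof cases
      case 1
      then have "a < b" "a < c" "a < d" "\<not> b < c" "b < d" "c < d" by linarith+
      then show ?thesis unfolding step t f4 g4 by (simp add: algebra_simps)
    next
      case 2
      then have "\<not> a < b" "\<not> a < c" "\<not> a < d" "\<not> b < c" "b < d" "c < d" by linarith+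
      then show ?thesis unfolding step t f4 g4 by (simp add: algebra_simps)
    next
      case 3
      then have "\<not> a < b" "a < c" "\<not> a < d" "b < c" "b < d" "\<not> c < d" by linarith+
      then show ?thesis unfolding step t f4 g4 by (simp add: algebra_simps)
    next
      case 4
      then have "a < b" "a < c" "\<not> a < d" "\<not> b < c" "\<not> b < d" "\<not> c < d" by linarith+
      then show ?thesis unfolding step t f4 g4 by (simp add: algebra_simps)
    qed
  next
    case False
    then have nd: "cyc a d b" using alt by blast
    have t: "cyc a c b = False" using False by simp
    consider "a < d \<and> d < b \<and> b < c" | "d < b \<and> b < c \<and> c < a" | "b < c \<and> c < a \<and> a < d" | "c < a \<and> a < d \<and> d < b"
      using arrange[OF nd False ne'(2,4) ne'(6)[symmetric]] by blast
    then show ?thesis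
    proof cases
      case 1
      then have "a < b" "a < c" "a < d" "b < c" "\<not> b < d" "\<not> c < d" by linarith+
      then show ?thesis unfolding step t f4 g4 by (simp add: algebra_simps)
    next
      case 2
      then have "\<not> a < b" "\<not> a < c" "\<not> a < d" "b < c" "\<not> b < d" "\<not> c < d" by linarith+
      then show ?thesis unfolding step t f4 g4 by (simp add: algebra_simps)
    next
      case 3
      then have "\<not> a < b" "\<not> a < c" "a < d" "b < c" "b < d" "c < d" by linarith+
      then show ?thesis unfolding step t f4 g4 by (simp add: algebra_simps)
    next
      case 4
      then have "a < b" "\<not> a < c" "a < d" "\<not> b < c" "\<not> b < d" "c < d" by linarith+
      then show ?thesis unfolding step t f4 g4 by (simp add: algebra_simps)
    qed
  qed
qed

text \<open>The properties of an arc of the knot, as a chain, that determine its intersection numbers.\<close>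

definition cycle_at_crossings :: "(nat \<Rightarrow> int) \<Rightarrow> bool" where
  "cycle_at_crossings f \<longleftrightarrow> (\<forall>d. d \<notin> out ` {..<n} \<union> inc ` {..<n} \<longrightarrow> f d = 0) \<and>
     (\<forall>k<n. k \<notin> Field (over_under S) \<longrightarrow> f (out k) + f (inc k) = 0) \<and>
     (\<forall>(k, l)\<in>over_under S. f (out k) + f (inc k) + f (out l) + f (inc l) = 0)"

text \<open>
  Only the crossings contribute: at any other passage, f and g are proportional on the two darts. The sum over
  a crossing is evaluated by the local formula, which is stated for the doubled sum.
\<close>

lemma intersection_number_eq_pairing:
  assumes f: "cycle_at_crossings f" and g: "cycle_at_crossings g"
  shows "intersection_number S f g =
    pairing (over_under S) (surface_sign S) (\<lambda>k. f (out k) - f (inc k)) (\<lambda>k. g (out k) - g (inc k)) div 4"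
proof -
  define M where "M = (\<lambda>d e. f d * g e - f e * g d)"
  define R where "R = (\<lambda>d e. if e \<in> vertex S d \<and> dart_before S d e then M d e else 0)"
  \<comment> \<open>K k l collects the terms of R between the strands k and l; a crossing gives rise to four of these blocks.\<close>
  define K where "K = (\<lambda>k l. R (out k) (out l) + R (out k) (inc l) + R (inc k) (out l) + R (inc k) (inc l))"
  let ?U = "out ` {..<n} \<union> inc ` {..<n}"
  let ?X = "over_under S"
  have U: "?U \<subseteq> darts S" using out_darts inc_darts by auto
  have f0: "f d = 0" "g d = 0" if "d \<notin> ?U" for d
    using f g that unfolding cycle_at_crossings_def by blast+
  have sumU: "(\<Sum>d\<in>?U. h d) = (\<Sum>k<n. h (out k) + h (inc k))" for h :: "nat \<Rightarrow> int"
  proof -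
    have "out ` {..<n} \<inter> inc ` {..<n} = {}" using out_neq_inc by auto
    moreover have "inj_on out {..<n}" "inj_on inc {..<n}" using out_inj inc_inj by (auto intro!: inj_onI)
    ultimately show ?thesis by (simp add: sum.union_disjoint sum.reindex sum.distrib)
  qed
  have "(\<Sum>d\<in>darts S. \<Sum>e\<in>{e \<in> vertex S d. dart_before S d e}. f d * g e - f e * g d)
      = (\<Sum>d\<in>darts S. \<Sum>e\<in>darts S. R d e)"
  proof (rule sum.cong)
    fix d assume d: "d \<in> darts S"
    have "(\<Sum>e\<in>{e \<in> vertex S d. dart_before S d e}. f d * g e - f e * g d)
        = (\<Sum>e\<in>{e \<in> vertex S d. dart_before S d e}. R d e)"
      by (rule sum.cong) (simp_all add: R_def M_def)
    also have "\<dots> = (\<Sum>e\<in>darts S. R d e)"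
      by (rule sum.mono_neutral_left) (use vertex_darts[OF d] finite_darts in \<open>auto simp: R_def\<close>)
    finally show "(\<Sum>e\<in>{e \<in> vertex S d. dart_before S d e}. f d * g e - f e * g d) = (\<Sum>e\<in>darts S. R d e)" .
  qed simp
  also have "\<dots> = (\<Sum>d\<in>darts S. \<Sum>e\<in>?U. R d e)"
    by (rule sum.cong[OF refl], rule sum.mono_neutral_right[OF finite_darts U]) (auto simp: R_def M_def f0)
  also have "\<dots> = (\<Sum>d\<in>?U. \<Sum>e\<in>?U. R d e)"
    by (rule sum.mono_neutral_right[OF finite_darts U]) (auto simp: R_def M_def f0 intro!: sum.neutral)
  also have "\<dots> = (\<Sum>k<n. \<Sum>l<n. K k l)"
    unfolding sumU K_def by (simp add: sum.distrib algebra_simps)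
  also have "\<dots> = (\<Sum>x\<in>{..<n} \<times> {..<n}. K (fst x) (snd x))"
    by (simp add: sum.cartesian_product case_prod_beta)
  also have "\<dots> = (\<Sum>x\<in>(\<lambda>k. (k, k)) ` {..<n} \<union> (?X \<union> ?X\<inverse>). K (fst x) (snd x))"
  proof (rule sum.mono_neutral_right)
    show "(\<lambda>k. (k, k)) ` {..<n} \<union> (?X \<union> ?X\<inverse>) \<subseteq> {..<n} \<times> {..<n}"
      using crossingD(1,2) by auto
    show "\<forall>x\<in>{..<n} \<times> {..<n} - ((\<lambda>k. (k, k)) ` {..<n} \<union> (?X \<union> ?X\<inverse>)). K (fst x) (snd x) = 0"
    proof
      fix x assume x: "x \<in> {..<n} \<times> {..<n} - ((\<lambda>k. (k, k)) ` {..<n} \<union> (?X \<union> ?X\<inverse>))"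
      obtain k l where kl: "x = (k, l)" by (cases x)
      have b: "k < n" "l < n" "k \<noteq> l" using x kl by auto
      have "(k, l) \<notin> surface_double_points S" using x kl double_points_partition by blast
      then have "vertex S (out k) \<noteq> vertex S (out l)" using b unfolding surface_double_points_def by blast
      then have "e \<notin> vertex S d" if "d \<in> {out k, inc k}" "e \<in> {out l, inc l}" for d e
        using that vertex_eq[of e d] vertex_inc[OF b(1)] vertex_inc[OF b(2)] by auto
      then show "K (fst x) (snd x) = 0" by (simp add: K_def R_def kl)
    qed
  qed simp
  also have "\<dots> = (\<Sum>k<n. K k k) + (\<Sum>x\<in>?X \<union> ?X\<inverse>. K (fst x) (snd x))"
  proof (subst sum.union_disjoint)
    show "(\<lambda>k. (k, k)) ` {..<n} \<inter> (?X \<union> ?X\<inverse>) = {}" using crossingD(3) by auto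
    show "finite (?X \<union> ?X\<inverse>)" using gauss_diagramD(1)[OF gauss_diagram_of_surface] by simp
  qed (simp_all add: sum.reindex inj_on_def)
  also have "(\<Sum>x\<in>?X \<union> ?X\<inverse>. K (fst x) (snd x)) = (\<Sum>x\<in>?X. K (fst x) (snd x) + K (snd x) (fst x))"
  proof -
    have fin: "finite ?X" by (rule gauss_diagramD(1)[OF gauss_diagram_of_surface])
    have "?X \<inter> ?X\<inverse> = {}" using over_under_asym by auto
    then have "(\<Sum>x\<in>?X \<union> ?X\<inverse>. K (fst x) (snd x)) = (\<Sum>x\<in>?X. K (fst x) (snd x)) + (\<Sum>x\<in>?X\<inverse>. K (fst x) (snd x))"
      using fin by (intro sum.union_disjoint) simp_all
    also have "(\<Sum>x\<in>?X\<inverse>. K (fst x) (snd x)) = (\<Sum>x\<in>?X. K (snd x) (fst x))"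
      by (rule sum.reindex_bij_witness[of _ prod.swap prod.swap]) auto
    finally show ?thesis by (simp add: sum.distrib)
  qed
  \<comment> \<open>At a passage off the crossings, f and g are proportional.\<close>
  also have "(\<Sum>k<n. K k k) = (\<Sum>x\<in>?X. K (fst x) (fst x) + K (snd x) (snd x))"
  proof -
    have fin: "finite ?X" and inj: "inj_on fst ?X" "inj_on snd ?X" and dis: "fst ` ?X \<inter> snd ` ?X = {}"
      using gauss_diagram_of_surface unfolding gauss_diagram_def by blast+
    have F: "Field ?X = fst ` ?X \<union> snd ` ?X" by (auto simp: Field_def Domain_fst Range_snd)
    have "(\<Sum>k<n. K k k) = (\<Sum>k\<in>Field ?X. K k k)"
    proof (rule sum.mono_neutral_right)
      show "Field ?X \<subseteq> {..<n}" using crossingD(1,2) by (auto simp: Field_def)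
      show "\<forall>k\<in>{..<n} - Field ?X. K k k = 0"
      proof
        fix k assume k: "k \<in> {..<n} - Field ?X"
        then have "f (inc k) = - f (out k)" "g (inc k) = - g (out k)"
          using f g unfolding cycle_at_crossings_def by (metis DiffD1 DiffD2 add_eq_0_iff lessThan_iff)+
        then show "K k k = 0" by (simp add: K_def R_def M_def)
      qed
    qed simp
    also have "\<dots> = (\<Sum>k\<in>fst ` ?X. K k k) + (\<Sum>k\<in>snd ` ?X. K k k)"
      unfolding F using fin dis by (intro sum.union_disjoint) simp_all
    finally show ?thesis by (simp add: sum.reindex[OF inj(1)] sum.reindex[OF inj(2)] sum.distrib)
  qed
  finally have total: "(\<Sum>d\<in>darts S. \<Sum>e\<in>{e \<in> vertex S d. dart_before S d e}. f d * g e - f e * g d) =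
      (\<Sum>x\<in>?X. K (fst x) (fst x) + K (snd x) (snd x)) + (\<Sum>x\<in>?X. K (fst x) (snd x) + K (snd x) (fst x))" .
  have crossing: "2 * (K k k + K l l + (K k l + K l k)) = surface_sign S (k, l) *
      ((f (out k) - f (inc k)) * (g (out l) - g (inc l)) - (f (out l) - f (inc l)) * (g (out k) - g (inc k)))"
    if x: "(k, l) \<in> ?X" for k l
  proof -
    note c = crossingD[OF x]
    let ?\<pi> = "dart_index S"
    have V: "vertex S (inc k) = vertex S (out k)" "vertex S (out l) = vertex S (out k)" "vertex S (inc l) = vertex S (out k)"
      using vertex_inc c by auto
    have in_v: "out k \<in> vertex S (out k)" "inc k \<in> vertex S (out k)" "out l \<in> vertex S (out k)" "inc l \<in> vertex S (out k)"
      using vertex_self V by metis+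
    have before: "dart_before S d e \<longleftrightarrow> ?\<pi> d < ?\<pi> e" if "d \<in> vertex S (out k)" "e \<in> vertex S (out k)" for d e
      using vertex_eq[OF that(1)] vertex_eq[OF that(2)] by (simp add: dart_before_def dart_index_def Let_def)
    have RR: "R d e + R e d = step (?\<pi> d) (?\<pi> e) * M d e" if "d \<in> vertex S (out k)" "e \<in> vertex S (out k)" for d e
    proof -
      have "e \<in> vertex S d" "d \<in> vertex S e" using that vertex_eq[OF that(1)] vertex_eq[OF that(2)] by simp_all
      then show ?thesis
        using before[OF that] before[OF that(2,1)] dart_index_inj[OF out_darts[OF c(1)] that]
        by (auto simp: R_def M_def step_def)
    qed
    have R0: "R d d = 0" for d by (simp add: R_def M_def)
    have ne: "out k \<noteq> inc k" "out k \<noteq> out l" "out k \<noteq> inc l" "inc k \<noteq> out l" "inc k \<noteq> inc l" "out l \<noteq> inc l"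
      using out_neq_inc[OF c(1)] out_neq_inc[OF c(2), of k] out_neq_inc[OF c(2), of l] out_inj[OF c(1,2)] inc_inj[OF c(1,2)] c(3) by metis+
    have dist: "distinct [?\<pi> (out k), ?\<pi> (inc k), ?\<pi> (out l), ?\<pi> (inc l)]"
      using dart_index_inj[OF out_darts[OF c(1)]] in_v ne by (simp, metis)
    have left: "on_left S k e \<longleftrightarrow> cyc (?\<pi> (out k)) (?\<pi> e) (?\<pi> (inc k))" if "e \<in> {out l, inc l}" for e
    proof -
      have "e \<in> vertex S (out k)" "out k \<noteq> e" "e \<noteq> inc k" using that in_v ne by auto
      then show ?thesis
        unfolding on_left_def using funpow_dist_less_iff_cyc[OF out_darts[OF c(1)] in_v(1) _ in_v(2)] ne(1) by blast
    qed
    have sums: "f (out k) + f (inc k) + f (out l) + f (inc l) = 0" "g (out k) + g (inc k) + g (out l) + g (inc l) = 0"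
      using f g x unfolding cycle_at_crossings_def by blast+
    have sgn: "surface_sign S (k, l) = (if cyc (?\<pi> (out k)) (?\<pi> (out l)) (?\<pi> (inc k)) then 1 else - 1)"
      using left[of "out l"] by (simp add: surface_sign_def)
    have alt: "cyc (?\<pi> (out k)) (?\<pi> (out l)) (?\<pi> (inc k)) \<noteq> cyc (?\<pi> (out k)) (?\<pi> (inc l)) (?\<pi> (inc k))"
      using c(5) left[of "out l"] left[of "inc l"] by simp
    have "K k k + K l l + (K k l + K l k) =
        (R (out k) (inc k) + R (inc k) (out k)) + (R (out k) (out l) + R (out l) (out k))
        + (R (out k) (inc l) + R (inc l) (out k)) + (R (inc k) (out l) + R (out l) (inc k))
        + (R (inc k) (inc l) + R (inc l) (inc k)) + (R (out l) (inc l) + R (inc l) (out l))"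
      by (simp add: K_def R0)
    then show ?thesis
      unfolding RR[OF in_v(1,2)] RR[OF in_v(1,3)] RR[OF in_v(1,4)] RR[OF in_v(2,3)] RR[OF in_v(2,4)] RR[OF in_v(3,4)] M_def
        sgn local_intersection_form[OF sums dist alt, symmetric]
      by simp
  qed
  have half: "s div 2 = p div 4" if "2 * s = p" for s p :: int using that by presburger
  have "2 * (\<Sum>d\<in>darts S. \<Sum>e\<in>{e \<in> vertex S d. dart_before S d e}. f d * g e - f e * g d) =
      pairing ?X (surface_sign S) (\<lambda>k. f (out k) - f (inc k)) (\<lambda>k. g (out k) - g (inc k))"
    unfolding total pairing_def sum.distrib[symmetric] sum_distrib_left
    by (rule sum.cong) (use crossing in auto)
  then show ?thesis
    unfolding intersection_number_def using half by blast
qed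

subsection \<open>Arcs\<close>

lemma arc_positions_less: "k < n \<Longrightarrow> l < n \<Longrightarrow> j \<in> arc_positions S k l \<Longrightarrow> j < n"
  by (auto simp: arc_positions_def split: if_splits)

lemma arc_cycle_values:
  assumes kl: "k < n" "l < n"
  shows "m < n \<Longrightarrow> arc_cycle S k l (out m) = of_bool (m \<in> arc_positions S k l)"
    "arc_cycle S k l (inc m) = - of_bool (prev m \<in> arc_positions S k l)"
    "d \<notin> out ` {..<n} \<union> inc ` {..<n} \<Longrightarrow> arc_cycle S k l d = 0"
proof -
  let ?A = "arc_positions S k l"
  have fin: "finite ?A" by (simp add: arc_positions_def)
  have A: "j < n" if "j \<in> ?A" for j using arc_positions_less[OF kl that] .
  have delta: "(\<Sum>j\<in>?A. of_bool (j = i) :: int) = of_bool (i \<in> ?A)" for i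
    using fin by (simp add: of_bool_def)
  show "arc_cycle S k l (out m) = of_bool (m \<in> ?A)" if "m < n"
  proof -
    have "arc_cycle S k l (out m) = (\<Sum>j\<in>?A. of_bool (j = m))"
      unfolding arc_cycle_def
    proof (rule sum.cong[OF refl])
      fix j assume "j \<in> ?A"
      then show "of_bool (walk S ! j = out m) - of_bool (opp S (walk S ! j) = out m) = (of_bool (j = m) :: int)"
        using A[of j] out_inj[of j m] walk_neq_opp[of m j] that by (simp add: out_dart_def)
    qed
    then show ?thesis using delta by simp
  qed
  show "arc_cycle S k l (inc m) = - of_bool (prev m \<in> ?A)"
  proof -
    have "arc_cycle S k l (inc m) = (\<Sum>j\<in>?A. - of_bool (j = prev m))"
      unfolding arc_cycle_def
    proof (rule sum.cong[OF refl])
      fix j assume "j \<in> ?A"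
      then have "walk S ! j \<noteq> inc m" "opp S (walk S ! j) = inc m \<longleftrightarrow> j = prev m"
        unfolding in_dart_def using A[of j] walk_neq_opp[OF _ prev_less] opp_walk_inj[OF _ prev_less] by blast+
      then show "of_bool (walk S ! j = inc m) - of_bool (opp S (walk S ! j) = inc m) = (- of_bool (j = prev m) :: int)"
        by simp
    qed
    then show ?thesis using delta by (simp add: sum_negf)
  qed
  show "arc_cycle S k l d = 0" if d: "d \<notin> out ` {..<n} \<union> inc ` {..<n}"
    unfolding arc_cycle_def
  proof (rule sum.neutral, rule ballI)
    fix j assume "j \<in> ?A"
    then have j: "j < n" by (rule A)
    have "walk S ! j \<noteq> d" using d j by (auto simp: out_dart_def)
    moreover have "opp S (walk S ! j) \<noteq> d"
    proof -
      define i where "i = (if j = n - 1 then 0 else j + 1)"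
      have "i < n" "prev i = j" using j n_pos prev_eq[of i] by (auto simp: i_def split: if_splits)
      then have "opp S (walk S ! j) = inc i" by (simp add: in_dart_def)
      then show ?thesis using d \<open>i < n\<close> by auto
    qed
    ultimately show "of_bool (walk S ! j = d) - of_bool (opp S (walk S ! j) = d) = (0 :: int)" by simp
  qed
qed

text \<open>
  An arc uses both darts at an inner position, and one dart at each of its ends. This is the origin of the
  halves in \<open>cyclic_arc\<close>.
\<close>

lemma arc_cycle_strand:
  assumes "k < n" "l < n" "k \<noteq> l" "m < n"
  shows "arc_cycle S k l (out m) - arc_cycle S k l (inc m) = cyclic_arc k l m"
    "arc_cycle S k l (out m) + arc_cycle S k l (inc m) = of_bool (m = k) - of_bool (m = l)"
proof -
  have A: "m \<in> arc_positions S k l \<longleftrightarrow> (if k < l then k \<le> m \<and> m < l else k \<le> m \<or> m < l)"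
    using assms(4) by (simp add: arc_positions_def)
  have P: "prev m \<in> arc_positions S k l \<longleftrightarrow> (if k < l then k < m \<and> m \<le> l else k < m \<or> m \<le> l)"
  proof (cases "m = 0")
    case True
    then show ?thesis
      using assms unfolding prev_eq[OF assms(4)] arc_positions_def by (simp; linarith)
  next
    case False
    then show ?thesis
      using assms unfolding prev_eq[OF assms(4)] arc_positions_def by (simp; linarith)
  qed
  consider "m = k" | "m = l" | "m \<noteq> k" "m \<noteq> l" by blast
  then have "of_bool (m \<in> arc_positions S k l) - - of_bool (prev m \<in> arc_positions S k l) = cyclic_arc k l m \<and>
      of_bool (m \<in> arc_positions S k l) + - of_bool (prev m \<in> arc_positions S k l) = (of_bool (m = k) - of_bool (m = l) :: int)"
  proof cases
    case 1
    then show ?thesis unfolding A P using assms(3) by (simp add: cyclic_arc_def)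
  next
    case 2
    then show ?thesis unfolding A P using assms(3) by (simp add: cyclic_arc_def)
  next
    case 3
    have "(if k < l then k \<le> m \<and> m < l else k \<le> m \<or> m < l) \<longleftrightarrow> cyc k m l"
      "(if k < l then k < m \<and> m \<le> l else k < m \<or> m \<le> l) \<longleftrightarrow> cyc k m l"
      using 3 assms(3) unfolding cyc_def by (cases "k < l"; simp; linarith)+
    then show ?thesis unfolding A P using 3 by (simp add: cyclic_arc_def)
  qed
  then show "arc_cycle S k l (out m) - arc_cycle S k l (inc m) = cyclic_arc k l m"
    "arc_cycle S k l (out m) + arc_cycle S k l (inc m) = of_bool (m = k) - of_bool (m = l)"
    unfolding arc_cycle_values(1)[OF assms(1,2,4)] arc_cycle_values(2)[OF assms(1,2)] by blast+
qed

lemma arc_cycle_at_crossings: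
  assumes kl: "(k, l) \<in> surface_double_points S"
  shows "cycle_at_crossings (arc_cycle S k l)"
proof -
  have b: "k < n" "l < n" "k \<noteq> l" using kl unfolding surface_double_points_def by auto
  have F: "k \<in> Field (over_under S)" "l \<in> Field (over_under S)"
    using kl unfolding double_points_partition by (auto simp: Field_def)
  have meet: "m \<in> {k, l} \<longleftrightarrow> m' \<in> {k, l}" if m: "(m, m') \<in> over_under S" for m m'
  proof -
    have "(m, m') \<in> surface_double_points S" "(m', m) \<in> surface_double_points S" "(l, k) \<in> surface_double_points S"
      using m kl unfolding double_points_partition by auto
    then show ?thesis using crossings_disjoint kl by blast
  qed
  show ?thesis
    unfolding cycle_at_crossings_def
  proof (intro conjI allI impI ballI)
    fix d assume "d \<notin> out ` {..<n} \<union> inc ` {..<n}"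
    then show "arc_cycle S k l d = 0" by (rule arc_cycle_values(3)[OF b(1,2)])
  next
    fix m assume "m < n" "m \<notin> Field (over_under S)"
    then show "arc_cycle S k l (out m) + arc_cycle S k l (inc m) = 0"
      using F arc_cycle_strand(2)[OF b] by auto
  next
    fix x assume x: "x \<in> over_under S"
    obtain m m' where mm: "x = (m, m')" by (cases x)
    have c: "m < n" "m' < n" "m \<noteq> m'" using crossingD(1-3) x mm by blast+
    have i: "m \<in> {k, l} \<longleftrightarrow> m' \<in> {k, l}" using meet x mm by blast
    have "of_bool (m = k) - of_bool (m = l) + (of_bool (m' = k) - of_bool (m' = l)) = (0 :: int)"
      using i c(3) b(3) by auto
    then show "case x of (m, m') \<Rightarrow> arc_cycle S k l (out m) + arc_cycle S k l (inc m)
        + arc_cycle S k l (out m') + arc_cycle S k l (inc m') = 0"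
      using arc_cycle_strand(2)[OF b c(1)] arc_cycle_strand(2)[OF b c(2)] by (simp add: mm)
  qed
qed

theorem intersection_number_arcs:
  assumes "(k, l) \<in> surface_double_points S" "(k', l') \<in> surface_double_points S"
  shows "intersection_number S (arc_cycle S k l) (arc_cycle S k' l') =
    pairing (over_under S) (surface_sign S) (cyclic_arc k l) (cyclic_arc k' l') div 4"
proof -
  have b: "k < n" "l < n" "k \<noteq> l" "k' < n" "l' < n" "k' \<noteq> l'" using assms unfolding surface_double_points_def by auto
  have F: "r < n" if "r \<in> Field (over_under S)" for r using that crossingD(1,2) by (auto simp: Field_def)
  have "pairing (over_under S) (surface_sign S)
      (\<lambda>m. arc_cycle S k l (out m) - arc_cycle S k l (inc m)) (\<lambda>m. arc_cycle S k' l' (out m) - arc_cycle S k' l' (inc m))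
    = pairing (over_under S) (surface_sign S) (cyclic_arc k l) (cyclic_arc k' l')"
    by (rule pairing_cong) (simp_all add: arc_cycle_strand(1) b F)
  then show ?thesis
    using intersection_number_eq_pairing[OF arc_cycle_at_crossings[OF assms(1)] arc_cycle_at_crossings[OF assms(2)]] by simp
qed

end

section \<open>Existence of surface realizations\<close>

text \<open>
  The ribbon graph of a Gauss diagram: position k of the walk has the outgoing dart 2 * k, whose
  opposite 2 * k + 1 arrives at the next position. The rotation at a crossing is read off from the sign.
\<close>

locale gauss_code =
  fixes N :: nat and Y :: "(nat \<times> nat) set" and e :: "nat \<times> nat \<Rightarrow> int"
  assumes gauss: "gauss_diagram Y e" and positions: "Field Y \<subseteq> {1..<N}" and N_pos: "0 < N"
begin

text \<open>A position that is not a passage through a crossing is its own mate; it becomes a vertex with two darts.\<close>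

definition mate :: "nat \<Rightarrow> nat" where
  "mate k = (if k \<in> Field Y then SOME l. (k, l) \<in> Y \<or> (l, k) \<in> Y else k)"

text \<open>Whether the other strand leaves the crossing to the left.\<close>

definition left_turn :: "nat \<Rightarrow> bool" where
  "left_turn k \<longleftrightarrow> (\<exists>l. (k, l) \<in> Y \<and> e (k, l) = 1 \<or> (l, k) \<in> Y \<and> e (l, k) = - 1)"

definition leave :: "nat \<Rightarrow> nat" where
  "leave k = 2 * k"

definition arrive :: "nat \<Rightarrow> nat" where
  "arrive k = 2 * ((k + N - 1) mod N) + 1"

definition rotation :: "nat \<Rightarrow> nat" where
  "rotation d = (if d \<ge> 2 * N then d
     else if even d then (if left_turn (d div 2) then leave (mate (d div 2)) else arrive (mate (d div 2)))
     else (let k = (d div 2 + 1) mod N in if left_turn k then arrive (mate k) else leave (mate k)))"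

definition reversal :: "nat \<Rightarrow> nat" where
  "reversal d = (if d \<ge> 2 * N then d else if even d then d + 1 else d - 1)"

definition ribbon :: surface_diagram where
  "ribbon = \<lparr>darts = {..<2 * N}, rot = rotation, opp = reversal, walk = map (\<lambda>k. 2 * k) [0..<N], over_under = Y\<rparr>"

lemma chordD:
  assumes "(k, l) \<in> Y"
  shows "k \<in> Field Y" "l \<in> Field Y" "k \<noteq> l" "k < N" "l < N" "0 < k" "0 < l" "e (k, l) = 1 \<or> e (k, l) = -1"
proof -
  show F: "k \<in> Field Y" "l \<in> Field Y" using assms by (auto simp: Field_def)
  then show "k < N" "l < N" "0 < k" "0 < l" using positions by auto
  show "k \<noteq> l" "e (k, l) = 1 \<or> e (k, l) = -1"
    using gauss_diagramD(2,3)[OF gauss assms] by simp_all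
qed

lemma chord_unique:
  assumes "(k, l) \<in> Y \<or> (l, k) \<in> Y" "(k, m) \<in> Y \<or> (m, k) \<in> Y"
  shows "l = m \<and> ((k, l) \<in> Y \<longleftrightarrow> (k, m) \<in> Y)"
proof -
  have D: "x = y" if "x \<in> Y" "y \<in> Y" "fst x = fst y \<or> snd x = snd y \<or> fst x = snd y \<or> snd x = fst y" for x y
    using gauss_diagramD(4)[OF gauss that(1,2)] that(3) by blast
  from assms show ?thesis
  proof (elim disjE)
    assume a: "(k, l) \<in> Y" "(k, m) \<in> Y"
    then show ?thesis using D[OF a] by simp
  next
    assume a: "(k, l) \<in> Y" "(m, k) \<in> Y"
    then show ?thesis using D[OF a] chordD(3)[OF a(1)] by simp
  next
    assume a: "(l, k) \<in> Y" "(k, m) \<in> Y"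
    then show ?thesis using D[OF a] chordD(3)[OF a(1)] by simp
  next
    assume a: "(l, k) \<in> Y" "(m, k) \<in> Y"
    then have "l = m" using D[OF a] by simp
    then show ?thesis by simp
  qed
qed

lemma mate_eq:
  assumes "(k, l) \<in> Y \<or> (l, k) \<in> Y"
  shows "mate k = l"
proof -
  have "k \<in> Field Y" using assms by (auto simp: Field_def)
  moreover have "(SOME l. (k, l) \<in> Y \<or> (l, k) \<in> Y) = l"
    using assms chord_unique by (intro some_equality) blast+
  ultimately show ?thesis by (simp add: mate_def)
qed

lemma chord_mate:
  assumes "k \<in> Field Y"
  shows "(k, mate k) \<in> Y \<or> (mate k, k) \<in> Y"
proof -
  obtain l where "(k, l) \<in> Y \<or> (l, k) \<in> Y" using assms by (auto simp: Field_def)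
  then show ?thesis using mate_eq by metis
qed

lemma left_turn_chord:
  assumes "(k, l) \<in> Y"
  shows "left_turn k \<longleftrightarrow> e (k, l) = 1" "left_turn l \<longleftrightarrow> e (k, l) = - 1"
proof -
  have k: "m = l \<and> (k, m) \<in> Y" if "(k, m) \<in> Y \<or> (m, k) \<in> Y" for m
    using chord_unique[of k l m] assms that by blast
  have not_rev: "(l, k) \<notin> Y"
    using gauss_diagramD(4)[OF gauss assms, of "(l, k)"] chordD(3)[OF assms] by auto
  have l: "m = k \<and> (m, l) \<in> Y \<and> (l, m) \<notin> Y" if "(l, m) \<in> Y \<or> (m, l) \<in> Y" for m
    using chord_unique[of l k m] assms that not_rev by blast
  show "left_turn k \<longleftrightarrow> e (k, l) = 1" unfolding left_turn_def using k assms not_rev by metis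
  show "left_turn l \<longleftrightarrow> e (k, l) = - 1" unfolding left_turn_def using l assms by metis
qed

lemma mate_props:
  assumes "k < N"
  shows "mate k < N" "mate (mate k) = k" "k \<in> Field Y \<Longrightarrow> mate k \<noteq> k \<and> left_turn (mate k) = (\<not> left_turn k)"
    "k \<notin> Field Y \<Longrightarrow> mate k = k \<and> \<not> left_turn k"
proof -
  show out: "mate k = k \<and> \<not> left_turn k" if "k \<notin> Field Y"
    using that by (auto simp: mate_def left_turn_def Field_def)
  have chord: "mate k < N \<and> mate (mate k) = k \<and> mate k \<noteq> k \<and> left_turn (mate k) = (\<not> left_turn k)" if "k \<in> Field Y"
    using chord_mate[OF that]
  proof
    assume c: "(k, mate k) \<in> Y"
    then show ?thesis using chordD[OF c] left_turn_chord[OF c] mate_eq[of "mate k" k] by auto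
  next
    assume c: "(mate k, k) \<in> Y"
    then show ?thesis using chordD[OF c] left_turn_chord[OF c] mate_eq[of "mate k" k] by auto
  qed
  show "mate k < N" "mate (mate k) = k" using out chord assms by (cases "k \<in> Field Y"; simp)+
  show "k \<in> Field Y \<Longrightarrow> mate k \<noteq> k \<and> left_turn (mate k) = (\<not> left_turn k)" using chord by blast
qed

lemma leave_less: "k < N \<Longrightarrow> leave k < 2 * N"
  by (simp add: leave_def)

lemma arrive_less: "arrive k < 2 * N"
proof -
  have "(k + N - 1) mod N < N" using N_pos by simp
  then show ?thesis unfolding arrive_def by linarith
qed

lemma leave_inj: "leave k = leave l \<longleftrightarrow> k = l"
  by (simp add: leave_def)

lemma leave_neq_arrive: "leave k \<noteq> arrive l"
proof -
  have "even (leave k)" "odd (arrive l)" by (simp_all add: leave_def arrive_def)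
  then show ?thesis by metis
qed

lemma arrive_position: "k < N \<Longrightarrow> (arrive k div 2 + 1) mod N = k"
  using N_pos unfolding arrive_def by (cases k) (simp_all add: mod_if)

lemma arrive_inj: "k < N \<Longrightarrow> l < N \<Longrightarrow> arrive k = arrive l \<longleftrightarrow> k = l"
  using arrive_position by metis

lemma dart_cases:
  assumes "d < 2 * N"
  obtains k where "k < N" "d = leave k" | k where "k < N" "d = arrive k"
proof (cases "even d")
  case True
  then show thesis using assms that(1)[of "d div 2"] by (auto simp: leave_def)
next
  case False
  define k where "k = (if d div 2 = N - 1 then 0 else d div 2 + 1)"
  have "d div 2 < N" using assms by linarith
  then have "k < N" "(k + N - 1) mod N = d div 2"
    using N_pos by (auto simp: k_def mod_if)
  moreover from this False have "d = arrive k" by (simp add: arrive_def)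
  ultimately show thesis using that(2) by blast
qed

lemma rotation_leave: "k < N \<Longrightarrow> rotation (leave k) = (if left_turn k then leave (mate k) else arrive (mate k))"
  using leave_less[of k] by (simp add: rotation_def leave_def)

lemma rotation_arrive: "k < N \<Longrightarrow> rotation (arrive k) = (if left_turn k then arrive (mate k) else leave (mate k))"
proof -
  assume k: "k < N"
  have "odd (arrive k)" by (simp add: arrive_def)
  then show ?thesis
    using arrive_less[of k] arrive_position[OF k] by (simp add: rotation_def Let_def)
qed

lemma rotation_twice:
  assumes "k < N"
  shows "k \<in> Field Y \<Longrightarrow> rotation (rotation (leave k)) = arrive k \<and> rotation (rotation (arrive k)) = leave k"
    "k \<notin> Field Y \<Longrightarrow> rotation (leave k) = arrive k \<and> rotation (arrive k) = leave k"
  using mate_props[OF assms] assms by (auto simp: rotation_leave rotation_arrive)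

lemma rotation_four:
  assumes "d < 2 * N"
  shows "rotation (rotation (rotation (rotation d))) = d"
  using assms
proof (cases rule: dart_cases)
  case (1 k)
  then show ?thesis using rotation_twice[of k] by (cases "k \<in> Field Y") simp_all
next
  case (2 k)
  then show ?thesis using rotation_twice[of k] by (cases "k \<in> Field Y") simp_all
qed

lemma rotation_less:
  assumes "d < 2 * N" shows "rotation d < 2 * N"
  using assms
proof (cases rule: dart_cases)
  case (1 k)
  then show ?thesis using mate_props(1)[of k] by (simp add: rotation_leave leave_less arrive_less)
next
  case (2 k)
  then show ?thesis using mate_props(1)[of k] by (simp add: rotation_arrive leave_less arrive_less)
qed

lemma permutes_if_power_trivial:
  assumes "\<And>d. d < M \<Longrightarrow> f d < M" "\<And>d. d < M \<Longrightarrow> g (f d) = d" "\<And>d. \<not> d < M \<Longrightarrow> f d = d"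
  shows "f permutes {..<M :: nat}"
proof (rule bij_imp_permutes)
  have "inj_on f {..<M}" by (rule inj_on_inverseI[of _ g]) (simp add: assms(2))
  moreover have "f ` {..<M} \<subseteq> {..<M}" using assms(1) by auto
  ultimately show "bij_betw f {..<M} {..<M}"
    by (simp add: bij_betw_def endo_inj_surj)
qed (use assms(3) in simp)

lemma ribbon_sel [simp]: "darts ribbon = {..<2 * N}" "rot ribbon = rotation" "opp ribbon = reversal"
  "walk ribbon = map (\<lambda>k. 2 * k) [0..<N]" "over_under ribbon = Y"
  by (simp_all add: ribbon_def)

lemma rotation_permutes: "rotation permutes {..<2 * N}"
  using rotation_less rotation_four
  by (rule permutes_if_power_trivial[of _ _ "\<lambda>d. rotation (rotation (rotation d))"]) (simp_all add: rotation_def)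

lemma reversal_permutes: "reversal permutes {..<2 * N}"
proof (rule permutes_if_power_trivial[of _ _ reversal])
  fix d assume "d < 2 * N"
  then show "reversal d < 2 * N" "reversal (reversal d) = d"
    unfolding reversal_def by (auto elim!: evenE oddE) 
qed (simp add: reversal_def)

lemma out_dart_ribbon: "k < N \<Longrightarrow> out_dart ribbon k = leave k"
  by (simp add: out_dart_def leave_def)

lemma in_dart_ribbon: "in_dart ribbon k = arrive k"
proof -
  have "(k + N - 1) mod N < N" using N_pos by simp
  then show ?thesis by (simp add: in_dart_def arrive_def reversal_def)
qed

lemma vertex_leave:
  assumes k: "k < N"
  shows "vertex ribbon (leave k) = {leave k, arrive k, leave (mate k), arrive (mate k)}"
proof -
  have "(rotation ^^ 4) (leave k) = leave k"
    using rotation_four[OF leave_less[OF k]] by (simp add: numeral_eq_Suc)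
  then have "orbit rotation (leave k) = {(rotation ^^ m) (leave k) |m. m < 4}"
    by (rule orbit_altdef_bounded) simp
  also have "\<dots> = (\<lambda>m. (rotation ^^ m) (leave k)) ` {..<4}" by blast
  also have "\<dots> = (\<lambda>m. (rotation ^^ m) (leave k)) ` {0, 1, 2, 3}"
    by (rule arg_cong[of _ _ "image _"]) auto
  also have "\<dots> = {leave k, rotation (leave k), rotation (rotation (leave k)), rotation (rotation (rotation (leave k)))}"
    by (simp add: numeral_eq_Suc)
  also have "\<dots> = {leave k, arrive k, leave (mate k), arrive (mate k)}"
  proof (cases "k \<in> Field Y")
    case True
    have "rotation (rotation (leave k)) = arrive k" using rotation_twice(1)[OF k True] by blast
    then show ?thesis using k by (auto simp: rotation_leave rotation_arrive)
  next
    case False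
    then show ?thesis using rotation_twice(2)[OF k False] mate_props(4)[OF k False] by auto
  qed
  finally show ?thesis by (simp add: vertex_def)
qed

lemma double_points_ribbon: "surface_double_points ribbon = Y \<union> Y\<inverse>"
proof (intro set_eqI iffI)
  fix x assume x: "x \<in> surface_double_points ribbon"
  obtain k l where kl: "x = (k, l)" by (cases x)
  have b: "k < N" "l < N" "k \<noteq> l" "vertex ribbon (leave k) = vertex ribbon (leave l)"
    using x kl by (auto simp: surface_double_points_def out_dart_ribbon)
  have "leave l \<in> {leave k, arrive k, leave (mate k), arrive (mate k)}"
    using b(4) unfolding vertex_leave[OF b(1)] vertex_leave[OF b(2)] by blast
  then have l: "l = mate k" using b(3) by (auto simp: leave_inj leave_neq_arrive)
  then have "k \<in> Field Y" using b(3) mate_props(4)[OF b(1)] by metis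
  from chord_mate[OF this] show "x \<in> Y \<union> Y\<inverse>" using kl l by auto
next
  fix x assume x: "x \<in> Y \<union> Y\<inverse>"
  obtain k l where kl: "x = (k, l)" by (cases x)
  have c: "(k, l) \<in> Y \<or> (l, k) \<in> Y" using x kl by auto
  then have b: "k < N" "l < N" "k \<noteq> l" using chordD by blast+
  have "mate k = l" "mate l = k" using c mate_eq by blast+
  then have "vertex ribbon (leave k) = vertex ribbon (leave l)"
    using vertex_leave[OF b(1)] vertex_leave[OF b(2)] by auto
  then show "x \<in> surface_double_points ribbon"
    using b kl by (simp add: surface_double_points_def out_dart_ribbon)
qed

lemma funpow_dist_four_cycle:
  assumes "f x0 = x1" "f x1 = x2" "f x2 = x3" "f x3 = x0" "distinct [x0, x1, x2, x3]"
  shows "funpow_dist f x0 x1 = 1" "funpow_dist f x0 x2 = 2" "funpow_dist f x0 x3 = 3"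
proof -
  have o: "x1 \<in> orbit f x0" "x2 \<in> orbit f x1" "x3 \<in> orbit f x2" "x2 \<in> orbit f x0" "x3 \<in> orbit f x1" "x3 \<in> orbit f x0"
    using assms(1-4) by (metis orbit.base orbit.step)+
  show "funpow_dist f x0 x1 = 1" "funpow_dist f x0 x2 = 2" "funpow_dist f x0 x3 = 3"
    using assms o by (simp_all add: funpow_dist_step funpow_dist_0)
qed

lemma on_left_ribbon:
  assumes c: "(k, l) \<in> Y \<or> (l, k) \<in> Y"
  shows "on_left ribbon k (out_dart ribbon l) \<longleftrightarrow> left_turn k" "on_left ribbon k (in_dart ribbon l) \<longleftrightarrow> \<not> left_turn k"
proof -
  have b: "k < N" "l < N" "k \<noteq> l" "k \<in> Field Y" using c chordD by blast+
  have m: "mate k = l" "mate l = k" using c mate_eq by blast+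
  have lt: "left_turn l = (\<not> left_turn k)" using mate_props(3)[OF b(1,4)] m by simp
  have ne: "leave k \<noteq> leave l" "leave k \<noteq> arrive k" "leave k \<noteq> arrive l" "leave l \<noteq> arrive k" "leave l \<noteq> arrive l" "arrive k \<noteq> arrive l"
    using leave_inj leave_neq_arrive arrive_inj b by auto
  note r = rotation_leave[OF b(1)] rotation_leave[OF b(2)] rotation_arrive[OF b(1)] rotation_arrive[OF b(2)]
  have "(on_left ribbon k (out_dart ribbon l) \<longleftrightarrow> left_turn k) \<and> (on_left ribbon k (in_dart ribbon l) \<longleftrightarrow> \<not> left_turn k)"
  proof (cases "left_turn k")
    case True
    have "funpow_dist rotation (leave k) (leave l) = 1" "funpow_dist rotation (leave k) (arrive k) = 2"
      "funpow_dist rotation (leave k) (arrive l) = 3"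
      by (rule funpow_dist_four_cycle[of rotation "leave k" "leave l" "arrive k" "arrive l"],
          use ne r m lt True in \<open>simp_all\<close>)+
    then show ?thesis
      using True b by (simp_all add: on_left_def out_dart_ribbon in_dart_ribbon)
  next
    case False
    have "funpow_dist rotation (leave k) (arrive l) = 1" "funpow_dist rotation (leave k) (arrive k) = 2"
      "funpow_dist rotation (leave k) (leave l) = 3"
      by (rule funpow_dist_four_cycle[of rotation "leave k" "arrive l" "arrive k" "leave l"],
          use ne r m lt False in \<open>simp_all\<close>)+
    then show ?thesis
      using False b by (simp_all add: on_left_def out_dart_ribbon in_dart_ribbon)
  qed
  then show "on_left ribbon k (out_dart ribbon l) \<longleftrightarrow> left_turn k" "on_left ribbon k (in_dart ribbon l) \<longleftrightarrow> \<not> left_turn k"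
    by blast+
qed

lemma surface_sign_ribbon:
  assumes "x \<in> Y"
  shows "surface_sign ribbon x = e x"
proof -
  obtain k l where x: "x = (k, l)" by (cases x)
  then show ?thesis
    using on_left_ribbon(1)[of k l] left_turn_chord(1)[of k l] chordD(8)[of k l] assms
    by (auto simp: surface_sign_def)
qed

text \<open>The walk visits every dart or its reverse, hence the surface is connected.\<close>

lemma closed_surface_ribbon: "closed_surface ribbon"
  unfolding closed_surface_def ribbon_sel
proof (intro conjI ballI)
  show "{..<2 * N} \<noteq> {}" using N_pos by (auto simp: lessThan_empty_iff)
  show "rotation permutes {..<2 * N}" "reversal permutes {..<2 * N}" by (fact rotation_permutes reversal_permutes)+
  fix d assume d: "d \<in> {..<2 * N}"
  show "reversal d \<noteq> d" using d by (auto simp: reversal_def elim!: oddE)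
  show "reversal (reversal d) = d"
    using d unfolding reversal_def by (auto elim!: evenE oddE)
  fix d' assume d': "d' \<in> {..<2 * N}"
  let ?R = "{(x, y). y = rotation x \<or> y = reversal x}"
  have r1: "(x, rotation x) \<in> ?R\<^sup>*" for x by (rule r_into_rtrancl) simp
  have r2: "(x, rotation (rotation x)) \<in> ?R\<^sup>*" for x using r1 r1 by (rule rtrancl_trans)
  have turn: "(arrive k, leave k) \<in> ?R\<^sup>*" "(leave k, arrive k) \<in> ?R\<^sup>*" if "k < N" for k
    using rotation_twice[OF that] r1[of "arrive k"] r1[of "leave k"] r2[of "arrive k"] r2[of "leave k"]
    by (cases "k \<in> Field Y"; simp)+
  have next': "(leave k, leave (Suc k mod N)) \<in> ?R\<^sup>*" if "k < N" for k
  proof -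
    have "arrive (Suc k mod N) = reversal (leave k)"
      using that N_pos by (auto simp: arrive_def reversal_def leave_def mod_if)
    then have "(leave k, arrive (Suc k mod N)) \<in> ?R\<^sup>*" by (intro r_into_rtrancl) simp
    then show ?thesis using turn(1)[of "Suc k mod N"] N_pos by (meson mod_less_divisor rtrancl_trans)
  qed
  have walk: "(leave k, leave ((k + i) mod N)) \<in> ?R\<^sup>*" if "k < N" for k i
  proof (induct i)
    case 0
    then show ?case using that by simp
  next
    case (Suc i)
    have "(leave ((k + i) mod N), leave (Suc ((k + i) mod N) mod N)) \<in> ?R\<^sup>*"
      using N_pos by (intro next') simp
    then show ?case using Suc by (simp add: mod_Suc_eq)
  qed
  have all: "(leave k, leave l) \<in> ?R\<^sup>*" if "k < N" "l < N" for k l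
  proof -
    have "(k + (N - k + l)) mod N = l" using that by simp
    then show ?thesis using walk[OF that(1), of "N - k + l"] by simp
  qed
  have "d < 2 * N" "d' < 2 * N" using d d' by simp_all
  have "\<exists>k<N. (d, leave k) \<in> ?R\<^sup>*"
    using \<open>d < 2 * N\<close>
  proof (cases rule: dart_cases)
    case (1 k)
    then show ?thesis using rtrancl.rtrancl_refl by blast
  next
    case (2 k)
    then show ?thesis using turn(1)[of k] by blast
  qed
  then obtain k where k: "k < N" "(d, leave k) \<in> ?R\<^sup>*" by blast
  have "\<exists>l<N. (leave l, d') \<in> ?R\<^sup>*"
    using \<open>d' < 2 * N\<close>
  proof (cases rule: dart_cases)
    case (1 k)
    then show ?thesis using rtrancl.rtrancl_refl by blast
  next
    case (2 k)
    then show ?thesis using turn(2)[of k] by blast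
  qed
  then obtain l where l: "l < N" "(leave l, d') \<in> ?R\<^sup>*" by blast
  show "(d, d') \<in> ?R\<^sup>*"
    using rtrancl_trans[OF rtrancl_trans[OF k(2) all[OF k(1) l(1)]] l(2)] .
qed simp

theorem surface_knot_diagram_ribbon: "surface_knot_diagram ribbon"
proof -
  have len: "length (walk ribbon) = N" by simp
  have "distinct (walk ribbon @ map (opp ribbon) (walk ribbon))"
  proof -
    have "map (opp ribbon) (walk ribbon) = map (\<lambda>k. 2 * k + 1) [0..<N]"
      by (simp add: reversal_def)
    moreover have "distinct (map (\<lambda>k. 2 * k) [0..<N])" "distinct (map (\<lambda>k. 2 * k + 1) [0..<N])"
      by (simp_all add: distinct_map inj_on_def)
    moreover have "set (map (\<lambda>k. 2 * k) [0..<N]) \<inter> set (map (\<lambda>k. 2 * k + 1) [0..<N]) = {}"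
      by auto presburger
    ultimately show ?thesis by (simp only: ribbon_sel distinct_append) 
  qed
  moreover have "\<forall>k<length (walk ribbon). in_dart ribbon k \<in> vertex ribbon (out_dart ribbon k)"
    unfolding len by (simp add: in_dart_ribbon out_dart_ribbon vertex_leave)
  moreover have "\<forall>k l m. (k, l) \<in> surface_double_points ribbon \<and> (l, m) \<in> surface_double_points ribbon \<longrightarrow> k = m"
    unfolding double_points_ribbon using chord_unique by blast
  moreover have "\<forall>(k, l)\<in>surface_double_points ribbon. on_left ribbon k (out_dart ribbon l) \<noteq> on_left ribbon k (in_dart ribbon l)"
    unfolding double_points_ribbon using on_left_ribbon by auto
  moreover have "\<forall>(k, l)\<in>surface_double_points ribbon. ((k, l) \<in> over_under ribbon) \<noteq> ((l, k) \<in> over_under ribbon)"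
  proof -
    have "(l, k) \<notin> Y" if "(k, l) \<in> Y" for k l
      using gauss_diagramD(4)[OF gauss that, of "(l, k)"] chordD(3)[OF that] by auto
    then show ?thesis unfolding double_points_ribbon by auto
  qed
  moreover have "walk ribbon \<noteq> []" using N_pos by simp
  moreover have "set (walk ribbon) \<subseteq> darts ribbon" by auto
  moreover have "over_under ribbon \<subseteq> surface_double_points ribbon" unfolding double_points_ribbon by simp
  ultimately show ?thesis
    unfolding surface_knot_diagram_def using closed_surface_ribbon by (intro conjI)
qed

end

text \<open>The passages are numbered in their order, starting from 1, so that position 0 is left to the basepoint.\<close>

lemma long_realization_exists:
  assumes D: "virtual_diagram_on T D"
  obtains S where "long_realization D S"
proof -
  let ?X = "real_crossings D"
  define F where "F = Field ?X"
  have X: "gauss_diagram ?X (diagram_sign D)" by (rule gauss_diagram_of_diagram[OF D])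
  have finF: "finite F" unfolding F_def using gauss_diagramD(1)[OF X] by (rule finite_Field)
  define \<theta> where "\<theta> = (\<lambda>r. Suc (card {s \<in> F. s < r}))"
  have mono: "strict_mono_on F \<theta>"
  proof (rule strict_mono_onI)
    fix r s assume rs: "r \<in> F" "s \<in> F" "r < s"
    have "{x \<in> F. x < r} \<subset> {x \<in> F. x < s}" using rs by auto
    then show "\<theta> r < \<theta> s" unfolding \<theta>_def using finF by (simp add: psubset_card_mono)
  qed
  have inj: "inj_on \<theta> F" by (rule strict_mono_on_imp_inj_on[OF mono])
  define Y where "Y = map_prod \<theta> \<theta> ` ?X"
  define \<theta>' where "\<theta>' = inv_into F \<theta>"
  define e where "e = (\<lambda>y. diagram_sign D (map_prod \<theta>' \<theta>' y))"
  have XF: "fst x \<in> F" "snd x \<in> F" if "x \<in> ?X" for x using that unfolding F_def by (rule in_Field_fst_snd)+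
  have unrank: "map_prod \<theta>' \<theta>' (map_prod \<theta> \<theta> x) = x" if "x \<in> ?X" for x
    using XF[OF that] inj by (simp add: \<theta>'_def prod_eq_iff)
  have e: "e (map_prod \<theta> \<theta> x) = diagram_sign D x" if "x \<in> ?X" for x
    using unrank[OF that] by (simp add: e_def)
  interpret gauss_code "Suc (card F)" Y e
  proof
    show "gauss_diagram Y e"
      unfolding gauss_diagram_def
    proof (intro conjI ballI)
      have injY: "\<theta> r = \<theta> s \<longleftrightarrow> r = s" if "r \<in> F" "s \<in> F" for r s using inj_on_eq_iff[OF inj that] .
      show "finite Y" using gauss_diagramD(1)[OF X] by (simp add: Y_def)
      note d = gauss_diagramD(4)[OF X]
      show "inj_on fst Y"
      proof (rule inj_onI)
        fix x y assume "x \<in> Y" "y \<in> Y" "fst x = fst y"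
        then obtain x' y' where "x' \<in> ?X" "y' \<in> ?X" "x = map_prod \<theta> \<theta> x'" "y = map_prod \<theta> \<theta> y'" "fst x' = fst y'"
          unfolding Y_def using injY XF by force
        then show "x = y" using d[of x' y'] by blast
      qed
      show "inj_on snd Y"
      proof (rule inj_onI)
        fix x y assume "x \<in> Y" "y \<in> Y" "snd x = snd y"
        then obtain x' y' where "x' \<in> ?X" "y' \<in> ?X" "x = map_prod \<theta> \<theta> x'" "y = map_prod \<theta> \<theta> y'" "snd x' = snd y'"
          unfolding Y_def using injY XF by force
        then show "x = y" using d[of x' y'] by blast
      qed
      have "\<theta> (fst x) \<noteq> \<theta> (snd y)" if "x \<in> ?X" "y \<in> ?X" for x y
        using injY[OF XF(1)[OF that(1)] XF(2)[OF that(2)]] d[OF that] gauss_diagramD(2)[OF X that(1)] by blast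
      then show "fst ` Y \<inter> snd ` Y = {}" unfolding Y_def by fastforce
      show "e y \<in> {1, - 1}" if "y \<in> Y" for y
      proof -
        from that obtain x where "y = map_prod \<theta> \<theta> x" "x \<in> ?X" unfolding Y_def by (rule imageE)
        then show ?thesis using e[of x] gauss_diagramD(3)[OF X, of x] by simp
      qed
    qed
    show "Field Y \<subseteq> {1..<Suc (card F)}"
    proof
      fix i assume "i \<in> Field Y"
      then obtain y where "y \<in> Y" "i = fst y \<or> i = snd y" by (rule Field_obtain)
      then obtain x where "x \<in> ?X" "i = \<theta> (fst x) \<or> i = \<theta> (snd x)" unfolding Y_def by auto
      then obtain r where r: "r \<in> F" "i = \<theta> r" using XF by blast
      have "{s \<in> F. s < r} \<subset> F" using r(1) by blast
      then have "card {s \<in> F. s < r} < card F" using finF by (rule psubset_card_mono[rotated])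
      then show "i \<in> {1..<Suc (card F)}" using r(2) by (simp add: \<theta>_def)
    qed
  qed simp
  have "long_realization D ribbon"
    unfolding long_realization_def ribbon_sel
  proof (intro conjI exI[of _ \<theta>] ballI)
    show "surface_knot_diagram ribbon" by (rule surface_knot_diagram_ribbon)
    show "0 \<notin> Field Y" using positions by auto
    show "strict_mono_on (Field ?X) \<theta>" using mono unfolding F_def .
    show "Y = map_prod \<theta> \<theta> ` ?X" by (rule Y_def)
    show "surface_sign ribbon (map_prod \<theta> \<theta> x) = diagram_sign D x" if "x \<in> ?X" for x
      using surface_sign_ribbon[of "map_prod \<theta> \<theta> x"] e[OF that] imageI[OF that, of "map_prod \<theta> \<theta>"] unfolding Y_def by simp
  qed
  then show thesis by (rule that)
qed

section \<open>Closures of long diagrams\<close>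

lemma has_vector_derivative_glue:
  fixes E h\<^sub>1 h\<^sub>2 :: "real \<Rightarrow> 'a::real_normed_vector"
  assumes h: "(h\<^sub>1 has_vector_derivative d) (at u)" "(h\<^sub>2 has_vector_derivative d) (at u)" and \<delta>: "0 < \<delta>"
    and E: "\<And>s. s \<in> {u - \<delta>..u} \<Longrightarrow> E s = h\<^sub>1 s" "\<And>s. s \<in> {u..u + \<delta>} \<Longrightarrow> E s = h\<^sub>2 s"
  shows "(E has_vector_derivative d) (at u)"
proof -
  have "(E has_vector_derivative d) (at u within {u - \<delta>..u})"
    by (rule has_vector_derivative_transform[OF _ _ has_vector_derivative_at_within[OF h(1)]])
       (use \<delta> E(1) in simp_all)
  moreover have "(E has_vector_derivative d) (at u within {u..u + \<delta>})"
    by (rule has_vector_derivative_transform[OF _ _ has_vector_derivative_at_within[OF h(2)]])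
       (use \<delta> E(2) in simp_all)
  ultimately have "(E has_vector_derivative d) (at u within {u - \<delta>..u} \<union> {u..u + \<delta>})"
    unfolding has_vector_derivative_def has_derivative_within by (blast intro: Lim_Un)
  moreover have "{u - \<delta>..u} \<union> {u..u + \<delta>} = {u - \<delta>..u + \<delta>}" using \<delta> by auto
  moreover have "at u within {u - \<delta>..u + \<delta>} = at u" using \<delta> by (intro at_within_Icc_at) simp_all
  ultimately show ?thesis by simp
qed

lemma isCont_glue:
  fixes E h\<^sub>1 h\<^sub>2 :: "real \<Rightarrow> 'a::real_normed_vector"
  assumes h: "isCont h\<^sub>1 u" "isCont h\<^sub>2 u" and \<delta>: "0 < \<delta>"
    and E: "\<And>s. s \<in> {u - \<delta>..u} \<Longrightarrow> E s = h\<^sub>1 s" "\<And>s. s \<in> {u..u + \<delta>} \<Longrightarrow> E s = h\<^sub>2 s"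
  shows "isCont E u"
proof -
  have e: "E u = h\<^sub>1 u" "E u = h\<^sub>2 u" using E(1)[of u] E(2)[of u] \<delta> by simp_all
  have "(E \<longlongrightarrow> E u) (at u within {u - \<delta>..u})"
  proof (rule Lim_transform_eventually)
    show "(h\<^sub>1 \<longlongrightarrow> E u) (at u within {u - \<delta>..u})"
      using h(1) unfolding e(1) isCont_def by (rule Lim_at_imp_Lim_at_within)
    show "\<forall>\<^sub>F s in at u within {u - \<delta>..u}. h\<^sub>1 s = E s"
      unfolding eventually_at_filter using E(1) by (intro always_eventually) simp
  qed
  moreover have "(E \<longlongrightarrow> E u) (at u within {u..u + \<delta>})"
  proof (rule Lim_transform_eventually)
    show "(h\<^sub>2 \<longlongrightarrow> E u) (at u within {u..u + \<delta>})"
      using h(2) unfolding e(2) isCont_def by (rule Lim_at_imp_Lim_at_within)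
    show "\<forall>\<^sub>F s in at u within {u..u + \<delta>}. h\<^sub>2 s = E s"
      unfolding eventually_at_filter using E(2) by (intro always_eventually) simp
  qed
  ultimately have "(E \<longlongrightarrow> E u) (at u within {u - \<delta>..u} \<union> {u..u + \<delta>})" by (rule Lim_Un)
  moreover have "{u - \<delta>..u} \<union> {u..u + \<delta>} = {u - \<delta>..u + \<delta>}" using \<delta> by auto
  moreover have "at u within {u - \<delta>..u + \<delta>} = at u" using \<delta> by (intro at_within_Icc_at) simp_all
  ultimately show ?thesis by (simp add: isCont_def)
qed

definition periodic_glue :: "(real \<Rightarrow> 'a) \<Rightarrow> (real \<Rightarrow> 'a) \<Rightarrow> real \<Rightarrow> 'a" where
  "periodic_glue f g u = (if frac u \<le> 1/2 then f (frac u) else g (frac u))"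

text \<open>Near every parameter, the glued function coincides on either side with a translate of one of the pieces.\<close>

lemma periodic_glue_local:
  obtains \<delta> :: real and n m :: int and b c :: bool where "0 < \<delta>"
    "\<forall>f g :: real \<Rightarrow> 'a. f (1/2) = g (1/2) \<longrightarrow> g 1 = f 0 \<longrightarrow>
       (\<forall>s\<in>{u - \<delta>..u}. periodic_glue f g s = (if b then f else g) (s - of_int n)) \<and>
       (\<forall>s\<in>{u..u + \<delta>}. periodic_glue f g s = (if c then f else g) (s - of_int m))"
proof -
  define k where "k = \<lfloor>u\<rfloor>"
  define x where "x = frac u"
  have u: "u = of_int k + x" by (simp add: k_def x_def frac_def)
  have x: "0 \<le> x" "x < 1" by (simp_all add: x_def frac_lt_1)
  have fr: "frac s = s - of_int i" if "of_int i \<le> s" "s < of_int i + 1" for s :: real and i :: int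
    using that by (simp add: frac_unique_iff)
  consider "x = 0" | "0 < x" "x < 1/2" | "x = 1/2" | "1/2 < x" using x by linarith
  then show thesis
  proof cases
    case 1
    show thesis
    proof (rule that[of "1/4" False "k - 1" True k]; (intro allI impI conjI ballI)?)
      fix f g :: "real \<Rightarrow> 'a" and s assume glue: "g 1 = f 0" and s: "s \<in> {u - 1/4..u}"
      show "periodic_glue f g s = (if False then f else g) (s - of_int (k - 1))"
      proof (cases "s = u")
        case True
        then have "frac s = 0" "s - of_int (k - 1) = 1" using fr[of k s] u 1 by simp_all
        then show ?thesis using glue by (simp add: periodic_glue_def)
      next
        case False
        then show ?thesis using fr[of "k - 1" s] s u 1 by (simp add: periodic_glue_def)
      qed
    next
      fix f g :: "real \<Rightarrow> 'a" and s assume s: "s \<in> {u..u + 1/4}"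
      then show "periodic_glue f g s = (if True then f else g) (s - of_int k)"
        using fr[of k s] u 1 by (simp add: periodic_glue_def)
    qed simp
  next
    case 2
    define \<delta> where "\<delta> = min x (1/2 - x)"
    have d: "0 < \<delta>" "\<delta> \<le> x" "x + \<delta> \<le> 1/2" using 2 by (auto simp: \<delta>_def min_def)
    have *: "periodic_glue f g s = (if True then f else g) (s - of_int k)"
      if "u - \<delta> \<le> s" "s \<le> u + \<delta>" for f g :: "real \<Rightarrow> 'a" and s
      using fr[of k s] that d u by (simp add: periodic_glue_def)
    show thesis
      by (rule that[of \<delta> True k True k]; (intro allI impI conjI ballI *)?) (use d(1) in simp_all)
  next
    case 3
    show thesis
    proof (rule that[of "1/4" True k False k]; (intro allI impI conjI ballI)?)
      fix f g :: "real \<Rightarrow> 'a" and s assume s: "s \<in> {u - 1/4..u}"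
      then show "periodic_glue f g s = (if True then f else g) (s - of_int k)"
        using fr[of k s] u 3 by (simp add: periodic_glue_def)
    next
      fix f g :: "real \<Rightarrow> 'a" and s assume glue: "f (1/2) = g (1/2)" and s: "s \<in> {u..u + 1/4}"
      show "periodic_glue f g s = (if False then f else g) (s - of_int k)"
      proof (cases "s = u")
        case True
        then have "frac s = 1/2" "s - of_int k = 1/2" using fr[of k s] u 3 by simp_all
        then show ?thesis unfolding periodic_glue_def using glue by (simp only: order_refl if_True if_False)
      next
        case False
        then show ?thesis using fr[of k s] s u 3 by (simp add: periodic_glue_def)
      qed
    qed simp
  next
    case 4
    define \<delta> where "\<delta> = min (x - 1/2) (1 - x) / 2"
    have d: "0 < \<delta>" "1/2 < x - \<delta>" "x + \<delta> < 1" using 4 x by (auto simp: \<delta>_def min_def field_simps)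
    have *: "periodic_glue f g s = (if False then f else g) (s - of_int k)"
      if "u - \<delta> \<le> s" "s \<le> u + \<delta>" for f g :: "real \<Rightarrow> 'a" and s
      using fr[of k s] that d u by (simp add: periodic_glue_def)
    show thesis
      by (rule that[of \<delta> False k False k]; (intro allI impI conjI ballI *)?) (use d(1) in simp_all)
  qed
qed

lemma periodic_glue_C1:
  fixes f g f' g' :: "real \<Rightarrow> 'a::real_normed_vector"
  assumes f: "\<And>t. (f has_vector_derivative f' t) (at t)" "\<And>t. isCont f' t"
    and g: "\<And>t. (g has_vector_derivative g' t) (at t)" "\<And>t. isCont g' t"
    and glue: "f (1/2) = g (1/2)" "g 1 = f 0" "f' (1/2) = g' (1/2)" "g' 1 = f' 0"
  shows "(periodic_glue f g has_vector_derivative periodic_glue f' g' u) (at u)"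
    and "isCont (periodic_glue f' g') u"
proof -
  have shift: "((\<lambda>s. (if b then f else g) (s - r)) has_vector_derivative (if b then f' else g') (u - r)) (at u)" for b and r :: real
  proof -
    have "((\<lambda>s. s - r) has_vector_derivative 1) (at u)"
      by (auto intro!: derivative_eq_intros simp flip: has_real_derivative_iff_has_vector_derivative)
    from vector_diff_chain_at[OF this, of "if b then f else g" "(if b then f' else g') (u - r)"]
    show ?thesis using f(1) g(1) by (simp add: comp_def split: if_splits)
  qed
  have shiftC: "isCont (\<lambda>s. (if b then f' else g') (s - r)) u" for b and r :: real
  proof (rule isCont_o2[of _ "\<lambda>s. s - r"])
    show "isCont (if b then f' else g') (u - r)" using f(2) g(2) by simp
  qed simp
  obtain \<delta> :: real and n m :: int and b c :: bool where \<delta>: "0 < \<delta>"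
    and loc: "\<forall>f g :: real \<Rightarrow> 'a. f (1/2) = g (1/2) \<longrightarrow> g 1 = f 0 \<longrightarrow>
       (\<forall>s\<in>{u - \<delta>..u}. periodic_glue f g s = (if b then f else g) (s - of_int n)) \<and>
       (\<forall>s\<in>{u..u + \<delta>}. periodic_glue f g s = (if c then f else g) (s - of_int m))"
    by (rule periodic_glue_local[where u = u and 'a = 'a])
  note loc = loc[THEN spec, THEN spec, THEN mp, THEN mp]
  note L = loc[OF glue(1,2), THEN conjunct1, THEN bspec] and R = loc[OF glue(1,2), THEN conjunct2, THEN bspec]
    and L' = loc[OF glue(3,4), THEN conjunct1, THEN bspec] and R' = loc[OF glue(3,4), THEN conjunct2, THEN bspec]
  have mem: "u \<in> {u - \<delta>..u}" "u \<in> {u..u + \<delta>}" using \<delta> by simp_all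
  show "(periodic_glue f g has_vector_derivative periodic_glue f' g' u) (at u)"
  proof (rule has_vector_derivative_glue[OF _ _ \<delta> L R])
    show "((\<lambda>s. (if b then f else g) (s - of_int n)) has_vector_derivative periodic_glue f' g' u) (at u)"
      unfolding L'[OF mem(1)] by (rule shift)
    show "((\<lambda>s. (if c then f else g) (s - of_int m)) has_vector_derivative periodic_glue f' g' u) (at u)"
      unfolding R'[OF mem(2)] by (rule shift)
  qed
  show "isCont (periodic_glue f' g') u"
    by (rule isCont_glue[OF shiftC shiftC \<delta> L' R'])
qed

text \<open>
  The returning arc runs from R to -R around the upper half of the disk. Its angle, a multiple of
  \<open>3 v\<^sup>2 - 2 v\<^sup>3\<close>, has vanishing derivative at both ends, and its distance from the origin starts and ends with the
  slope \<open>\<plusminus> 4 R\<close>; so its velocity there is that of the axis, rescaled by 4 R.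
\<close>

definition return_arc :: "real \<Rightarrow> real \<Rightarrow> complex" where
  "return_arc R u = (let v = 2 * u - 1 in of_real (R * (1 + 2 * v * (1 - v))) * cis (pi * (3 * v^2 - 2 * v^3)))"

definition return_velocity :: "real \<Rightarrow> real \<Rightarrow> complex" where
  "return_velocity R u = (let v = 2 * u - 1 in
     (of_real (4 * R * (1 - 2 * v)) + of_real (R * (1 + 2 * v * (1 - v)) * (12 * pi * v * (1 - v))) * \<i>)
       * cis (pi * (3 * v^2 - 2 * v^3)))"

lemma return_arc_derivative: "(return_arc R has_vector_derivative return_velocity R u) (at u)"
proof -
  define v where "v = 2 * u - 1"
  have angle: "((\<lambda>u. pi * (3 * (2 * u - 1)^2 - 2 * (2 * u - 1)^3)) has_vector_derivative (12 * pi * v * (1 - v))) (at u)"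
    unfolding v_def has_real_derivative_iff_has_vector_derivative[symmetric]
    by (auto intro!: derivative_eq_intros simp: power2_eq_square algebra_simps)
  have cis: "(cis has_vector_derivative \<i> * cis t) (at t)" for t
    unfolding cis_conv_exp
    by (auto intro!: derivative_eq_intros has_vector_derivative_real_field simp: mult.commute)
  have turn: "((\<lambda>u. cis (pi * (3 * (2 * u - 1)^2 - 2 * (2 * u - 1)^3))) has_vector_derivative
      (12 * pi * v * (1 - v)) *\<^sub>R (\<i> * cis (pi * (3 * v^2 - 2 * v^3)))) (at u)"
    using vector_diff_chain_at[OF angle cis] by (simp add: comp_def v_def)
  have radius: "((\<lambda>u. complex_of_real (R * (1 + 2 * (2 * u - 1) * (1 - (2 * u - 1))))) has_vector_derivative
      of_real (4 * R * (1 - 2 * v))) (at u)"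
  proof (rule has_vector_derivative_of_real)
    show "((\<lambda>u. R * (1 + 2 * (2 * u - 1) * (1 - (2 * u - 1)))) has_real_derivative 4 * R * (1 - 2 * v)) (at u)"
      unfolding v_def by (auto intro!: derivative_eq_intros simp: algebra_simps)
  qed
  from has_vector_derivative_mult[OF radius turn]
  show ?thesis
    unfolding return_arc_def[abs_def] return_velocity_def Let_def v_def[symmetric]
    by (simp add: v_def[symmetric] scaleR_conv_of_real algebra_simps)
qed

lemma return_velocity_isCont: "isCont (return_velocity R) u"
proof -
  have "continuous_on UNIV (return_velocity R)"
    unfolding return_velocity_def[abs_def] Let_def by (intro continuous_intros)
  then show ?thesis by (simp add: continuous_on_eq_continuous_at)
qed

lemma norm_return_arc:
  assumes "0 < R" "u \<in> {1/2..1}"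
  shows "R \<le> norm (return_arc R u)"
proof -
  have "0 \<le> 2 * (2 * u - 1) * (1 - (2 * u - 1))" using assms(2) by (intro mult_nonneg_nonneg) simp_all
  then have "R * 1 \<le> R * (1 + 2 * (2 * u - 1) * (1 - (2 * u - 1)))" using assms(1) by (intro mult_left_mono) simp_all
  then have "R \<le> \<bar>R * (1 + 2 * (2 * u - 1) * (1 - (2 * u - 1)))\<bar>" by linarith
  then show ?thesis unfolding return_arc_def Let_def norm_mult norm_cis norm_of_real by simp
qed

lemma return_angle_mono:
  fixes v w :: real
  assumes "0 \<le> v" "v < w" "w \<le> 1"
  shows "3 * v^2 - 2 * v^3 < 3 * w^2 - 2 * w^3"
proof -
  have "0 < (w - v) * (3 * (v + w) - 2 * (v^2 + v * w + w^2))"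
  proof (rule mult_pos_pos)
    have le: "v * v \<le> v * 1" "w * w \<le> w * 1" "v * w \<le> v * 1" "v * w \<le> 1 * w" using assms by (intro mult_mono; simp)+
    have lin: "2 * (x + y + z) < 3 * (v + w)" if "x \<le> v * 1" "z \<le> w * 1" "y \<le> v * 1" "y \<le> 1 * w" for x y z
      using that assms(2) by simp
    from lin[OF le] show "0 < 3 * (v + w) - 2 * (v^2 + v * w + w^2)" by (simp add: power2_eq_square)
  qed (use assms in simp)
  then show ?thesis by (simp add: power2_eq_square power3_eq_cube algebra_simps)
qed

lemma inj_on_return_arc:
  assumes "0 < R"
  shows "inj_on (return_arc R) {1/2..1}"
proof (rule inj_onI)
  have *: False if st: "s \<in> {1/2..1}" "t \<in> {1/2..1}" "s < t" and eq: "return_arc R s = return_arc R t" for s t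
  proof -
    let ?\<rho> = "\<lambda>u. R * (1 + 2 * (2 * u - 1) * (1 - (2 * u - 1)))"
    let ?\<theta> = "\<lambda>u. pi * (3 * (2 * u - 1)^2 - 2 * (2 * u - 1)^3)"
    have pos: "0 < ?\<rho> u" if "u \<in> {1/2..1}" for u
    proof -
      have "0 \<le> 2 * (2 * u - 1) * (1 - (2 * u - 1))" using that by (intro mult_nonneg_nonneg) simp_all
      then have "0 < 1 + 2 * (2 * u - 1) * (1 - (2 * u - 1))" by (rule add_pos_nonneg[OF zero_less_one])
      with assms show ?thesis by (rule mult_pos_pos)
    qed
    have "norm (return_arc R u) = ?\<rho> u" if "u \<in> {1/2..1}" for u
      unfolding return_arc_def Let_def norm_mult norm_cis norm_of_real abs_of_pos[OF pos[OF that]] by simp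
    then have "?\<rho> s = ?\<rho> t" using st(1,2) eq by metis
    then have cis: "cis (?\<theta> s) = cis (?\<theta> t)"
      using eq pos[OF st(1)] unfolding return_arc_def Let_def by (metis less_irrefl mult_left_cancel of_real_eq_0_iff)
    have "0 \<le> 3 * (2 * s - 1)^2 - 2 * (2 * s - 1)^3"
    proof (cases "2 * s - 1 = 0")
      case True
      show ?thesis unfolding True by simp
    next
      case False
      then show ?thesis using return_angle_mono[of 0 "2 * s - 1"] st(1) by simp
    qed
    moreover have "3 * (2 * t - 1)^2 - 2 * (2 * t - 1)^3 \<le> 1"
    proof (cases "2 * t - 1 = 1")
      case True
      show ?thesis unfolding True by simp
    next
      case False
      then show ?thesis using return_angle_mono[of "2 * t - 1" 1] st(2) by simp
    qed
    moreover have "3 * (2 * s - 1)^2 - 2 * (2 * s - 1)^3 < 3 * (2 * t - 1)^2 - 2 * (2 * t - 1)^3"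
      using return_angle_mono[of "2 * s - 1" "2 * t - 1"] st by simp
    ultimately have "0 \<le> ?\<theta> s" "?\<theta> s < ?\<theta> t" "?\<theta> t \<le> pi * 1" by (simp_all only: mult_left_mono mult_strict_left_mono pi_gt_zero pi_ge_zero mult_nonneg_nonneg)
    then have "cos (?\<theta> t) < cos (?\<theta> s)" by (intro cos_monotone_0_pi) simp_all
    moreover have "cos (?\<theta> s) = cos (?\<theta> t)" using arg_cong[OF cis, of Re] by simp
    ultimately show False by simp
  qed
  fix s t assume "s \<in> {1/2..1}" "t \<in> {1/2..1}" "return_arc R s = return_arc R t"
  then show "s = t" using *[of s t] *[of t s] by (cases s t rule: linorder_cases) simp_all
qed

lemma return_velocity_nonzero:
  assumes "0 < R" "u \<in> {1/2..1}"
  shows "return_velocity R u \<noteq> 0"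
proof
  define v where "v = 2 * u - 1"
  have v: "0 \<le> v" "v \<le> 1" using assms(2) by (simp_all add: v_def)
  assume "return_velocity R u = 0"
  then have "complex_of_real (4 * R * (1 - 2 * v)) + of_real (R * (1 + 2 * v * (1 - v)) * (12 * pi * v * (1 - v))) * \<i> = 0"
    unfolding return_velocity_def Let_def v_def[symmetric] by simp
  then have "4 * R * (1 - 2 * v) = 0" "R * (1 + 2 * v * (1 - v)) * (12 * pi * v * (1 - v)) = 0"
    unfolding complex_eq_iff by simp_all
  then have "v = 1/2" using assms(1) by simp
  then show False
    using \<open>R * (1 + 2 * v * (1 - v)) * (12 * pi * v * (1 - v)) = 0\<close> assms(1) unfolding \<open>v = 1/2\<close> by simp
qed

text \<open>
  The disk has to exceed both the part of the line on which the curve differs from the axis and the image of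
  that part.
\<close>

lemma long_diagram_disk:
  assumes "long_diagram D"
  obtains R where "0 < R" "\<And>t. R \<le> \<bar>t\<bar> \<Longrightarrow> curve D t = of_real t" "\<And>t. \<bar>t\<bar> < R \<Longrightarrow> norm (curve D t) < R"
    "velocity (curve D) R = 1" "velocity (curve D) (- R) = 1"
proof -
  obtain R\<^sub>0 where R0: "\<And>t. R\<^sub>0 \<le> \<bar>t\<bar> \<Longrightarrow> curve D t = of_real t" and V: "virtual_diagram_on UNIV D"
    using assms unfolding long_diagram_def by blast
  note C1 = virtual_diagram_onD(1)[OF V]
  have "compact (curve D ` {- \<bar>R\<^sub>0\<bar>..\<bar>R\<^sub>0\<bar>})"
    using C1_differentiable_imp_continuous_on[OF C1] by (intro compact_continuous_image) (auto intro: continuous_on_subset)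
  then obtain M where M: "\<And>t. t \<in> {- \<bar>R\<^sub>0\<bar>..\<bar>R\<^sub>0\<bar>} \<Longrightarrow> norm (curve D t) \<le> M"
    using compact_imp_bounded bounded_iff by (metis imageI)
  define R where "R = max \<bar>R\<^sub>0\<bar> M + 1"
  have R: "\<bar>R\<^sub>0\<bar> < R" "M < R" "0 < R" by (auto simp: R_def)
  have far: "curve D t = of_real t" if "\<bar>R\<^sub>0\<bar> \<le> \<bar>t\<bar>" for t using R0 that by simp
  have vel: "velocity (curve D) r = 1" if "\<bar>R\<^sub>0\<bar> < \<bar>r\<bar>" for r
  proof -
    have "((\<lambda>x. complex_of_real x) has_vector_derivative of_real 1) (at r)"
      by (rule has_vector_derivative_of_real) (rule DERIV_ident)
    then have id: "(complex_of_real has_vector_derivative 1) (at r)" by simp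
    define d where "d = (\<bar>r\<bar> - \<bar>R\<^sub>0\<bar>) / 2"
    have "0 < d" using that by (simp add: d_def)
    moreover have "curve D s = of_real s" if "s \<in> {r - d..r + d}" for s
      using that by (intro far) (auto simp: d_def abs_if field_simps split: if_splits)
    ultimately show ?thesis
      by (intro velocity_unique_on_interval[OF velocity_works[OF C1] id, of "r - d" "r + d"]) simp_all
  qed
  show thesis
  proof (rule that[OF R(3)])
    show "curve D t = of_real t" if "R \<le> \<bar>t\<bar>" for t using that R by (intro far) simp
    show "norm (curve D t) < R" if "\<bar>t\<bar> < R" for t
    proof (cases "\<bar>t\<bar> \<le> \<bar>R\<^sub>0\<bar>")
      case True
      then have "norm (curve D t) \<le> M" by (intro M) auto
      then show ?thesis using R by simp
    next
      case False
      then show ?thesis using far[of t] that by simp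
    qed
  qed (use vel R in simp_all)
qed

text \<open>The part of the long diagram in a large disk, followed by the returning arc, is a closed curve of class C1.\<close>

lemma closure_diagram_exists:
  assumes long: "long_diagram D"
  obtains E where "closure_diagram D E"
proof -
  obtain R where R: "0 < R" and far: "\<And>t. R \<le> \<bar>t\<bar> \<Longrightarrow> curve D t = of_real t"
    and near: "\<And>t. \<bar>t\<bar> < R \<Longrightarrow> norm (curve D t) < R"
    and vel: "velocity (curve D) R = 1" "velocity (curve D) (- R) = 1"
    using long_diagram_disk[OF long] by metis
  have V: "virtual_diagram_on UNIV D" using long unfolding long_diagram_def by blast
  note C1 = virtual_diagram_onD(1)[OF V]
  let ?A = "\<lambda>u. R * (4 * u - 1)"
  define f where "f = (\<lambda>u. curve D (?A u))"
  define f' where "f' = (\<lambda>u. (4 * R) *\<^sub>R velocity (curve D) (?A u))"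
  define c where "c = periodic_glue f (return_arc R)"
  define c' where "c' = periodic_glue f' (return_velocity R)"
  define X where "X = {(u, v). u \<in> {0..1/2} \<and> v \<in> {0..1/2} \<and> (?A u, ?A v) \<in> real_crossings D}"
  define E where "E = \<lparr>curve = c, real_crossings = X\<rparr>"
  have f: "(f has_vector_derivative f' t) (at t)" for t
  proof -
    have "(?A has_vector_derivative 4 * R) (at t)"
      unfolding has_real_derivative_iff_has_vector_derivative[symmetric]
      by (auto intro!: derivative_eq_intros)
    from vector_diff_chain_at[OF this velocity_works[OF C1]] show ?thesis by (simp add: comp_def f_def f'_def)
  qed
  have "isCont (velocity (curve D)) t" for t
    using C1 unfolding C1_differentiable_on_eq velocity_def[abs_def] by (simp add: continuous_on_eq_continuous_at)
  then have f'C: "isCont f' t" for t unfolding f'_def by (intro continuous_intros isCont_o2[of _ ?A]) simp_all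
  have glue: "f (1/2) = return_arc R (1/2)" "return_arc R 1 = f 0"
    "f' (1/2) = return_velocity R (1/2)" "return_velocity R 1 = f' 0"
    using far[of R] far[of "- R"] R vel
    by (simp_all add: f_def f'_def return_arc_def return_velocity_def Let_def scaleR_conv_of_real)
  have der: "(c has_vector_derivative c' u) (at u)" "isCont c' u" for u
    unfolding c_def c'_def using periodic_glue_C1[OF f f'C return_arc_derivative return_velocity_isCont glue] by blast+
  have velc: "velocity c u = c' u" for u using der(1) by (rule velocity_eqI)
  have c_first: "c u = f u" "c' u = f' u" if "u \<in> {0..1/2}" for u
  proof -
    have "frac u = u" using that by (simp add: frac_eq)
    then show "c u = f u" "c' u = f' u" using that by (simp_all add: c_def c'_def periodic_glue_def)
  qed
  have c_second: "c u = return_arc R u" "c' u = return_velocity R u" if "u \<in> {1/2..1}" for u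
  proof -
    have "u = 1/2 \<or> u = 1 \<or> 1/2 < u \<and> u < 1" using that unfolding atLeastAtMost_iff by linarith
    then consider "u = 1/2" | "u = 1" | "1/2 < u" "u < 1" by blast
    then have "c u = return_arc R u \<and> c' u = return_velocity R u"
    proof cases
      case 1
      show ?thesis using c_first[of "1/2"] glue unfolding 1 by simp
    next
      case 2
      then have "frac u = 0" by simp
      then show ?thesis using glue 2 by (simp add: c_def c'_def periodic_glue_def)
    next
      case 3
      then have "frac u = u" by (simp add: frac_eq)
      then show ?thesis using 3 by (simp add: c_def c'_def periodic_glue_def)
    qed
    then show "c u = return_arc R u" "c' u = return_velocity R u" by blast+
  qed
  have outer: "R \<le> norm (c u)" if "u \<in> {1/2..1}" for u
    unfolding c_second(1)[OF that] by (rule norm_return_arc[OF R that])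
  have inj: "inj_on c {1/2..1}"
    using inj_on_return_arc[OF R] c_second(1) by (simp add: inj_on_def)
  have per: "c (t + 1) = c t" for t by (simp add: c_def periodic_glue_def frac_1_eq)
  have C1c: "c C1_differentiable_on UNIV"
    unfolding C1_differentiable_on_def
    using der by (intro exI[of _ c']) (simp add: continuous_on_eq_continuous_at)
  have nonzero: "velocity c u \<noteq> 0" for u
  proof -
    have "velocity c u = c' (frac u)" using velocity_periodic[OF C1c per, of u] velc by simp
    moreover have "c' x \<noteq> 0" if "0 \<le> x" "x < 1" for x
    proof (cases "x \<le> 1/2")
      case True
      have "velocity (curve D) (?A x) \<noteq> 0" using V unfolding virtual_diagram_on_def by blast
      then show ?thesis using c_first(2)[of x] True that R by (simp add: f'_def)
    next
      case False
      then show ?thesis using c_second(2)[of x] return_velocity_nonzero[OF R, of x] that by simp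
    qed
    ultimately show ?thesis by (simp add: frac_lt_1)
  qed
  have A_inj: "?A u = ?A v \<longleftrightarrow> u = v" for u v using R by simp
  have inner: "s \<in> {0..1/2}" if s: "s \<in> {0..<1}" and t: "t \<in> {0..<1}" and st: "s \<noteq> t" "c s = c t" for s t
  proof (rule ccontr)
    assume "s \<notin> {0..1/2}"
    then have s': "s \<in> {1/2..1}" using s by simp
    show False
    proof (cases "t \<in> {1/2..1}")
      case True
      then show False using inj_onD[OF inj st(2) s'] st(1) by blast
    next
      case False
      then have t': "t \<in> {0..1/2}" "t < 1/2" using t by auto
      show False
      \<comment> \<open>The parameters 0 and 1 give the same point, so that s would have to be 1.\<close>
      proof (cases "t = 0")
        case True
        then have "c s = c 1" using st(2) per[of 0] by simp
        then have "s = 1" using inj_onD[OF inj _ s', of 1] by simp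
        then show False using s by simp
      next
        case False
        then have "R * (4 * t - 1) < R * 1" "R * (- 1) < R * (4 * t - 1)"
          using t' R by (intro mult_strict_left_mono; simp)+
        then have "\<bar>?A t\<bar> < R" by (simp add: abs_less_iff)
        then have "norm (c t) < R" unfolding c_first(1)[OF t'(1)] f_def by (rule near)
        then show False using outer[OF s'] st(2) by simp
      qed
    qed
  qed
  have dp: "s \<in> {0..1/2} \<and> t \<in> {0..1/2} \<and> (?A s, ?A t) \<in> double_points UNIV (curve D)"
    if "(s, t) \<in> double_points {0..<1} c" for s t
  proof -
    have st: "s \<in> {0..<1}" "t \<in> {0..<1}" "s \<noteq> t" "c s = c t" using that by (simp_all add: double_points_def)
    have "s \<in> {0..1/2}" by (rule inner[OF st])
    moreover have "t \<in> {0..1/2}" by (rule inner[OF st(2,1) st(3)[symmetric] st(4)[symmetric]])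
    ultimately show ?thesis
      using st(3,4) A_inj[of s t] c_first(1)[of s] c_first(1)[of t] by (simp add: double_points_def f_def)
  qed
  have "virtual_diagram_on {0..<1} E"
    unfolding virtual_diagram_on_def
  proof (intro conjI allI ballI impI)
    show "curve E C1_differentiable_on UNIV" using C1c by (simp add: E_def)
    show "velocity (curve E) t \<noteq> 0" for t using nonzero by (simp add: E_def)
    have "finite (double_points UNIV (curve D))" using V unfolding virtual_diagram_on_def by blast
    moreover have "inj (map_prod ?A ?A)" using A_inj by (intro injI) (simp add: prod_eq_iff)
    ultimately have "finite (map_prod ?A ?A -` double_points UNIV (curve D))" by (rule finite_vimageI)
    moreover have "double_points {0..<1} (curve E) \<subseteq> map_prod ?A ?A -` double_points UNIV (curve D)"
      using dp by (auto simp: E_def)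
    ultimately show "finite (double_points {0..<1} (curve E))" by (rule finite_subset[rotated])
    fix x assume "x \<in> double_points {0..<1} (curve E)"
    then obtain s t where st: "x = (s, t)" "(s, t) \<in> double_points {0..<1} c" by (cases x) (simp add: E_def)
    note d = dp[OF st(2)]
    have "det2 (velocity (curve D) (?A s)) (velocity (curve D) (?A t)) \<noteq> 0"
      using V d unfolding virtual_diagram_on_def by fast
    then show "case x of (s, t) \<Rightarrow> det2 (velocity (curve E) s) (velocity (curve E) t) \<noteq> 0"
      using d R by (simp add: st(1) E_def velc c_first(2) f'_def det2_scaleR)
  next
    fix s t u :: real assume T: "s \<in> {0..<1}" "t \<in> {0..<1}" "u \<in> {0..<1}" and eq: "curve E s = curve E t \<and> curve E t = curve E u"
    show "s = t \<or> t = u \<or> s = u"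
    proof (rule ccontr)
      assume ne: "\<not> (s = t \<or> t = u \<or> s = u)"
      have eq': "c s = c t" "c t = c u" using eq by (simp_all add: E_def)
      have "(s, t) \<in> double_points {0..<1} c" "(t, u) \<in> double_points {0..<1} c"
        using T ne eq' by (simp_all add: double_points_def)
      from dp[OF this(1)] dp[OF this(2)] have i: "s \<in> {0..1/2}" "t \<in> {0..1/2}" "u \<in> {0..1/2}" by blast+
      then have "curve D (?A s) = curve D (?A t)" "curve D (?A t) = curve D (?A u)"
        using eq' c_first(1) by (simp_all add: f_def)
      then show False using virtual_diagram_onD(5)[OF V, of "?A s" "?A t" "?A u"] ne A_inj by blast
    qed
  next
    show "real_crossings E \<subseteq> double_points {0..<1} (curve E)"
    proof
      fix x assume "x \<in> real_crossings E"
      then obtain s t where st: "x = (s, t)" "s \<in> {0..1/2}" "t \<in> {0..1/2}" "(?A s, ?A t) \<in> real_crossings D"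
        by (auto simp: E_def X_def)
      have "?A s \<noteq> ?A t" "curve D (?A s) = curve D (?A t)" using virtual_diagram_onD(3)[OF V st(4)] by simp_all
      then show "x \<in> double_points {0..<1} (curve E)"
        using st c_first(1)[OF st(2)] c_first(1)[OF st(3)] by (auto simp: double_points_def E_def f_def)
    qed
    fix s t assume "(s, t) \<in> real_crossings E"
    then show "(t, s) \<notin> real_crossings E"
      using virtual_diagram_onD(6)[OF V, of "(?A s, ?A t)"] by (auto simp: E_def X_def)
  qed
  then have "closed_diagram E" using per by (simp add: closed_diagram_def E_def)
  then have "closure_diagram D E"
    unfolding closure_diagram_def
    using long R far near outer inj c_first(1)
    by (intro conjI exI[of _ R]) (simp_all add: E_def X_def f_def)
  then show thesis by (rule that)
qed

text \<open>The parameters of all crossings lie in the disk, so that the closure has the same Gauss diagram.\<close>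

lemma closure_crossings:
  assumes "closure_diagram D E"
  obtains A where "strict_mono A" "real_crossings D = map_prod A A ` real_crossings E"
    "\<And>x. x \<in> real_crossings E \<Longrightarrow> diagram_sign D (map_prod A A x) = diagram_sign E x"
proof -
  obtain R where R: "0 < R" and far: "\<forall>t. R \<le> \<bar>t\<bar> \<longrightarrow> curve D t = of_real t"
    and near: "\<forall>t. \<bar>t\<bar> < R \<longrightarrow> norm (curve D t) < R"
    and first: "\<forall>u\<in>{0..1/2}. curve E u = curve D (R * (4 * u - 1))"
    and X: "real_crossings E = {(u, v). u \<in> {0..1/2} \<and> v \<in> {0..1/2} \<and>
             (R * (4 * u - 1), R * (4 * v - 1)) \<in> real_crossings D}"
    and long: "long_diagram D" and closed: "closed_diagram E"
    using assms unfolding closure_diagram_def by blast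
  have V: "virtual_diagram_on UNIV D" "virtual_diagram_on {0..<1} E"
    using long closed unfolding long_diagram_def closed_diagram_def by blast+
  note C1 = virtual_diagram_onD(1)[OF V(1)] virtual_diagram_onD(1)[OF V(2)]
  let ?A = "\<lambda>u. R * (4 * u - 1)"
  have mono: "strict_mono ?A" using R by (intro strict_monoI) simp
  \<comment> \<open>The curve is injective on the part outside the disk and does not return there.\<close>
  have small: "\<bar>s\<bar> < R" if "s \<noteq> t" "curve D s = curve D t" for s t
  proof (rule ccontr)
    assume "\<not> \<bar>s\<bar> < R"
    then have s: "curve D s = of_real s" "R \<le> \<bar>s\<bar>" using far by simp_all
    then have "R \<le> norm (curve D t)" using that(2) by (metis norm_of_real)
    then have "curve D t = of_real t" using far near by (meson not_le)
    then show False using s that by simp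
  qed
  have lift: "\<exists>u\<in>{0..1/2}. ?A u = s" if "\<bar>s\<bar> < R" for s
  proof (rule bexI[of _ "(s / R + 1) / 4"])
    show "?A ((s / R + 1) / 4) = s" using R by (simp add: field_simps)
    have "- 1 \<le> s / R" "s / R \<le> 1" using that R by (auto simp: field_simps abs_less_iff)
    moreover have "0 \<le> (x + 1) / 4 \<and> (x + 1) / 4 \<le> 1/2" if "- 1 \<le> x" "x \<le> 1" for x :: real
      using that by simp
    ultimately show "(s / R + 1) / 4 \<in> {0..1/2}" unfolding atLeastAtMost_iff by blast
  qed
  show thesis
  proof (rule that[OF mono])
    show "real_crossings D = map_prod ?A ?A ` real_crossings E"
    proof (intro set_eqI iffI)
      fix x assume x: "x \<in> real_crossings D"
      note d = virtual_diagram_onD(3)[OF V(1) x]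
      obtain u where u: "u \<in> {0..1/2}" "?A u = fst x" using lift[OF small[of "fst x" "snd x"]] d by blast
      obtain v where v: "v \<in> {0..1/2}" "?A v = snd x" using lift[OF small[of "snd x" "fst x"]] d by metis
      have "x = map_prod ?A ?A (u, v)" using u(2) v(2) by (simp add: prod_eq_iff)
      moreover have "(u, v) \<in> real_crossings E" unfolding X using u v x by simp
      ultimately show "x \<in> map_prod ?A ?A ` real_crossings E" by (rule image_eqI)
    next
      fix x assume "x \<in> map_prod ?A ?A ` real_crossings E"
      then show "x \<in> real_crossings D" unfolding X by auto
    qed
    have vel: "velocity (curve E) u = (4 * R) *\<^sub>R velocity (curve D) (?A u)" if "u \<in> {0..1/2}" for u
    proof (rule velocity_unique_on_interval[OF velocity_works[OF C1(2)] _ _ that])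
      have "(?A has_vector_derivative 4 * R) (at u)"
        unfolding has_real_derivative_iff_has_vector_derivative[symmetric] by (auto intro!: derivative_eq_intros)
      from vector_diff_chain_at[OF this velocity_works[OF C1(1)]]
      show "((\<lambda>u. curve D (?A u)) has_vector_derivative (4 * R) *\<^sub>R velocity (curve D) (?A u)) (at u)"
        by (simp add: comp_def)
      show "curve E s = curve D (?A s)" if "s \<in> {0..1/2}" for s using first that by blast
    qed simp
    fix x assume "x \<in> real_crossings E"
    then have "fst x \<in> {0..1/2}" "snd x \<in> {0..1/2}" unfolding X by auto
    then show "diagram_sign D (map_prod ?A ?A x) = diagram_sign E x"
      using R by (simp add: diagram_sign_def case_prod_beta vel det2_scaleR zero_less_mult_iff)
  qed
qed

section \<open>The polynomials of surface diagrams\<close>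

text \<open>Since \<open>\<beta>\<close> is the whole knot minus \<open>\<alpha>\<close>, its intersection numbers are expressed by those of \<open>\<alpha>\<close>.\<close>

lemma (in knot_on_surface) long_surface_polys:
  "(W_long_diag a S, F_diag a b S, G_diag a b S, H_diag a b S)
     = gauss_polys (over_under S) (surface_sign S) a b"
proof -
  let ?X = "over_under S" and ?e = "surface_sign S"
  let ?w = "typed_weight ?e"
  let ?u = "\<lambda>x. pairing ?X ?e (alpha_arc x) (\<lambda>_. 1)"
  let ?n = "\<lambda>x y. pairing ?X ?e (alpha_arc x) (alpha_arc y)"
  let ?i = "intersection_number S"
  note fin = gauss_diagramD(1)[OF gauss_diagram_of_surface]
  note ne = gauss_diagramD(2)[OF gauss_diagram_of_surface]
  have dp: "(min (fst x) (snd x), max (fst x) (snd x)) \<in> surface_double_points S"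
    "(max (fst x) (snd x), min (fst x) (snd x)) \<in> surface_double_points S" if "x \<in> ?X" for x
    unfolding double_points_partition using that by (cases x; auto simp: min_def max_def)+
  have arcs: "alpha S x = arc_cycle S (min (fst x) (snd x)) (max (fst x) (snd x))"
    "beta S x = arc_cycle S (max (fst x) (snd x)) (min (fst x) (snd x))" for x
    by (cases x; simp add: alpha_def beta_def)+
  have aa: "?i (alpha S x) (alpha S y) = ?n x y div 4" if "x \<in> ?X" "y \<in> ?X" for x y
    unfolding arcs alpha_arc_def by (rule intersection_number_arcs[OF dp(1)[OF that(1)] dp(1)[OF that(2)]])
  have "?i (alpha S x) (beta S y) = pairing ?X ?e (alpha_arc x) (beta_arc y) div 4" if "x \<in> ?X" "y \<in> ?X" for x y
    unfolding arcs alpha_arc_def beta_arc_def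
    by (rule intersection_number_arcs[OF dp(1)[OF that(1)] dp(2)[OF that(2)]])
  then have ab: "?i (alpha S x) (beta S y) = (2 * ?u x - ?n x y) div 4" if "x \<in> ?X" "y \<in> ?X" for x y
    using that pairing_alpha_beta[OF ne[OF that(2)]] by simp
  have "?i (beta S x) (beta S y) = pairing ?X ?e (beta_arc x) (beta_arc y) div 4" if "x \<in> ?X" "y \<in> ?X" for x y
    unfolding arcs beta_arc_def by (rule intersection_number_arcs[OF dp(2)[OF that(1)] dp(2)[OF that(2)]])
  then have bb: "?i (beta S x) (beta S y) = (2 * ?u y - 2 * ?u x + ?n x y) div 4" if "x \<in> ?X" "y \<in> ?X" for x y
    using that pairing_beta_beta[OF ne[OF that(1)] ne[OF that(2)]] by simp
  have half: "(2 * m) div 4 = m div 2" for m :: int by presburger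
  have self: "?i (alpha S x) (beta S x) = ?u x div 2" if "x \<in> ?X" for x
    using ab[OF that that] by (simp add: half)
  have typed: "typed_crossings S a = {x \<in> ?X. if a = 0 then fst x < snd x else snd x < fst x}" for a
    by (auto simp: typed_crossings_def)
  have single: "(\<Sum>x\<in>typed_crossings S a. of_int (?e x) * f x) = (\<Sum>x\<in>?X. of_int (?w a x) * f x)"
    for a and f :: "nat \<times> nat \<Rightarrow> laurent"
    unfolding typed sum.inter_filter[OF fin] by (rule sum.cong) (simp_all add: typed_weight_def)
  have double: "(\<Sum>x\<in>typed_crossings S a. \<Sum>y\<in>typed_crossings S b. of_int (?e x * ?e y) * f x y)
      = (\<Sum>x\<in>?X. \<Sum>y\<in>?X. of_int (?w a x * ?w b y) * f x y)"
    for a b and f :: "nat \<times> nat \<Rightarrow> nat \<times> nat \<Rightarrow> laurent"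
    unfolding of_int_mult mult.assoc sum_distrib_left[symmetric] single ..
  have writhe: "typed_writhe S a = (\<Sum>x\<in>?X. ?w a x)" for a
    unfolding typed_writhe_def typed sum.inter_filter[OF fin] by (rule sum.cong) (simp_all add: typed_weight_def)
  have W: "W_long_diag a S = poly_W ?X (?w a) ?u" for a
    unfolding W_long_diag_def single poly_W_def weighted_sum_def by (rule sum.cong) (simp_all add: self)
  have F: "F_diag a b S = poly_F ?X (?w a) (?w b) ?n"
    unfolding F_diag_def double poly_F_def weighted_double_sum_def
    by (intro sum.cong refl) (simp add: aa)
  have "(\<Sum>x\<in>?X. \<Sum>y\<in>?X. of_int (?w a x * ?w b y) * (t_pow (?i (alpha S x) (beta S y)) - 1)) =
      weighted_double_sum ?X (?w a) (?w b) (\<lambda>x y. (2 * ?u x - ?n x y) div 4)"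
    unfolding weighted_double_sum_def by (intro sum.cong refl) (simp add: ab)
  then have G: "G_diag a b S = poly_G ?X (?w a) (?w b) ?u ?n"
    unfolding G_diag_def double poly_G_def writhe W by simp
  have "(\<Sum>x\<in>?X. \<Sum>y\<in>?X. of_int (?w a x * ?w b y) * (t_pow (?i (beta S x) (beta S y)) - 1)) =
      weighted_double_sum ?X (?w a) (?w b) (\<lambda>x y. (2 * ?u y - 2 * ?u x + ?n x y) div 4)"
    unfolding weighted_double_sum_def by (intro sum.cong refl) (simp add: bb)
  then have H: "H_diag a b S = poly_H ?X (?w a) (?w b) ?u ?n"
    unfolding H_diag_def double poly_H_def writhe W by simp
  show ?thesis unfolding gauss_polys_def long_polys_def W F G H ..
qed

lemma (in knot_on_surface) closed_surface_polys:
  "(W_diag S, I_diag S, II_diag S) = closed_gauss_polys (over_under S) (surface_sign S)"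
proof -
  let ?X = "over_under S" and ?e = "surface_sign S"
  let ?g = "\<lambda>x. cyclic_arc (fst x) (snd x)" and ?g' = "\<lambda>x. cyclic_arc (snd x) (fst x)"
  let ?i = "intersection_number S" and ?p = "\<lambda>f g. pairing ?X ?e f g div 4"
  have dp: "(fst x, snd x) \<in> surface_double_points S" "(snd x, fst x) \<in> surface_double_points S"
    if "x \<in> ?X" for x
    unfolding double_points_partition using that by simp_all
  have arcs: "gamma S x = arc_cycle S (fst x) (snd x)" "gamma_bar S x = arc_cycle S (snd x) (fst x)" for x
    by (cases x; simp add: gamma_def gamma_bar_def)+
  have i: "?i (gamma S x) (gamma S y) = ?p (?g x) (?g y)" "?i (gamma S x) (gamma_bar S y) = ?p (?g x) (?g' y)"
    "?i (gamma_bar S x) (gamma_bar S y) = ?p (?g' x) (?g' y)" if "x \<in> ?X" "y \<in> ?X" for x y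
    unfolding arcs by (rule intersection_number_arcs; rule dp; rule that)+
  have W: "W_diag S = weighted_sum ?X ?e (\<lambda>x. ?p (?g x) (?g' x))"
    unfolding W_diag_def weighted_sum_def by (rule sum.cong) (simp_all add: i)
  let ?s = "\<lambda>f h. \<Sum>x\<in>?X. \<Sum>y\<in>?X. of_int (?e x * ?e y) * (t_pow (?i (f x) (h y)) - 1)"
  let ?d = "\<lambda>f h. weighted_double_sum ?X ?e ?e (\<lambda>x y. ?p (f x) (h y))"
  have "?s (gamma S) (gamma S) = ?d ?g ?g" "?s (gamma S) (gamma_bar S) = ?d ?g ?g'"
    "?s (gamma_bar S) (gamma_bar S) = ?d ?g' ?g'"
    unfolding weighted_double_sum_def by (intro sum.cong refl; simp add: i)+
  then show ?thesis
    unfolding closed_gauss_polys_def Let_def I_diag_def II_diag_def writhe_def W[symmetric]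
    by (simp only: prod.inject)
qed

lemma long_realization_polys:
  assumes "long_realization D S"
  shows "(W_long_diag a S, F_diag a b S, G_diag a b S, H_diag a b S) = diagram_polys D a b"
proof -
  obtain \<theta> where \<theta>: "strict_mono_on (Field (real_crossings D)) \<theta>"
      "over_under S = map_prod \<theta> \<theta> ` real_crossings D"
      "\<And>x. x \<in> real_crossings D \<Longrightarrow> surface_sign S (map_prod \<theta> \<theta> x) = diagram_sign D x"
    using assms unfolding long_realization_def by blast
  interpret knot_on_surface S by (rule knot_on_surface.intro) (use assms in \<open>simp add: long_realization_def\<close>)
  show ?thesis
    unfolding long_surface_polys diagram_polys_def \<theta>(2) by (rule gauss_polys_image[OF \<theta>(1)]) (rule \<theta>(3))
qed

lemma closed_realization_polys:
  assumes "closed_realization D S"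
  shows "(W_diag S, I_diag S, II_diag S) = closed_diagram_polys D"
proof -
  obtain \<theta> where \<theta>: "inj_on \<theta> (Field (real_crossings D))"
      "\<forall>r\<in>Field (real_crossings D). \<forall>s\<in>Field (real_crossings D). \<forall>t\<in>Field (real_crossings D).
        r < s \<and> s < t \<longrightarrow> cyclic_order (\<theta> r) (\<theta> s) (\<theta> t)"
      "over_under S = map_prod \<theta> \<theta> ` real_crossings D"
      "\<forall>x\<in>real_crossings D. surface_sign S (map_prod \<theta> \<theta> x) = diagram_sign D x"
    using assms unfolding closed_realization_def by (elim conjE exE) (rule that; assumption)
  interpret knot_on_surface S by (rule knot_on_surface.intro) (use assms in \<open>simp add: closed_realization_def\<close>)
  have order: "cyclic_order k l m = cyc k l m" for k l m by (simp add: cyclic_order_def cyc_def)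
  show ?thesis
    unfolding closed_surface_polys closed_diagram_polys_def \<theta>(3)
  proof (rule closed_gauss_polys_image[OF \<theta>(1)])
    fix r s t assume "r \<in> Field (real_crossings D)" "s \<in> Field (real_crossings D)" "t \<in> Field (real_crossings D)"
      "r < s" "s < t"
    then show "cyc (\<theta> r) (\<theta> s) (\<theta> t)" using \<theta>(2)[unfolded order] by metis
  next
    fix x assume "x \<in> real_crossings D"
    with \<theta>(4) show "surface_sign S (map_prod \<theta> \<theta> x) = diagram_sign D x" by (rule bspec)
  qed
qed

section \<open>Invariance\<close>

lemma equivclp_invariant:
  assumes "\<And>x y. r x y \<Longrightarrow> f y = f x" "equivclp r x y"
  shows "f y = f x"
  using assms(2)
proof (induction rule: equivclp_induct)
  case base
  show ?case ..
next
  case (step y z)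
  then show ?case using assms(1)[of y z] assms(1)[of z y] by metis
qed

lemma diagram_polys_move:
  assumes D: "parameter_domain T D" "parameter_domain T D'" and "move_I T D D' \<or> move_II T D D' \<or> move_III T D D'"
  shows "diagram_polys D' = diagram_polys D"
  using assms(3) diagram_polys_move_I[OF D] diagram_polys_move_II[OF D] diagram_polys_move_III[OF D]
  by (intro ext) metis

lemma long_equivalent_polys:
  assumes "long_equivalent D D'"
  shows "diagram_polys D' = diagram_polys D"
proof -
  have move: "diagram_polys D\<^sub>2 = diagram_polys D\<^sub>1"
    if "long_diagram D\<^sub>1 \<and> long_diagram D\<^sub>2 \<and>
      (long_isotopy D\<^sub>1 D\<^sub>2 \<or> move_I UNIV D\<^sub>1 D\<^sub>2 \<or> move_II UNIV D\<^sub>1 D\<^sub>2 \<or> move_III UNIV D\<^sub>1 D\<^sub>2)" for D\<^sub>1 D\<^sub>2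
  proof -
    have V: "virtual_diagram_on UNIV D\<^sub>1" "virtual_diagram_on UNIV D\<^sub>2"
      using that unfolding long_diagram_def by blast+
    then have "parameter_domain UNIV D\<^sub>1" "parameter_domain UNIV D\<^sub>2" by (simp_all add: parameter_domain_def)
    from diagram_polys_move[OF this] diagram_polys_long_isotopy[OF V(1)] that show ?thesis by blast
  qed
  show ?thesis
    by (rule equivclp_invariant[OF move assms[unfolded long_equivalent_def]])
qed

text \<open>
  By the proposition for Gauss diagrams, the polynomials of a closed diagram cut open at 0 determine those
  of the closed diagram itself, so that moves away from 0 need no separate treatment.
\<close>

lemma closed_polys_determined:
  assumes "gauss_diagram X e" "gauss_diagram X' e'" "gauss_polys X' e' = gauss_polys X e"
  shows "closed_gauss_polys X' e' = closed_gauss_polys X e"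
proof -
  obtain W00 F00 G00 H00 W01 F01 G01 H01 W10 F10 G10 H10 W11 F11 G11 H11 where
    P: "gauss_polys X e 0 0 = (W00, F00, G00, H00)" "gauss_polys X e 0 1 = (W01, F01, G01, H01)"
      "gauss_polys X e 1 0 = (W10, F10, G10, H10)" "gauss_polys X e 1 1 = (W11, F11, G11, H11)"
    by (metis prod_cases4)
  show ?thesis
    unfolding closed_gauss_polys_eq[OF assms(1) P] closed_gauss_polys_eq[OF assms(2) P[folded assms(3)]] ..
qed

lemma closed_equivalent_polys:
  assumes "closed_equivalent E E'"
  shows "closed_diagram_polys E' = closed_diagram_polys E"
proof -
  have move: "closed_diagram_polys E\<^sub>2 = closed_diagram_polys E\<^sub>1"
    if "closed_diagram E\<^sub>1 \<and> closed_diagram E\<^sub>2 \<and>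
      (closed_isotopy E\<^sub>1 E\<^sub>2 \<or> move_I {0..<1} E\<^sub>1 E\<^sub>2 \<or> move_II {0..<1} E\<^sub>1 E\<^sub>2 \<or> move_III {0..<1} E\<^sub>1 E\<^sub>2)" for E\<^sub>1 E\<^sub>2
  proof (cases "closed_isotopy E\<^sub>1 E\<^sub>2")
    case True
    with that show ?thesis using closed_diagram_polys_isotopy by blast
  next
    case False
    have V: "virtual_diagram_on {0..<1} E\<^sub>1" "virtual_diagram_on {0..<1} E\<^sub>2"
      using that unfolding closed_diagram_def by blast+
    have "parameter_domain {0..<1} E\<^sub>1" "parameter_domain {0..<1} E\<^sub>2"
      using that V unfolding closed_diagram_def parameter_domain_def by simp_all
    from diagram_polys_move[OF this] have "diagram_polys E\<^sub>2 = diagram_polys E\<^sub>1" using that False by blast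
    then show ?thesis
      unfolding diagram_polys_def closed_diagram_polys_def
      by (rule closed_polys_determined[OF gauss_diagram_of_diagram[OF V(1)] gauss_diagram_of_diagram[OF V(2)]])
  qed
  show ?thesis
    by (rule equivclp_invariant[OF move assms[unfolded closed_equivalent_def]])
qed

section \<open>Long knots and their closures\<close>

lemma closure_diagram_polys:
  assumes "closure_diagram D E"
  shows "closed_diagram_polys E = closed_diagram_polys D"
proof -
  obtain A where A: "strict_mono A" "real_crossings D = map_prod A A ` real_crossings E"
    "\<And>x. x \<in> real_crossings E \<Longrightarrow> diagram_sign D (map_prod A A x) = diagram_sign E x"
    using closure_crossings[OF assms] by blast
  have m: "strict_mono_on (Field (real_crossings E)) A" using A(1) by (simp add: strict_mono_on_def strict_mono_def)
  show ?thesis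
    unfolding closed_diagram_polys_def A(2)
    by (rule closed_gauss_polys_image[symmetric, OF strict_mono_on_imp_inj_on[OF m]])
      (rule strict_mono_on_cyc[OF m] A(3); assumption)+
qed

text \<open>No new surface is needed for the closure, only the basepoint is forgotten.\<close>

lemma closure_realization:
  assumes "closure_diagram D E" "long_realization D S"
  shows "closed_realization E S"
proof -
  obtain A where A: "strict_mono A" "real_crossings D = map_prod A A ` real_crossings E"
    "\<And>x. x \<in> real_crossings E \<Longrightarrow> diagram_sign D (map_prod A A x) = diagram_sign E x"
    using closure_crossings[OF assms(1)] by blast
  obtain \<theta> where \<theta>: "strict_mono_on (Field (real_crossings D)) \<theta>"
      "over_under S = map_prod \<theta> \<theta> ` real_crossings D"
      "\<And>x. x \<in> real_crossings D \<Longrightarrow> surface_sign S (map_prod \<theta> \<theta> x) = diagram_sign D x"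
    using assms(2) unfolding long_realization_def by blast
  have in_Field: "A r \<in> Field (real_crossings D)" if "r \<in> Field (real_crossings E)" for r
    using that unfolding A(2) by (elim Field_obtain) (force simp: Field_def)
  have m: "strict_mono_on (Field (real_crossings E)) (\<theta> \<circ> A)"
  proof (rule strict_mono_onI)
    fix r s assume rs: "r \<in> Field (real_crossings E)" "s \<in> Field (real_crossings E)" "r < s"
    show "(\<theta> \<circ> A) r < (\<theta> \<circ> A) s"
      using strict_mono_onD[OF \<theta>(1) in_Field[OF rs(1)] in_Field[OF rs(2)] strict_monoD[OF A(1) rs(3)]] by simp
  qed
  have prod: "map_prod (\<theta> \<circ> A) (\<theta> \<circ> A) x = map_prod \<theta> \<theta> (map_prod A A x)" for x by (cases x) simp
  show ?thesis
    unfolding closed_realization_def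
  proof (intro conjI exI[of _ "\<theta> \<circ> A"] ballI impI)
    show "surface_knot_diagram S" using assms(2) by (simp add: long_realization_def)
    show "inj_on (\<theta> \<circ> A) (Field (real_crossings E))" by (rule strict_mono_on_imp_inj_on[OF m])
    show "over_under S = map_prod (\<theta> \<circ> A) (\<theta> \<circ> A) ` real_crossings E"
      unfolding \<theta>(2) A(2) image_image prod ..
    show "surface_sign S (map_prod (\<theta> \<circ> A) (\<theta> \<circ> A) x) = diagram_sign E x" if "x \<in> real_crossings E" for x
      unfolding prod using \<theta>(3)[of "map_prod A A x"] A(2) A(3)[OF that] that by simp
    show "cyclic_order ((\<theta> \<circ> A) r) ((\<theta> \<circ> A) s) ((\<theta> \<circ> A) t)"
      if "r \<in> Field (real_crossings E)" "s \<in> Field (real_crossings E)" "t \<in> Field (real_crossings E)" "r < s \<and> s < t"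
      for r s t
      using strict_mono_on_cyc[OF m that(1-3)] that(4) unfolding cyc_def cyclic_order_def by blast
  qed
qed

text \<open>
  The description has a value because a realization exists, and only one because the polynomials of D are
  invariant.
\<close>

lemma long_invariant_value:
  assumes D: "long_diagram D"
    and P: "\<And>D' S. long_realization D' S \<Longrightarrow> P S = g (diagram_polys D')"
  shows "long_invariant P {D'. long_equivalent D D'} = g (diagram_polys D)"
  unfolding long_invariant_def
proof (rule the_equality)
  obtain S where S: "long_realization D S"
    using long_realization_exists D unfolding long_diagram_def by blast
  have "long_equivalent D D" unfolding long_equivalent_def by (rule equivclp_refl)
  with S show "\<exists>D'\<in>{D'. long_equivalent D D'}. \<exists>S. long_realization D' S \<and> g (diagram_polys D) = P S"
    using P by (intro bexI[of _ D] exI[of _ S]) simp_all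
next
  fix p assume "\<exists>D'\<in>{D'. long_equivalent D D'}. \<exists>S. long_realization D' S \<and> p = P S"
  then show "p = g (diagram_polys D)" using P long_equivalent_polys by fastforce
qed

lemma long_knot_polys:
  assumes D: "long_diagram D" and K: "K = {D'. long_equivalent D D'}"
  shows "diagram_polys D a b = (W_long a K, F_long a b K, G_long a b K, H_long a b K)"
proof -
  have "W_long a K = fst (diagram_polys D a b)"
    unfolding W_long_def K
    by (rule long_invariant_value[OF D]) (simp add: long_realization_polys[symmetric])
  moreover have "F_long a b K = fst (snd (diagram_polys D a b))"
    unfolding F_long_def K
    by (rule long_invariant_value[OF D]) (simp add: long_realization_polys[symmetric])
  moreover have "G_long a b K = fst (snd (snd (diagram_polys D a b)))"
    unfolding G_long_def K
    by (rule long_invariant_value[OF D]) (simp add: long_realization_polys[symmetric])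
  moreover have "H_long a b K = snd (snd (snd (diagram_polys D a b)))"
    unfolding H_long_def K
    by (rule long_invariant_value[OF D]) (simp add: long_realization_polys[symmetric])
  ultimately show ?thesis by simp
qed

lemma closed_invariant_value:
  assumes D: "long_diagram D" and K: "K = {D'. long_equivalent D D'}"
    and P: "\<And>E S. closed_realization E S \<Longrightarrow> P S = g (closed_diagram_polys E)"
  shows "closed_invariant P (closure_knot K) = g (closed_diagram_polys D)"
  unfolding closed_invariant_def
proof (rule the_equality)
  obtain S where S: "long_realization D S"
    using long_realization_exists D unfolding long_diagram_def by blast
  obtain E where E: "closure_diagram D E" by (rule closure_diagram_exists[OF D])
  have "long_equivalent D D" unfolding long_equivalent_def by (rule equivclp_refl)
  moreover have "closed_equivalent E E" unfolding closed_equivalent_def by (rule equivclp_refl)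
  ultimately have "E \<in> closure_knot K" unfolding closure_knot_def K using E by blast
  moreover note R = closure_realization[OF E S]
  moreover have "g (closed_diagram_polys D) = P S" using P[OF R] closure_diagram_polys[OF E] by simp
  ultimately show "\<exists>E\<in>closure_knot K. \<exists>S. closed_realization E S \<and> g (closed_diagram_polys D) = P S" by blast
next
  fix p assume "\<exists>E\<in>closure_knot K. \<exists>S. closed_realization E S \<and> p = P S"
  then obtain D' E E' S where *: "long_equivalent D D'" "closure_diagram D' E" "closed_equivalent E E'"
    "closed_realization E' S" "p = P S"
    unfolding closure_knot_def K by blast
  have D': "long_diagram D'" using *(2) unfolding closure_diagram_def by blast
  have "closed_diagram_polys D' = closed_diagram_polys D"
    using closed_polys_determined[OF gauss_diagram_of_diagram gauss_diagram_of_diagram, of UNIV D UNIV D']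
      long_equivalent_polys[OF *(1)] D D'
    unfolding long_diagram_def closed_diagram_polys_def diagram_polys_def by blast
  then show "p = g (closed_diagram_polys D)"
    using *(5) P[OF *(4)] closed_equivalent_polys[OF *(3)] closure_diagram_polys[OF *(2)] by simp
qed

theorem proposition10p1:
  fixes K :: "diagram set"
  assumes "K \<in> long_virtual_knots"
  shows "writhe_polynomial (closure_knot K) = W_long 0 K + invert (W_long 1 K) \<and>
         first_intersection_polynomial (closure_knot K) =
           F_long 0 1 K + G_long 0 0 K + invert (G_long 1 1 K) + invert (H_long 0 1 K) \<and>
         second_intersection_polynomial (closure_knot K) =
           F_long 0 0 K + F_long 1 1 K
           + G_long 0 1 K + invert (G_long 0 1 K) + G_long 1 0 K + invert (G_long 1 0 K)
           + H_long 0 0 K + H_long 1 1 K"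
proof -
  obtain D where D: "long_diagram D" and K: "K = {D'. long_equivalent D D'}"
    using assms unfolding long_virtual_knots_def by (auto elim!: quotientE)
  have "gauss_diagram (real_crossings D) (diagram_sign D)"
    using D gauss_diagram_of_diagram unfolding long_diagram_def by blast
  \<comment> \<open>One diagram computes the polynomials of K as well as those of its closure.\<close>
  note eq = closed_gauss_polys_eq[OF this, folded diagram_polys_def closed_diagram_polys_def,
      OF long_knot_polys[OF D K] long_knot_polys[OF D K] long_knot_polys[OF D K] long_knot_polys[OF D K]]
  have "writhe_polynomial (closure_knot K) = fst (closed_diagram_polys D)"
    unfolding writhe_polynomial_def
    by (rule closed_invariant_value[OF D K]) (simp add: closed_realization_polys[symmetric])
  moreover have "first_intersection_polynomial (closure_knot K) = fst (snd (closed_diagram_polys D))"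
    unfolding first_intersection_polynomial_def
    by (rule closed_invariant_value[OF D K]) (simp add: closed_realization_polys[symmetric])
  moreover have "second_intersection_polynomial (closure_knot K) = snd (snd (closed_diagram_polys D))"
    unfolding second_intersection_polynomial_def
    by (rule closed_invariant_value[OF D K]) (simp add: closed_realization_polys[symmetric])
  ultimately show ?thesis unfolding eq by simp
qed

end
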